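(* Let $\mathscr T=(V,\mathcal E)$ be the directed Cartesian product of locally finite rooted directed trees $\mathscr T_1,\ldots,\mathscr T_d$, of finite joint branching index. Let $S_{\boldsymbol\lambda_{\mathfrak c}}$ be a multishift belonging to $\mathcal S_{\mathscr T}$. Let $E$ denote the joint kernel of $S_{\boldsymbol\lambda_{\mathfrak c}}^*$ and let $\mathcal L_{u,F}$ be the subspaces in the decomposition $E=\bigoplus_{F\in\mathscr P}\bigoplus_{u\in\Omega_F}\mathcal L_{u,F}$. Then $S_{\boldsymbol\lambda_{\mathfrak c}}$ is unitarily equivalent to the multiplication $d$-tuple $\mathscr M_z=(\mathscr M_{z_1},\ldots,\mathscr M_{z_d})$ on a reproducing kernel Hilbert space $\mathscr H_{\mathfrak c}(\mathscr T)$ of $E$-valued holomorphic functions defined on the open ball $\mathbb B^d_r$ in $\mathbb C^d$ for some positive $r$. Further, the reproducing kernel $\kappa_{\mathscr H_{\mathfrak c}(\mathscr T)}:\mathbb B^d_r\times\mathbb B^d_r\to B(E)$ associated with $\mathscr H_{\mathfrak c}(\mathscr T)$ is given by $$\kappa_{\mathscr H_{\mathfrak c}(\mathscr T)}(z,w)=\sum_{F\in\mathscr P}\sum_{u\in\Omega_F}\Big(\sum_{\alpha\in\mathbb N^d}\frac{\mathsf d_u!}{(\mathsf d_u+\alpha)!}\prod_{j=0}^{|\alpha|-1}\frac{|\mathsf d_u|+d+j}{\mathfrak c(|\mathsf d_u|+j)}\,z^\alpha\overline w^\alpha\Big)P_{\mathcal L_{u,F}},\quad z,w\in\mathbb B^d_r,$$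 where $P_{\mathcal L_{u,F}}$ is the orthogonal projection on $\mathcal L_{u,F}$.
   Context: Conventions: $\mathbb N=\{0,1,2,\ldots\}$; for $\alpha\in\mathbb N^d$, $\alpha!=\prod_j\alpha_j!$ and $|\alpha|=\sum_j\alpha_j$; empty products are $1$. $\mathscr P$ is the set of all subsets of $\{1,\ldots,d\}$. $\mathbb B^d_r$ is the open ball of radius $r$ centered at the origin in $\mathbb C^d$. $B(E)$ is the algebra of bounded linear operators on $E$. Trees: a rooted directed tree is a connected directed graph without circuits in which every vertex has at most one parent and exactly one vertex (the root) has no parent. $\mathsf{Chi}(u)$ is the set of children of $u$; for a non-root $u$, $\mathsf{par}(u)$ is its parent and $\mathsf{sib}(u)=\mathsf{Chi}(\mathsf{par}(u))$ (so $u\in\mathsf{sib}(u)$). All directed trees are assumed countably infinite and leafless (every vertex has at least one child). Locally finite: every $\mathsf{Chi}(u)$ is finite. The depth of $u$ is the length of the path from the root to $u$. Products: for rooted directed trees $\mathscr T_j=(V_j,\mathcal E_j)$ with roots $\mathsf{root}_j$, the directed Cartesian product $\mathscr T=(V,\mathcal E)$ has $V=V_1\times\cdots\times V_d$ and $(v,w)\in\mathcal E$ iff there is $k$ with $v_j=w_j$ for $j\neq k$ and $(v_k,w_k)\in\mathcal E_k$. Put $\mathsf{root}=(\mathsf{root}_1,\ldots,\mathsf{root}_d)$. The depth of $v\in V$ is $\mathsf d_v=(\mathsf d_{v_1},\ldots,\mathsf d_{v_d})$, $\mathsf d_{v_j}$ being the depth of $v_j$ in $\mathscr T_j$. $\mathsf{Chi}_j(v)$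 (resp. $\mathsf{sib}_j(v)$, for $v_j\neq\mathsf{root}_j$) is the set of $w\in V$ with $w_i=v_i$ for $i\ne j$ and $w_j\in\mathsf{Chi}(v_j)$ (resp. $w_j\in\mathsf{sib}(v_j)$). $\mathscr T$ is of finite joint branching index if, for each $j$, the set of depths of the branching vertices of $\mathscr T_j$ (vertices with at least two children) is bounded (possibly empty). Family $\mathcal S_{\mathscr T}$: for a sequence $\mathfrak c:\mathbb N\to(0,\infty)$ put $$\lambda_j(w)=\sqrt{\frac{\mathfrak c(|\mathsf d_v|)}{\mathrm{card}(\mathsf{Chi}_j(v))}}\sqrt{\frac{\mathsf d_{v_j}+1}{|\mathsf d_v|+d}},\quad w\in\mathsf{Chi}_j(v),\ v\in V,\ j=1,\ldots,d.$$ On $l^2(V)$ with orthonormal basis $\{e_v\}_{v\in V}$ of indicator functions, $S_{\boldsymbol\lambda_{\mathfrak c}}=(S_1,\ldots,S_d)$ is the (commuting, bounded if $\mathfrak c$ is bounded) multishift $S_je_v=\sum_{w\in\mathsf{Chi}_j(v)}\lambda_j(w)e_w$. $\mathcal S_{\mathscr T}=\{S_{\boldsymbol\lambda_{\mathfrak c}}:\inf\mathfrak c>0,\ \sup\mathfrak c<\infty\}$. The joint kernel of $S^*_{\boldsymbol\lambda_{\mathfrak c}}$ is $E=\bigcap_{j=1}^d\ker S_j^*$. Spaces $\mathcal L_{u,F}$: for $F\in\mathscr P$ let $\Phi_F=\{v\in V: v_j\neq\mathsf{root}_j\text{ if }j\in F,\ v_j=\mathsf{root}_j\text{ if }j\notin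 F\}$. For $u\in\Phi_F$, $\mathsf{sib}_F(u)$ is the set of $w\in V$ with $w_j\in\mathsf{sib}(u_j)$ for $j\in F$ and $w_j=u_j$ for $j\notin F$. These sets partition $\Phi_F$, and $\Omega_F$ is any set containing exactly one element of each class. For $G\in\mathscr P$, $v_G$ is $v$ with all coordinates $v_j$, $j\notin G$, replaced by $\mathsf{root}_j$; $\mathsf{sib}_{F,G}(u)=\{v_G: v\in\mathsf{sib}_F(u)\}$ for $G\subseteq F$; for $j\notin G$, $v_G|u_j$ is $v_G$ with $j$-th coordinate replaced by $u_j$. $\mathcal L_{u,F}\subseteq l^2(\mathsf{sib}_F(u))$ is the space of $f$ with $\sum_{w\in\mathsf{sib}_j(v_G|u_j)}f(w)\lambda_j(w)=0$ for all $j\in F$, $G=F\setminus\{j\}$, $v_G\in\mathsf{sib}_{F,G}(u)$ ($\mathcal L_{\mathsf{root},\emptyset}$ is the span of $e_{\mathsf{root}}$). One has $E=\bigoplus_{F\in\mathscr P}\bigoplus_{u\in\Omega_F}\mathcal L_{u,F}$ (orthogonal sum). *)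

theory Defs
  imports
    "HOL-Analysis.Analysis"
    "HOL-Library.Function_Algebras"
    "Graph_Theory.Digraph_Component"
begin

section \<open>Complex Hilbert spaces with explicit carriers\<close>

text \<open>
  The spaces below are spaces of functions cut out of a full function type, and one of them is
  existentially quantified together with its inner product, so a Hilbert space is given by a
  carrier, a scalar multiplication and an inner product (linear in the first argument).
  Addition is that of the ambient type (pointwise, for functions).
\<close>

record 'b hspace =
  hcarrier :: "'b set"
  hscale :: "complex \<Rightarrow> 'b \<Rightarrow> 'b"
  hinner :: "'b \<Rightarrow> 'b \<Rightarrow> complex"

definition hnorm :: "'b hspace \<Rightarrow> 'b \<Rightarrow> real" where
  "hnorm H x = sqrt (Re (hinner H x x))"

locale complex_hilbert_space = vector_space "hscale H"
  for H :: "'b::ab_group_add hspace" +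
  assumes carrier_subspace: "module.subspace (hscale H) (hcarrier H)"
    and inner_add: "\<lbrakk>x \<in> hcarrier H; y \<in> hcarrier H; z \<in> hcarrier H\<rbrakk>
          \<Longrightarrow> hinner H (x + y) z = hinner H x z + hinner H y z"
    and inner_scale: "\<lbrakk>x \<in> hcarrier H; y \<in> hcarrier H\<rbrakk>
          \<Longrightarrow> hinner H (hscale H a x) y = a * hinner H x y"
    and inner_commute: "\<lbrakk>x \<in> hcarrier H; y \<in> hcarrier H\<rbrakk>
          \<Longrightarrow> hinner H x y = cnj (hinner H y x)"
    and inner_pos: "\<lbrakk>x \<in> hcarrier H; x \<noteq> 0\<rbrakk> \<Longrightarrow> 0 < Re (hinner H x x)"
    and complete: "\<lbrakk>\<And>n. X n \<in> hcarrier H;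
          \<And>e. 0 < e \<Longrightarrow> \<exists>N. \<forall>m\<ge>N. \<forall>n\<ge>N. hnorm H (X m - X n) < e\<rbrakk>
          \<Longrightarrow> \<exists>x\<in>hcarrier H. (\<lambda>n. hnorm H (X n - x)) \<longlonglongrightarrow> 0"

text \<open>Operators are functions on the ambient type; only their values on the carrier matter.\<close>

definition bounded_operator ::
    "'b::ab_group_add hspace \<Rightarrow> 'c::ab_group_add hspace \<Rightarrow> ('b \<Rightarrow> 'c) \<Rightarrow> bool" where
  "bounded_operator H K A \<longleftrightarrow>
     (\<forall>x\<in>hcarrier H. A x \<in> hcarrier K) \<and>
     (\<forall>x\<in>hcarrier H. \<forall>y\<in>hcarrier H. A (x + y) = A x + A y) \<and>
     (\<forall>a. \<forall>x\<in>hcarrier H. A (hscale H a x) = hscale K a (A x)) \<and>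
     (\<exists>C. \<forall>x\<in>hcarrier H. hnorm K (A x) \<le> C * hnorm H x)"

definition unitary_operator ::
    "'b::ab_group_add hspace \<Rightarrow> 'c::ab_group_add hspace \<Rightarrow> ('b \<Rightarrow> 'c) \<Rightarrow> bool" where
  "unitary_operator H K U \<longleftrightarrow>
     bounded_operator H K U \<and>
     bij_betw U (hcarrier H) (hcarrier K) \<and>
     (\<forall>x\<in>hcarrier H. \<forall>y\<in>hcarrier H. hinner K (U x) (U y) = hinner H x y)"

definition unitarily_equivalent ::
    "'b::ab_group_add hspace \<Rightarrow> ('d \<Rightarrow> 'b \<Rightarrow> 'b) \<Rightarrow>
     'c::ab_group_add hspace \<Rightarrow> ('d \<Rightarrow> 'c \<Rightarrow> 'c) \<Rightarrow> bool" where
  "unitarily_equivalent H S K M \<longleftrightarrow>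
     (\<exists>U. unitary_operator H K U \<and> (\<forall>j. \<forall>x\<in>hcarrier H. U (S j x) = M j (U x)))"

definition hilbert_adjoint :: "'b hspace \<Rightarrow> ('b \<Rightarrow> 'b) \<Rightarrow> 'b \<Rightarrow> 'b" where
  "hilbert_adjoint H A x =
     (THE y. y \<in> hcarrier H \<and> (\<forall>z\<in>hcarrier H. hinner H (A z) x = hinner H z y))"

definition orthogonal_projection :: "'b::ab_group_add hspace \<Rightarrow> 'b set \<Rightarrow> 'b \<Rightarrow> 'b" where
  "orthogonal_projection H M x = (THE y. y \<in> M \<and> (\<forall>z\<in>M. hinner H (x - y) z = 0))"

text \<open>Unconditional convergence of a series of operators in the operator norm.\<close>

definition operator_has_sum ::
    "'b::ab_group_add hspace \<Rightarrow> ('i \<Rightarrow> 'b \<Rightarrow> 'b) \<Rightarrow> 'i set \<Rightarrow> ('b \<Rightarrow> 'b) \<Rightarrow> bool" where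
  "operator_has_sum H A I B \<longleftrightarrow>
     (\<forall>e>0. \<forall>\<^sub>F X in finite_subsets_at_top I.
        \<forall>x\<in>hcarrier H. hnorm H ((\<Sum>i\<in>X. A i x) - B x) \<le> e * hnorm H x)"

text \<open>Functions in \<open>l\<^sup>2(V)\<close> are extended by zero outside \<open>V\<close>, so that
  \<open>l\<^sup>2(W)\<close> is a subspace of \<open>l\<^sup>2(V)\<close> for \<open>W \<subseteq> V\<close>.\<close>

definition ell2 :: "'v set \<Rightarrow> ('v \<Rightarrow> complex) hspace" where
  "ell2 V =
     \<lparr> hcarrier = {f. (\<forall>v. v \<notin> V \<longrightarrow> f v = 0) \<and> (\<lambda>v. (cmod (f v))\<^sup>2) summable_on V},
       hscale = (\<lambda>a f v. a * f v),
       hinner = (\<lambda>f g. \<Sum>\<^sub>\<infinity>v\<in>V. f v * cnj (g v)) \<rparr>"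


section \<open>Vector-valued reproducing kernel Hilbert spaces\<close>

text \<open>Complex Frechet differentiability; a complex linear map from \<open>complex ^ 'd\<close> to \<open>E\<close> is
  given by the images \<open>A j\<close> of the standard basis vectors.\<close>

definition holomorphic_into ::
    "'b::ab_group_add hspace \<Rightarrow> (complex ^ 'd) set \<Rightarrow> (complex ^ 'd \<Rightarrow> 'b) \<Rightarrow> bool" where
  "holomorphic_into E D f \<longleftrightarrow>
     (\<forall>z\<in>D. f z \<in> hcarrier E) \<and>
     (\<forall>z\<in>D. \<exists>A. (\<forall>j. A j \<in> hcarrier E) \<and>
        ((\<lambda>w. hnorm E (f w - f z - (\<Sum>j\<in>UNIV. hscale E (w $ j - z $ j) (A j))) / norm (w - z))
          \<longlongrightarrow> 0) (at z))"

text \<open>Functions on \<open>D\<close> are represented by functions that vanish outside \<open>D\<close>.\<close>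

definition reproducing_kernel_space ::
    "'b::ab_group_add hspace \<Rightarrow> 'z set \<Rightarrow> ('z \<Rightarrow> 'b) hspace \<Rightarrow> bool" where
  "reproducing_kernel_space E D H \<longleftrightarrow>
     complex_hilbert_space H \<and>
     hscale H = (\<lambda>a f z. hscale E a (f z)) \<and>
     (\<forall>f\<in>hcarrier H. (\<forall>z\<in>D. f z \<in> hcarrier E) \<and> (\<forall>z. z \<notin> D \<longrightarrow> f z = 0)) \<and>
     (\<forall>z\<in>D. \<exists>C. \<forall>f\<in>hcarrier H. hnorm E (f z) \<le> C * hnorm H f)"

definition reproducing_kernel ::
    "'b::ab_group_add hspace \<Rightarrow> 'z set \<Rightarrow> ('z \<Rightarrow> 'b) hspace \<Rightarrow> ('z \<Rightarrow> 'z \<Rightarrow> 'b \<Rightarrow> 'b) \<Rightarrow> bool" where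
  "reproducing_kernel E D H \<kappa> \<longleftrightarrow>
     (\<forall>z\<in>D. \<forall>w\<in>D. bounded_operator E E (\<kappa> z w)) \<and>
     (\<forall>w\<in>D. \<forall>g\<in>hcarrier E.
        (\<lambda>z. if z \<in> D then \<kappa> z w g else 0) \<in> hcarrier H \<and>
        (\<forall>f\<in>hcarrier H.
           hinner H f (\<lambda>z. if z \<in> D then \<kappa> z w g else 0) = hinner E (f w) g))"

definition mult_coord ::
    "'b hspace \<Rightarrow> 'd \<Rightarrow> (complex ^ 'd \<Rightarrow> 'b) \<Rightarrow> (complex ^ 'd \<Rightarrow> 'b)" where
  "mult_coord E j f = (\<lambda>z. hscale E (z $ j) (f z))"


section \<open>Rooted directed trees\<close>

definition Chi :: "'a pair_pre_digraph \<Rightarrow> 'a \<Rightarrow> 'a set" where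
  "Chi T u = {w \<in> pverts T. (u, w) \<in> parcs T}"

definition root_of :: "'a pair_pre_digraph \<Rightarrow> 'a" where
  "root_of T = (THE r. r \<in> pverts T \<and> (\<nexists>u. (u, r) \<in> parcs T))"

definition par :: "'a pair_pre_digraph \<Rightarrow> 'a \<Rightarrow> 'a" where
  "par T u = (THE p. (p, u) \<in> parcs T)"

definition sib :: "'a pair_pre_digraph \<Rightarrow> 'a \<Rightarrow> 'a set" where
  "sib T u = Chi T (par T u)"

definition depth :: "'a pair_pre_digraph \<Rightarrow> 'a \<Rightarrow> nat" where
  "depth T u = (THE n. (root_of T, u) \<in> parcs T ^^ n)"

text \<open>Connectedness in \<^theory>\<open>Graph_Theory.Digraph_Component\<close> is that of the underlying undirected
  graph, and a forest is a digraph without directed cycles (in particular without loops).\<close>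

definition rooted_directed_tree :: "'a pair_pre_digraph \<Rightarrow> bool" where
  "rooted_directed_tree T \<longleftrightarrow>
     pair_wf_digraph T \<and>
     Digraph_Component.connected (with_proj T) \<and>
     forest (with_proj T) \<and>
     (\<forall>v u u'. (u, v) \<in> parcs T \<and> (u', v) \<in> parcs T \<longrightarrow> u = u') \<and>
     (\<exists>!r. r \<in> pverts T \<and> (\<nexists>u. (u, r) \<in> parcs T)) \<and>
     countable (pverts T) \<and> infinite (pverts T) \<and>
     (\<forall>u\<in>pverts T. Chi T u \<noteq> {})"

definition locally_finite :: "'a pair_pre_digraph \<Rightarrow> bool" where
  "locally_finite T \<longleftrightarrow> (\<forall>u\<in>pverts T. finite (Chi T u))"

definition branching_vertices :: "'a pair_pre_digraph \<Rightarrow> 'a set" where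
  "branching_vertices T = {u \<in> pverts T. \<exists>v\<in>Chi T u. \<exists>w\<in>Chi T u. v \<noteq> w}"


section \<open>Directed Cartesian products\<close>

text \<open>The number \<open>d\<close> of trees is \<open>CARD('d)\<close>. The trees are countable, so a common
  type of vertices is no restriction.\<close>

definition product_digraph :: "('d \<Rightarrow> 'a pair_pre_digraph) \<Rightarrow> ('d \<Rightarrow> 'a) pair_pre_digraph" where
  "product_digraph T =
     \<lparr> pverts = {v. \<forall>j. v j \<in> pverts (T j)},
       parcs = {(v, w). (\<forall>j. v j \<in> pverts (T j)) \<and> (\<forall>j. w j \<in> pverts (T j)) \<and>
                  (\<exists>k. (\<forall>j. j \<noteq> k \<longrightarrow> v j = w j) \<and> (v k, w k) \<in> parcs (T k))} \<rparr>"

abbreviation product_verts :: "('d \<Rightarrow> 'a pair_pre_digraph) \<Rightarrow> ('d \<Rightarrow> 'a) set" where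
  "product_verts T \<equiv> pverts (product_digraph T)"

definition finite_joint_branching_index :: "('d \<Rightarrow> 'a pair_pre_digraph) \<Rightarrow> bool" where
  "finite_joint_branching_index T \<longleftrightarrow>
     (\<forall>j. bdd_above (depth (T j) ` branching_vertices (T j)))"

definition mdepth :: "('d \<Rightarrow> 'a pair_pre_digraph) \<Rightarrow> ('d \<Rightarrow> 'a) \<Rightarrow> 'd \<Rightarrow> nat" where
  "mdepth T v = (\<lambda>j. depth (T j) (v j))"

definition msize :: "('d::finite \<Rightarrow> nat) \<Rightarrow> nat" where
  "msize \<alpha> = (\<Sum>j\<in>UNIV. \<alpha> j)"

definition mfact :: "('d::finite \<Rightarrow> nat) \<Rightarrow> nat" where
  "mfact \<alpha> = (\<Prod>j\<in>UNIV. fact (\<alpha> j))"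

definition mpower :: "complex ^ 'd \<Rightarrow> ('d::finite \<Rightarrow> nat) \<Rightarrow> complex" where
  "mpower z \<alpha> = (\<Prod>j\<in>UNIV. (z $ j) ^ \<alpha> j)"

definition Chi_at :: "('d \<Rightarrow> 'a pair_pre_digraph) \<Rightarrow> 'd \<Rightarrow> ('d \<Rightarrow> 'a) \<Rightarrow> ('d \<Rightarrow> 'a) set" where
  "Chi_at T j v = {w \<in> product_verts T. (\<forall>i. i \<noteq> j \<longrightarrow> w i = v i) \<and> w j \<in> Chi (T j) (v j)}"

definition sib_at :: "('d \<Rightarrow> 'a pair_pre_digraph) \<Rightarrow> 'd \<Rightarrow> ('d \<Rightarrow> 'a) \<Rightarrow> ('d \<Rightarrow> 'a) set" where
  "sib_at T j v = {w \<in> product_verts T. (\<forall>i. i \<noteq> j \<longrightarrow> w i = v i) \<and> w j \<in> sib (T j) (v j)}"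


section \<open>The multishifts\<close>

text \<open>The weight \<open>\<lambda>\<^sub>j(w)\<close>, which is meaningful only if \<open>w j\<close> is not the root; the vertex \<open>v\<close> is the
  unique one with \<open>w \<in> Chi_at T j v\<close>.\<close>

definition shift_weight ::
    "('d::finite \<Rightarrow> 'a pair_pre_digraph) \<Rightarrow> (nat \<Rightarrow> real) \<Rightarrow> 'd \<Rightarrow> ('d \<Rightarrow> 'a) \<Rightarrow> real" where
  "shift_weight T c j w =
     (let v = w(j := par (T j) (w j)) in
        sqrt (c (msize (mdepth T v)) / real (card (Chi_at T j v))) *
        sqrt ((real (mdepth T v j) + 1) / (real (msize (mdepth T v)) + real CARD('d))))"

definition is_multishift ::
    "('d::finite \<Rightarrow> 'a pair_pre_digraph) \<Rightarrow> (nat \<Rightarrow> real) \<Rightarrow>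
     ('d \<Rightarrow> (('d \<Rightarrow> 'a) \<Rightarrow> complex) \<Rightarrow> (('d \<Rightarrow> 'a) \<Rightarrow> complex)) \<Rightarrow> bool" where
  "is_multishift T c S \<longleftrightarrow>
     (\<forall>j. bounded_operator (ell2 (product_verts T)) (ell2 (product_verts T)) (S j) \<and>
       (\<forall>v\<in>product_verts T.
          S j (indicator {v}) =
          (\<Sum>w\<in>Chi_at T j v. (\<lambda>x. complex_of_real (shift_weight T c j w) * indicator {w} x))))"

definition joint_kernel ::
    "('d::finite \<Rightarrow> 'a pair_pre_digraph) \<Rightarrow>
     ('d \<Rightarrow> (('d \<Rightarrow> 'a) \<Rightarrow> complex) \<Rightarrow> (('d \<Rightarrow> 'a) \<Rightarrow> complex)) \<Rightarrow>
     (('d \<Rightarrow> 'a) \<Rightarrow> complex) hspace" where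
  "joint_kernel T S = (ell2 (product_verts T))
     \<lparr> hcarrier := (\<Inter>j. {f \<in> hcarrier (ell2 (product_verts T)).
                       hilbert_adjoint (ell2 (product_verts T)) (S j) f = 0}) \<rparr>"


section \<open>The decomposition of the joint kernel\<close>

definition Phi :: "('d \<Rightarrow> 'a pair_pre_digraph) \<Rightarrow> 'd set \<Rightarrow> ('d \<Rightarrow> 'a) set" where
  "Phi T F = {v \<in> product_verts T. \<forall>j. j \<in> F \<longleftrightarrow> v j \<noteq> root_of (T j)}"

definition sib_set :: "('d \<Rightarrow> 'a pair_pre_digraph) \<Rightarrow> 'd set \<Rightarrow> ('d \<Rightarrow> 'a) \<Rightarrow> ('d \<Rightarrow> 'a) set" where
  "sib_set T F u = {w \<in> product_verts T.
     (\<forall>j\<in>F. w j \<in> sib (T j) (u j)) \<and> (\<forall>j. j \<notin> F \<longrightarrow> w j = u j)}"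

text \<open>The vertex \<open>v\<^sub>G\<close> obtained from \<open>v\<close>.\<close>

definition vrestrict :: "('d \<Rightarrow> 'a pair_pre_digraph) \<Rightarrow> 'd set \<Rightarrow> ('d \<Rightarrow> 'a) \<Rightarrow> ('d \<Rightarrow> 'a)" where
  "vrestrict T G v = (\<lambda>j. if j \<in> G then v j else root_of (T j))"

definition sib_restrict ::
    "('d \<Rightarrow> 'a pair_pre_digraph) \<Rightarrow> 'd set \<Rightarrow> 'd set \<Rightarrow> ('d \<Rightarrow> 'a) \<Rightarrow> ('d \<Rightarrow> 'a) set" where
  "sib_restrict T F G u = vrestrict T G ` sib_set T F u"

definition is_transversal ::
    "('d \<Rightarrow> 'a pair_pre_digraph) \<Rightarrow> ('d set \<Rightarrow> ('d \<Rightarrow> 'a) set) \<Rightarrow> bool" where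
  "is_transversal T \<Omega> \<longleftrightarrow>
     (\<forall>F. \<Omega> F \<subseteq> Phi T F \<and> (\<forall>u\<in>Phi T F. \<exists>!x. x \<in> \<Omega> F \<and> x \<in> sib_set T F u))"

text \<open>Here \<open>p\<close> ranges over the vertices \<open>v\<^sub>G\<close> with \<open>G = F - {j}\<close>, and \<open>p(j := u j)\<close> is
  \<open>v\<^sub>G|u\<^sub>j\<close>. For \<open>F = {}\<close> this is the span of the indicator of the root.\<close>

definition L_space ::
    "('d::finite \<Rightarrow> 'a pair_pre_digraph) \<Rightarrow> (nat \<Rightarrow> real) \<Rightarrow> ('d \<Rightarrow> 'a) \<Rightarrow> 'd set \<Rightarrow>
     (('d \<Rightarrow> 'a) \<Rightarrow> complex) set" where
  "L_space T c u F =
     {f \<in> hcarrier (ell2 (sib_set T F u)).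
        \<forall>j\<in>F. \<forall>p\<in>sib_restrict T F (F - {j}) u.
          (\<Sum>w\<in>sib_at T j (p(j := u j)). f w * complex_of_real (shift_weight T c j w)) = 0}"

definition kernel_term ::
    "(nat \<Rightarrow> real) \<Rightarrow> ('d::finite \<Rightarrow> nat) \<Rightarrow> complex ^ 'd \<Rightarrow> complex ^ 'd \<Rightarrow> ('d \<Rightarrow> nat) \<Rightarrow> complex" where
  "kernel_term c \<delta> z w \<alpha> =
     complex_of_real (real (mfact \<delta>) / real (mfact (\<lambda>j. \<delta> j + \<alpha> j)) *
       (\<Prod>j<msize \<alpha>. (real (msize \<delta>) + real CARD('d) + real j) / c (msize \<delta> + j))) *
     mpower z \<alpha> * cnj (mpower w \<alpha>)"

end

theory Submission
  imports Defs
begin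

text \<open>
  Since the weights are constant along each set of children, \<open>S\<^sub>j = J\<^sub>j D\<^sub>j\<close>, where \<open>J\<^sub>j\<close> is an
  isometry acting in the direction \<open>j\<close> only and \<open>D\<^sub>j\<close> is multiplication by a function of the depth.
  The isometries doubly commute, so the joint kernel \<open>E\<close> is wandering: \<open>f\<close> is determined by the
  elements \<open>f\<^sub>\<alpha> = P\<^sub>E J\<^sup>*\<^sup>\<alpha> f\<close> of \<open>E\<close>. Multiplication by functions of the depth preserves \<open>E\<close>, and
  \<open>S\<^sup>\<alpha> = J\<^sup>\<alpha> W\<^sub>\<alpha>\<close> on \<open>E\<close>, where \<open>W\<^sub>\<alpha>\<^sup>-\<^sup>2\<close> is multiplication by the coefficient of \<open>z\<^sup>\<alpha> w\<^sup>\<alpha>\<close> in the kernel.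
  Hence \<open>f \<mapsto> \<Sum>\<alpha>. z\<^sup>\<alpha> W\<^sub>\<alpha>\<^sup>-\<^sup>1 f\<^sub>\<alpha>\<close> turns \<open>S\<close> into multiplication by the coordinates, and its range
  carries the transported norm. Finite joint branching index and local finiteness make \<open>E\<close> finite
  dimensional, which gives a common radius of convergence and makes the sum over \<open>F\<close> and \<open>u\<close> finite.
\<close>

section \<open>Rooted directed trees\<close>

text \<open>The algebra is kept apart from the analysis. The isometries and their adjoints have
  pointwise formulas that make sense on every function vanishing off the vertices, so the
  commutation relations need no summability, and adjointness is needed only against finitely
  supported functions. Neither the expansion of f into its components nor the norm identity behind
  it is proved: as the target carries the transported norm, injectivity of the model map suffices
  for unitarity. The kernel is found by duality. Evaluation at w paired with g in E is a bounded
  functional, and pairing its representing vector with J^\<beta> g' reads off the coefficients of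
  that vector. Convergence rests on crude sup norm bounds: a model coefficient costs one factor
  \<open>branch_bound\<close> and one factor \<open>sqrt growth\<close> per unit of |\<alpha>|,
  whereas the depth of the vertex enters only a multiplicative constant. This is why one radius
  serves all vertices; the finite support of E turns pointwise estimates into norm
  estimates.\<close>

locale leafless_tree =
  fixes T :: "'a pair_pre_digraph"
  assumes rooted: "rooted_directed_tree T" and loc_fin: "locally_finite T"
begin

abbreviation "rt \<equiv> root_of T"

lemma arc_verts: "(u, v) \<in> parcs T \<Longrightarrow> u \<in> pverts T \<and> v \<in> pverts T"
  using rooted pair_wf_digraph.arc_fst_in_verts[of T "(u,v)"]
    pair_wf_digraph.arc_snd_in_verts[of T "(u,v)"]
  by (auto simp: rooted_directed_tree_def)

lemma parent_unique: "(u, v) \<in> parcs T \<Longrightarrow> (u', v) \<in> parcs T \<Longrightarrow> u = u'"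
  using rooted by (auto simp: rooted_directed_tree_def)

lemma root_ex1: "\<exists>!r. r \<in> pverts T \<and> (\<nexists>u. (u, r) \<in> parcs T)"
  using rooted by (auto simp: rooted_directed_tree_def)

lemma root_vert: "rt \<in> pverts T" and root_orphan: "(u, rt) \<notin> parcs T"
  using theI'[OF root_ex1] unfolding root_of_def by auto

lemma Chi_iff: "x \<in> Chi T u \<longleftrightarrow> (u, x) \<in> parcs T"
  using arc_verts by (auto simp: Chi_def)

lemma par_eq: "(u, v) \<in> parcs T \<Longrightarrow> par T v = u"
  unfolding par_def using parent_unique by blast

lemma par_arc:
  assumes "v \<in> pverts T" "v \<noteq> rt"
  shows "(par T v, v) \<in> parcs T"
proof -
  obtain u where "(u, v) \<in> parcs T"
    using root_ex1 assms root_vert root_orphan by blast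
  then show ?thesis using par_eq by simp
qed

lemma par_Chi: "x \<in> Chi T u \<Longrightarrow> par T x = u"
  by (simp add: Chi_iff par_eq)

lemma Chi_par: "v \<in> pverts T \<Longrightarrow> v \<noteq> rt \<Longrightarrow> v \<in> Chi T (par T v)"
  by (simp add: Chi_iff par_arc)

lemma par_vert: "v \<in> pverts T \<Longrightarrow> v \<noteq> rt \<Longrightarrow> par T v \<in> pverts T"
  using par_arc arc_verts by blast

lemma Chi_vert: "x \<in> Chi T u \<Longrightarrow> x \<in> pverts T \<and> u \<in> pverts T \<and> x \<noteq> rt"
  using arc_verts root_orphan Chi_iff by auto

lemma Chi_empty: "u \<notin> pverts T \<Longrightarrow> Chi T u = {}"
  using Chi_vert by blast

lemma finite_Chi: "finite (Chi T u)"
  using loc_fin Chi_empty unfolding locally_finite_def by (cases "u \<in> pverts T") auto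

lemma Chi_nonempty: "u \<in> pverts T \<Longrightarrow> Chi T u \<noteq> {}"
  using rooted by (auto simp: rooted_directed_tree_def)

lemma card_Chi_pos: "u \<in> pverts T \<Longrightarrow> card (Chi T u) > 0"
  using finite_Chi Chi_nonempty by (simp add: card_gt_0_iff)

text \<open>Unique parents let two paths ending at the same vertex be stripped of their last arcs in
  parallel; since the root has no parent, both run out together.\<close>

lemma depth_relpow_unique:
  "(rt, u) \<in> parcs T ^^ n \<Longrightarrow> (rt, u) \<in> parcs T ^^ m \<Longrightarrow> n = m"
proof (induction n arbitrary: u m)
  case 0
  then show ?case using root_orphan by (cases m) auto
next
  case (Suc n)
  then obtain p where p: "(rt, p) \<in> parcs T ^^ n" "(p, u) \<in> parcs T" by auto
  then obtain k where k: "m = Suc k" using root_orphan Suc.prems by (cases m) auto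
  then obtain q where "(rt, q) \<in> parcs T ^^ k" "(q, u) \<in> parcs T" using Suc.prems by auto
  then show ?case using Suc.IH p k parent_unique by blast
qed

lemma relpow_ex:
  assumes "u \<in> pverts T"
  shows "\<exists>n. (rt, u) \<in> parcs T ^^ n"
proof -
  let ?R = "\<Union>e\<in>parcs T. {(fst e, snd e), (snd e, fst e)}"
  have "Digraph_Component.connected (with_proj T)"
    using rooted by (simp add: rooted_directed_tree_def)
  then have "(rt, u) \<in> rtrancl_on (pverts T) ?R"
    using root_vert assms
    by (auto simp: Digraph_Component.connected_def strongly_connected_def reachable_def mk_symmetric_def)
  moreover have "\<exists>n. (rt, u) \<in> parcs T ^^ n" if "(a, u) \<in> rtrancl_on (pverts T) ?R" "a = rt" for a
    using that
  proof (induction a u rule: rtrancl_on.induct)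
    case (rtrancl_on_refl a)
    then show ?case by (metis relpow_0_I)
  next
    case (rtrancl_on_into_rtrancl_on a b e)
    then obtain n where n: "(rt, b) \<in> parcs T ^^ n" by blast
    consider "(b, e) \<in> parcs T" | "(e, b) \<in> parcs T" using rtrancl_on_into_rtrancl_on by auto
    then show ?case
    proof cases
      case 1
      then show ?thesis using n by (metis relpow_Suc_I)
    next
      \<comment> \<open>An arc traversed backwards leads from \<open>b\<close> to its parent, the
        last but one vertex of the directed path to \<open>b\<close>; dropping the final arc keeps
        the path directed.\<close>
      case 2
      then obtain k where "n = Suc k" using n root_orphan by (cases n) auto
      then show ?thesis using n 2 parent_unique by (metis relpow_Suc_E)
    qed
  qed
  ultimately show ?thesis by blast
qed

lemma depth_relpow: "u \<in> pverts T \<Longrightarrow> (rt, u) \<in> parcs T ^^ depth T u"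
  unfolding depth_def using relpow_ex[of u] depth_relpow_unique[of u] by (metis (lifting) theI)

lemma depth_eq: "(rt, u) \<in> parcs T ^^ n \<Longrightarrow> depth T u = n"
  unfolding depth_def using depth_relpow_unique by blast

lemma depth_root [simp]: "depth T rt = 0"
  by (rule depth_eq) auto

lemma depth_Chi: "x \<in> Chi T u \<Longrightarrow> depth T x = Suc (depth T u)"
  using depth_relpow[of u] Chi_iff[of x u] arc_verts[of u x] by (intro depth_eq) auto

lemma depth_eq_0: "u \<in> pverts T \<Longrightarrow> depth T u = 0 \<Longrightarrow> u = rt"
  using depth_relpow[of u] by simp

lemma depth_par: "u \<in> pverts T \<Longrightarrow> u \<noteq> rt \<Longrightarrow> depth T u = Suc (depth T (par T u))"
  using depth_Chi Chi_par by blast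

lemma finite_level: "finite {u \<in> pverts T. depth T u = n}"
proof (induction n)
  case 0
  have "{u \<in> pverts T. depth T u = 0} \<subseteq> {rt}" using depth_eq_0 by auto
  then show ?case using finite_subset by blast
next
  case (Suc n)
  have "{u \<in> pverts T. depth T u = Suc n} \<subseteq> (\<Union>p\<in>{u \<in> pverts T. depth T u = n}. Chi T p)"
  proof
    fix u assume u: "u \<in> {u \<in> pverts T. depth T u = Suc n}"
    then have "u \<noteq> rt" by auto
    then show "u \<in> (\<Union>p\<in>{u \<in> pverts T. depth T u = n}. Chi T p)"
      using u depth_par[of u] Chi_par[of u] par_vert[of u] by auto
  qed
  then show ?case using Suc finite_Chi by (meson finite_UN_I finite_subset)
qed

lemma finite_levels: "finite {u \<in> pverts T. depth T u \<le> n}"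
proof -
  have "{u \<in> pverts T. depth T u \<le> n} = (\<Union>k\<le>n. {u \<in> pverts T. depth T u = k})" by auto
  then show ?thesis using finite_level by simp
qed

lemma Chi_nonbranching:
  assumes "x \<in> Chi T u" "u \<notin> branching_vertices T"
  shows "Chi T u = {x}"
  using assms Chi_vert[of x u] unfolding branching_vertices_def by blast

end

section \<open>Power series in several variables\<close>

lemma has_sum_sum:
  fixes f :: "'i \<Rightarrow> 'b \<Rightarrow> 'c::topological_comm_monoid_add"
  assumes "\<And>j. j \<in> J \<Longrightarrow> (f j has_sum S j) A"
  shows "((\<lambda>x. \<Sum>j\<in>J. f j x) has_sum (\<Sum>j\<in>J. S j)) A"
  using assms by (induction J rule: infinite_finite_induct) (auto intro: has_sum_add)

text \<open>A finite set of multi-indices lies in a cube, and over a cube the sum factors into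
  partial geometric sums, one for each coordinate.\<close>

lemma summable_on_geometric_multiindex:
  fixes q :: real
  assumes "0 \<le> q" "q < 1"
  shows "(\<lambda>\<alpha>::'d::finite \<Rightarrow> nat. q ^ msize \<alpha>) summable_on UNIV"
proof (rule nonneg_bounded_partial_sums_imp_summable_on)
  show "\<forall>\<^sub>F X in finite_subsets_at_top UNIV.
          (\<Sum>\<alpha>\<in>X. q ^ msize (\<alpha> :: 'd \<Rightarrow> nat)) \<le> (1 / (1 - q)) ^ CARD('d)"
  proof (rule eventually_finite_subsets_at_top_weakI)
    fix X :: "('d \<Rightarrow> nat) set" assume X: "finite X"
    define N where "N = (\<Sum>\<alpha>\<in>X. msize \<alpha>)"
    have "X \<subseteq> (\<Pi>\<^sub>E j\<in>UNIV. {..<Suc N})"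
    proof
      fix \<alpha> assume "\<alpha> \<in> X"
      then have "msize \<alpha> \<le> N" unfolding N_def using X by (simp add: member_le_sum)
      moreover have "\<alpha> j \<le> msize \<alpha>" for j unfolding msize_def by (simp add: member_le_sum)
      ultimately show "\<alpha> \<in> (\<Pi>\<^sub>E j\<in>UNIV. {..<Suc N})"
        by (auto simp: PiE_iff less_Suc_eq_le intro: order_trans)
    qed
    then have "(\<Sum>\<alpha>\<in>X. q ^ msize \<alpha>) \<le> (\<Sum>\<alpha>\<in>(\<Pi>\<^sub>E j\<in>(UNIV::'d set). {..<Suc N}). q ^ msize \<alpha>)"
      by (rule sum_mono2[rotated]) (use assms in \<open>auto intro: finite_PiE\<close>)
    also have "\<dots> = (\<Prod>j\<in>(UNIV::'d set). \<Sum>k<Suc N. q ^ k)"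
      by (subst prod_sum_PiE) (simp_all add: msize_def power_sum)
    also have "\<dots> = (\<Sum>k<Suc N. q ^ k) ^ CARD('d)" by simp
    also have "\<dots> \<le> (1 / (1 - q)) ^ CARD('d)"
    proof (rule power_mono)
      have "(\<Sum>k<Suc N. q ^ k) \<le> suminf (\<lambda>k. q ^ k)"
        using assms by (intro sum_le_suminf summable_geometric) auto
      then show "(\<Sum>k<Suc N. q ^ k) \<le> 1 / (1 - q)" using assms by (simp add: suminf_geometric)
    qed (use assms in \<open>simp add: sum_nonneg del: sum.lessThan_Suc\<close>)
    finally show "(\<Sum>\<alpha>\<in>X. q ^ msize \<alpha>) \<le> (1 / (1 - q)) ^ CARD('d)" .
  qed
qed (use assms in auto)

lemma norm_mpower_le:
  fixes z :: "complex ^ 'd::finite"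
  assumes "\<And>j. cmod (z $ j) \<le> r"
  shows "cmod (mpower z \<alpha>) \<le> r ^ msize \<alpha>"
proof -
  have "cmod (mpower z \<alpha>) = (\<Prod>j\<in>UNIV. cmod (z $ j) ^ \<alpha> j)"
    by (simp add: mpower_def prod_norm[symmetric] norm_power)
  also have "\<dots> \<le> (\<Prod>j\<in>UNIV. r ^ \<alpha> j)"
    using assms by (intro prod_mono) (auto intro: power_mono)
  finally show ?thesis by (simp add: msize_def power_sum)
qed

lemma ball_coord:
  fixes z :: "complex ^ 'd::finite"
  shows "z \<in> ball 0 r \<Longrightarrow> cmod (z $ j) < r"
  using Finite_Cartesian_Product.norm_nth_le[of z j] by simp

lemma multi_series_abs_summable:
  fixes z :: "complex ^ 'd::finite" and a :: "('d \<Rightarrow> nat) \<Rightarrow> complex"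
  assumes "(\<lambda>\<alpha>. cmod (a \<alpha>) * r ^ msize \<alpha>) summable_on UNIV" "\<And>j. cmod (z $ j) \<le> r"
  shows "(\<lambda>\<alpha>. cmod (a \<alpha> * mpower z \<alpha>)) summable_on UNIV"
  by (rule Infinite_Sum.abs_summable_on_comparison_test'[OF assms(1)])
    (unfold norm_mult, rule mult_left_mono, rule norm_mpower_le, rule assms(2), simp)

text \<open>Grouping the terms by the exponent of one variable \<open>t\<close> gives a power series
  in \<open>t\<close> alone that vanishes near 0 and has the fibre sums as coefficients. The
  remaining indices may still range over an infinite set.\<close>

lemma multi_series_coefficient_fibre:
  fixes g :: "'i \<Rightarrow> complex" and e :: "'i \<Rightarrow> nat"
  assumes "0 < \<rho>" and sm: "(\<lambda>\<alpha>. cmod (g \<alpha>) * \<rho> ^ e \<alpha>) summable_on S"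
    and zero: "\<And>t. cmod t \<le> \<rho> \<Longrightarrow> (\<Sum>\<^sub>\<infinity>\<alpha>\<in>S. g \<alpha> * t ^ e \<alpha>) = 0"
  shows "(\<Sum>\<^sub>\<infinity>\<alpha>\<in>{\<alpha>\<in>S. e \<alpha> = n}. g \<alpha>) = 0"
proof -
  define G where "G n = (\<Sum>\<^sub>\<infinity>\<alpha>\<in>{\<alpha>\<in>S. e \<alpha> = n}. g \<alpha>)" for n
  have sums: "(\<lambda>n. G n * t ^ n) sums 0" if t: "cmod t \<le> \<rho>" for t
  proof -
    let ?Sg = "SIGMA n:UNIV. {\<alpha>\<in>S. e \<alpha> = n}"
    have bij: "bij_betw (\<lambda>\<alpha>. (e \<alpha>, \<alpha>)) S ?Sg"
      by (rule bij_betwI[of _ _ _ snd]) auto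
    have "(\<lambda>\<alpha>. g \<alpha> * t ^ e \<alpha>) summable_on S"
      by (rule Infinite_Sum.abs_summable_summable, rule Infinite_Sum.abs_summable_on_comparison_test'[OF sm])
        (simp add: norm_mult norm_power t mult_left_mono power_mono)
    then have sm': "(\<lambda>(n, \<alpha>). g \<alpha> * t ^ n) summable_on ?Sg"
      using summable_on_reindex_bij_betw[OF bij, of "\<lambda>(n, \<alpha>). g \<alpha> * t ^ n"] by simp
    have "(\<Sum>\<^sub>\<infinity>(n, \<alpha>)\<in>?Sg. g \<alpha> * t ^ n) = (\<Sum>\<^sub>\<infinity>\<alpha>\<in>S. g \<alpha> * t ^ e \<alpha>)"
      using infsum_reindex_bij_betw[OF bij, of "\<lambda>(n, \<alpha>). g \<alpha> * t ^ n"] by simp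
    then have tot: "((\<lambda>(n, \<alpha>). g \<alpha> * t ^ n) has_sum 0) ?Sg"
      using sm' zero[OF t] by (simp add: summable_iff_has_sum_infsum)
    have "((\<lambda>\<alpha>. g \<alpha> * t ^ n) has_sum (G n * t ^ n)) {\<alpha>\<in>S. e \<alpha> = n}" for n
    \<comment> \<open>Summability at \<open>t\<close> controls a fibre only where
      \<open>t ^ n\<close> can be divided out; otherwise every term is 0.\<close>
    proof (cases "t ^ n = 0")
      case False
      have "(\<lambda>\<alpha>. g \<alpha> * t ^ n) summable_on {\<alpha>\<in>S. e \<alpha> = n}"
        using summable_on_SigmaD1[OF sm', of n] by simp
      then have "g summable_on {\<alpha>\<in>S. e \<alpha> = n}"
        using False summable_on_cmult_left' by blast
      then show ?thesis unfolding G_def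
        by (intro has_sum_cmult_left) (simp add: summable_iff_has_sum_infsum)
    next
      case True
      show ?thesis unfolding True by simp
    qed
    then have "((\<lambda>n. G n * t ^ n) has_sum 0) UNIV"
      using has_sum_SigmaD[OF tot, of "\<lambda>n. G n * t ^ n"] by simp
    then show ?thesis by (rule has_sum_imp_sums)
  qed
  have "conv_radius G \<ge> ereal \<rho>"
    using conv_radius_geI[of G "complex_of_real \<rho>"] sums[of "complex_of_real \<rho>"] \<open>0 < \<rho>\<close>
    by (auto simp: sums_iff)
  then have "fps_conv_radius (Abs_fps G) > 0"
    using \<open>0 < \<rho>\<close> less_le_trans[of 0 "ereal \<rho>"] by (simp add: fps_conv_radius_def)
  moreover have "eventually (\<lambda>t. eval_fps (Abs_fps G) t = eval_fps 0 t) (nhds 0)"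
    using \<open>0 < \<rho>\<close> sums
    by (auto simp: eventually_nhds_metric eval_fps_def sums_iff dist_norm intro!: exI[of _ \<rho>])
  ultimately have "Abs_fps G = 0"
    by (intro eval_fps_eqD) auto
  then have "G n = 0" by (metis fps_nth_Abs_fps fps_zero_nth)
  then show ?thesis unfolding G_def .
qed

text \<open>The variables are eliminated one at a time: the set \<open>A\<close> below collects those for which
  coefficients have already been compared.\<close>

lemma multi_series_unique:
  fixes a :: "('d::finite \<Rightarrow> nat) \<Rightarrow> complex"
  assumes "0 < r" and sm: "(\<lambda>\<alpha>. cmod (a \<alpha>) * r ^ msize \<alpha>) summable_on UNIV"
    and "0 < s" "s \<le> r"
    and zero: "\<And>z :: complex ^ 'd. (\<And>j. cmod (z $ j) \<le> s) \<Longrightarrow> (\<Sum>\<^sub>\<infinity>\<alpha>. a \<alpha> * mpower z \<alpha>) = 0"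
  shows "a \<beta> = 0"
proof -
  have "(\<Sum>\<^sub>\<infinity>\<alpha>\<in>{\<alpha>. \<forall>j\<in>A. \<alpha> j = \<beta> j}. a \<alpha> * (\<Prod>j\<in>-A. (z $ j) ^ \<alpha> j)) = 0"
    if "\<And>j. cmod (z $ j) \<le> s" for A :: "'d set" and z :: "complex ^ 'd"
    using finite[of A] that
  proof (induction A arbitrary: z rule: finite_induct)
    case empty
    then show ?case using zero[of z] by (simp add: mpower_def)
  next
    case (insert k A)
    let ?S = "{\<alpha>. \<forall>j\<in>A. \<alpha> j = \<beta> j}"
    define g where "g \<alpha> = a \<alpha> * (\<Prod>j\<in>-(insert k A). (z $ j) ^ \<alpha> j)" for \<alpha>
    have split: "(\<Prod>j\<in>-A. (f j :: 'b::comm_monoid_mult)) = f k * (\<Prod>j\<in>-(insert k A). f j)" for f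
    proof -
      have "- A = insert k (- (insert k A))" using insert by auto
      then show ?thesis by (metis ComplI finite_code insertI1 ComplD prod.insert)
    qed
    have "(\<Sum>\<^sub>\<infinity>\<alpha>\<in>{\<alpha>\<in>?S. \<alpha> k = \<beta> k}. g \<alpha>) = 0"
    proof (rule multi_series_coefficient_fibre[OF \<open>0 < s\<close>])
      show "(\<lambda>\<alpha>. cmod (g \<alpha>) * s ^ \<alpha> k) summable_on ?S"
      proof (rule summable_on_comparison_test)
        \<comment> \<open>On the fibre the variables in \<open>A\<close> have fixed exponents and
          contribute a constant; dividing by it allows comparison with the full majorant.\<close>
        let ?c = "1 / (\<Prod>j\<in>A. s ^ \<beta> j)"
        have "(\<lambda>\<alpha>. cmod (a \<alpha>) * s ^ msize \<alpha>) summable_on UNIV"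
          by (rule summable_on_comparison_test[OF sm])
            (use assms in \<open>auto intro!: mult_left_mono power_mono\<close>)
        then show "(\<lambda>\<alpha>. ?c * (cmod (a \<alpha>) * s ^ msize \<alpha>)) summable_on ?S"
          by (intro summable_on_cmult_right) (rule summable_on_subset, auto)
        fix \<alpha> assume \<alpha>: "\<alpha> \<in> ?S"
        have "cmod (\<Prod>j\<in>-(insert k A). (z $ j) ^ \<alpha> j) \<le> (\<Prod>j\<in>-(insert k A). s ^ \<alpha> j)"
          using insert.prems
          by (auto simp: prod_norm[symmetric] norm_power intro!: prod_mono power_mono)
        then have "cmod (g \<alpha>) * s ^ \<alpha> k \<le> cmod (a \<alpha>) * (\<Prod>j\<in>-(insert k A). s ^ \<alpha> j) * s ^ \<alpha> k"
          using assms by (auto simp: g_def norm_mult intro!: mult_right_mono mult_left_mono)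
        also have "\<dots> = cmod (a \<alpha>) * (\<Prod>j\<in>-A. s ^ \<alpha> j)" by (simp add: split)
        also have "(\<Prod>j\<in>-A. s ^ \<alpha> j) = ?c * s ^ msize \<alpha>"
        proof -
          have "s ^ msize \<alpha> = (\<Prod>j\<in>A \<union> -A. s ^ \<alpha> j)" by (simp add: msize_def power_sum)
          also have "\<dots> = (\<Prod>j\<in>A. s ^ \<alpha> j) * (\<Prod>j\<in>-A. s ^ \<alpha> j)"
            by (rule prod.union_disjoint) auto
          also have "(\<Prod>j\<in>A. s ^ \<alpha> j) = (\<Prod>j\<in>A. s ^ \<beta> j)" using \<alpha> by auto
          finally show ?thesis using \<open>0 < s\<close> by (simp add: field_simps)
        qed
        finally show "cmod (g \<alpha>) * s ^ \<alpha> k \<le> ?c * (cmod (a \<alpha>) * s ^ msize \<alpha>)"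
          by (simp add: mult_ac)
      qed (use \<open>0 < s\<close> in auto)
      fix t assume t: "cmod t \<le> s"
      define z' where "z' = (\<chi> j. if j = k then t else z $ j)"
      have "(\<Prod>j\<in>-A. (z' $ j) ^ \<alpha> j) = t ^ \<alpha> k * (\<Prod>j\<in>-(insert k A). (z $ j) ^ \<alpha> j)" for \<alpha>
        unfolding split by (auto simp: z'_def intro!: prod.cong)
      then show "(\<Sum>\<^sub>\<infinity>\<alpha>\<in>?S. g \<alpha> * t ^ \<alpha> k) = 0"
        using insert.IH[of z'] insert.prems t by (simp add: g_def z'_def mult_ac)
    qed
    moreover have "{\<alpha>\<in>?S. \<alpha> k = \<beta> k} = {\<alpha>. \<forall>j\<in>insert k A. \<alpha> j = \<beta> j}" by auto
    ultimately show ?case unfolding g_def by simp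
  qed
  \<comment> \<open>With all variables eliminated the index set is the single \<beta> and the
    product is empty, so any point of the polydisc, such as 0, serves.\<close>
  from this[of 0 UNIV] show ?thesis
    using \<open>0 < s\<close> by (simp add: fun_eq_iff[symmetric])
qed

text \<open>Here \<open>A\<close> bounds the sum of the sizes of the value, the linear part and the remainder of \<open>f\<close>
  at \<open>z\<close> on the polydisc of radius \<open>s\<close>. Bounds of this shape multiply.\<close>

definition first_order_majorant ::
    "complex ^ 'd::finite \<Rightarrow> real \<Rightarrow> (complex ^ 'd \<Rightarrow> complex) \<Rightarrow> real \<Rightarrow> bool" where
  "first_order_majorant z s f A \<longleftrightarrow>
     (\<exists>c p q u. 0 \<le> p \<and> 0 \<le> q \<and> 0 \<le> u \<and> p + q + u \<le> A \<and> cmod (f z) \<le> p \<and>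
       (\<forall>t h. 0 \<le> t \<and> t \<le> 1 \<and> (\<forall>j. cmod (h $ j) \<le> t * s) \<longrightarrow>
          cmod (\<Sum>j\<in>UNIV. h $ j * c j) \<le> t * q \<and>
          cmod (f (z + h) - f z - (\<Sum>j\<in>UNIV. h $ j * c j)) \<le> t\<^sup>2 * u))"

lemma first_order_majorant_const: "first_order_majorant z s (\<lambda>_. 1) 1"
  unfolding first_order_majorant_def
  by (rule exI[of _ "\<lambda>_. 0"], rule exI[of _ 1], rule exI[of _ 0], rule exI[of _ 0]) auto

lemma first_order_majorant_coord:
  assumes "0 \<le> s"
  shows "first_order_majorant z s (\<lambda>w. w $ k) (cmod (z $ k) + s)"
  unfolding first_order_majorant_def
  by (rule exI[of _ "\<lambda>j. of_bool (j = k)"], rule exI[of _ "cmod (z $ k)"], rule exI[of _ s],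
      rule exI[of _ 0]) (use assms in \<open>auto simp: of_bool_def if_distrib cong: if_cong\<close>)

text \<open>Writing each function as value plus linear part plus remainder, the nine products in (p
  + q + u) (p' + q' + u') sort themselves by order in \<open>h\<close>, so the three new bounds add
  up to exactly the product of the old sums.\<close>

lemma first_order_majorant_mult:
  fixes z :: "complex ^ 'd::finite"
  assumes "first_order_majorant z s f A" "first_order_majorant z s g B"
  shows "first_order_majorant z s (\<lambda>w. f w * g w) (A * B)"
proof -
  obtain c p q u where f: "0 \<le> p" "0 \<le> q" "0 \<le> u" "p + q + u \<le> A" "cmod (f z) \<le> p"
    and fh: "\<And>t h. 0 \<le> t \<and> t \<le> 1 \<and> (\<forall>j. cmod (h $ j) \<le> t * s) \<Longrightarrow>
          cmod (\<Sum>j\<in>UNIV. h $ j * c j) \<le> t * q \<and>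
          cmod (f (z + h) - f z - (\<Sum>j\<in>UNIV. h $ j * c j)) \<le> t\<^sup>2 * u"
    using assms(1) unfolding first_order_majorant_def by auto
  obtain c' p' q' u' where g: "0 \<le> p'" "0 \<le> q'" "0 \<le> u'" "p' + q' + u' \<le> B" "cmod (g z) \<le> p'"
    and gh: "\<And>t h. 0 \<le> t \<and> t \<le> 1 \<and> (\<forall>j. cmod (h $ j) \<le> t * s) \<Longrightarrow>
          cmod (\<Sum>j\<in>UNIV. h $ j * c' j) \<le> t * q' \<and>
          cmod (g (z + h) - g z - (\<Sum>j\<in>UNIV. h $ j * c' j)) \<le> t\<^sup>2 * u'"
    using assms(2) unfolding first_order_majorant_def by auto
  let ?c = "\<lambda>j. f z * c' j + g z * c j"
  let ?q = "p * q' + p' * q" and ?u = "p * u' + p' * u + q * q' + q * u' + u * q' + u * u'"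
  have "p * p' + ?q + ?u = (p + q + u) * (p' + q' + u')" by (simp add: algebra_simps)
  also have "\<dots> \<le> A * B" using f g by (intro mult_mono) auto
  finally have sum: "p * p' + ?q + ?u \<le> A * B" .
  have main: "cmod (\<Sum>j\<in>UNIV. h $ j * ?c j) \<le> t * ?q \<and>
      cmod (f (z + h) * g (z + h) - f z * g z - (\<Sum>j\<in>UNIV. h $ j * ?c j)) \<le> t\<^sup>2 * ?u"
    if th: "0 \<le> t \<and> t \<le> 1 \<and> (\<forall>j. cmod (h $ j) \<le> t * s)" for t and h :: "complex ^ 'd"
  proof -
    define L R L' R' where "L = (\<Sum>j\<in>UNIV. h $ j * c j)" and "R = f (z + h) - f z - L"
      and "L' = (\<Sum>j\<in>UNIV. h $ j * c' j)" and "R' = g (z + h) - g z - L'"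
    have b: "cmod L \<le> t * q" "cmod R \<le> t\<^sup>2 * u" "cmod L' \<le> t * q'" "cmod R' \<le> t\<^sup>2 * u'"
      using fh[OF th] gh[OF th] by (auto simp: L_def R_def L'_def R'_def)
    have lin: "(\<Sum>j\<in>UNIV. h $ j * ?c j) = f z * L' + g z * L"
      by (simp add: L_def L'_def sum_distrib_left sum.distrib[symmetric] algebra_simps)
    have t: "0 \<le> t" "t \<le> 1" using th by auto
    \<comment> \<open>Since t \<le> 1, a remainder also counts as first order, so the product of any
      two non-constant parts is of order \<open>t\<^sup>2\<close>.\<close>
    have b': "cmod R \<le> t * u" "cmod R' \<le> t * u'"
      using b t f g mult_left_mono[of t 1 t]
      by (auto simp: power2_eq_square intro: order_trans mult_right_mono)
    have "cmod (f z * L' + g z * L) \<le> cmod (f z) * cmod L' + cmod (g z) * cmod L"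
      by (metis norm_mult norm_triangle_ineq)
    also have "\<dots> \<le> p * (t * q') + p' * (t * q)"
      using b f g t by (intro add_mono mult_mono) auto
    finally have 1: "cmod (f z * L' + g z * L) \<le> t * ?q" by (simp add: algebra_simps)
    have "f (z + h) = f z + L + R" "g (z + h) = g z + L' + R'"
      by (simp_all add: R_def R'_def)
    then have "f (z + h) * g (z + h) - f z * g z - (f z * L' + g z * L) =
        f z * R' + g z * R + L * L' + L * R' + R * L' + R * R'"
      by (simp add: algebra_simps)
    also have "cmod \<dots> \<le> cmod (f z) * cmod R' + cmod (g z) * cmod R + cmod L * cmod L' +
        cmod L * cmod R' + cmod R * cmod L' + cmod R * cmod R'"
      unfolding norm_mult[symmetric] by (intro norm_triangle_le add_mono order_refl)
    also have "\<dots> \<le> p * (t\<^sup>2 * u') + p' * (t\<^sup>2 * u) + (t * q) * (t * q') +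
        (t * q) * (t * u') + (t * u) * (t * q') + (t * u) * (t * u')"
      using b b' f g t by (intro add_mono mult_mono) auto
    finally have 2: "cmod (f (z + h) * g (z + h) - f z * g z - (f z * L' + g z * L)) \<le> t\<^sup>2 * ?u"
      by (simp add: algebra_simps power2_eq_square)
    show ?thesis using 1 2 by (simp add: lin)
  qed
  have "cmod (f z * g z) \<le> p * p'" using f g by (simp add: norm_mult mult_mono)
  then show ?thesis
    unfolding first_order_majorant_def using main sum f(1-3) g(1-3)
    by (intro exI[of _ ?c] exI[of _ "p * p'"] exI[of _ ?q] exI[of _ ?u]) auto
qed

text \<open>By multiplicativity the majorant of a monomial is the monomial at the moduli
  \<open>cmod (z $ j) + s\<close>. No binomial expansion is needed, and no factor polynomial in
  \<alpha> arises.\<close>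

lemma first_order_majorant_mpower:
  fixes z :: "complex ^ 'd::finite"
  assumes "0 \<le> s"
  shows "first_order_majorant z s (\<lambda>w. mpower w \<alpha>) (\<Prod>j\<in>UNIV. (cmod (z $ j) + s) ^ \<alpha> j)"
proof -
  have pow: "first_order_majorant z s (\<lambda>w. (w $ j) ^ n) ((cmod (z $ j) + s) ^ n)" for j n
  proof (induction n)
    case 0
    show ?case using first_order_majorant_const by simp
  next
    case (Suc n)
    show ?case
      using first_order_majorant_mult[OF first_order_majorant_coord[OF assms] Suc] by simp
  qed
  have "first_order_majorant z s (\<lambda>w. \<Prod>j\<in>J. (w $ j) ^ \<alpha> j) (\<Prod>j\<in>J. (cmod (z $ j) + s) ^ \<alpha> j)"
    for J
    using finite[of J]
  proof (induction J rule: finite_induct)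
    case empty
    show ?case using first_order_majorant_const by simp
  next
    case (insert k J)
    then show ?case using first_order_majorant_mult[OF pow insert.IH] by simp
  qed
  then show ?thesis unfolding mpower_def .
qed

lemma mpower_first_order:
  fixes z :: "complex ^ 'd::finite"
  assumes "0 < s" "\<And>j. cmod (z $ j) + s \<le> r"
  obtains c :: "('d \<Rightarrow> nat) \<Rightarrow> 'd \<Rightarrow> complex" where
    "\<And>\<alpha> j. cmod (c \<alpha> j) \<le> r ^ msize \<alpha> / s"
    "\<And>\<alpha> h. norm h \<le> s \<Longrightarrow> cmod (mpower (z + h) \<alpha> - mpower z \<alpha> - (\<Sum>j\<in>UNIV. h $ j * c \<alpha> j))
       \<le> (norm h / s)\<^sup>2 * r ^ msize \<alpha>"
proof -
  have "\<exists>c. (\<forall>j. cmod (c j) \<le> r ^ msize \<alpha> / s) \<and>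
     (\<forall>h. norm h \<le> s \<longrightarrow> cmod (mpower (z + h) \<alpha> - mpower z \<alpha> - (\<Sum>j\<in>UNIV. h $ j * c j))
       \<le> (norm h / s)\<^sup>2 * r ^ msize \<alpha>)" for \<alpha> :: "'d \<Rightarrow> nat"
  proof -
    have "(\<Prod>j\<in>UNIV. (cmod (z $ j) + s) ^ \<alpha> j) \<le> (\<Prod>j\<in>UNIV. r ^ \<alpha> j)"
      using assms by (intro prod_mono) (auto intro!: power_mono)
    then have le: "(\<Prod>j\<in>UNIV. (cmod (z $ j) + s) ^ \<alpha> j) \<le> r ^ msize \<alpha>"
      by (simp add: msize_def power_sum)
    obtain c p q u where f: "0 \<le> p" "0 \<le> q" "0 \<le> u"
      "p + q + u \<le> (\<Prod>j\<in>UNIV. (cmod (z $ j) + s) ^ \<alpha> j)"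
      and fh: "\<And>t h. 0 \<le> t \<and> t \<le> 1 \<and> (\<forall>j. cmod (h $ j) \<le> t * s) \<Longrightarrow>
          cmod (\<Sum>j\<in>UNIV. h $ j * c j) \<le> t * q \<and>
          cmod (mpower (z + h) \<alpha> - mpower z \<alpha> - (\<Sum>j\<in>UNIV. h $ j * c j)) \<le> t\<^sup>2 * u"
      using first_order_majorant_mpower[of s z \<alpha>] \<open>0 < s\<close> unfolding first_order_majorant_def
      by auto
    have qu: "q \<le> r ^ msize \<alpha>" "u \<le> r ^ msize \<alpha>" using f le by auto
    have "cmod (c k) \<le> r ^ msize \<alpha> / s" for k
    proof -
      \<comment> \<open>Testing on \<open>s\<close> times the k-th basis vector, with t = 1,
        isolates the k-th coefficient.\<close>
      have "cmod (\<Sum>j\<in>UNIV. (axis k (complex_of_real s)) $ j * c j) \<le> 1 * q"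
        using fh[of 1 "axis k (complex_of_real s)"] \<open>0 < s\<close> by (simp add: axis_def)
      also have "(\<Sum>j\<in>UNIV. (axis k (complex_of_real s)) $ j * c j) = complex_of_real s * c k"
        by (simp add: axis_def if_distrib[of "\<lambda>x. x * _"] cong: if_cong)
      finally show ?thesis using \<open>0 < s\<close> qu by (simp add: norm_mult field_simps)
    qed
    moreover have "cmod (mpower (z + h) \<alpha> - mpower z \<alpha> - (\<Sum>j\<in>UNIV. h $ j * c j))
       \<le> (norm h / s)\<^sup>2 * r ^ msize \<alpha>" if "norm h \<le> s" for h
    proof -
      have "cmod (mpower (z + h) \<alpha> - mpower z \<alpha> - (\<Sum>j\<in>UNIV. h $ j * c j)) \<le> (norm h / s)\<^sup>2 * u"
        using fh[of "norm h / s" h] that \<open>0 < s\<close> Finite_Cartesian_Product.norm_nth_le[of h] by simp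
      also have "\<dots> \<le> (norm h / s)\<^sup>2 * r ^ msize \<alpha>" using qu by (intro mult_left_mono) auto
      finally show ?thesis .
    qed
    ultimately show ?thesis by blast
  qed
  then show ?thesis using that by metis
qed

text \<open>The linear coefficients \<open>c\<close> depend on \<open>z\<close>, \<open>s\<close>
  and \<open>r\<close> but not on the series \<open>a\<close>. Sharing them among all vertices is
  what later makes the partial derivatives elements of the joint kernel.\<close>

lemma multi_series_first_order:
  fixes z :: "complex ^ 'd::finite"
  assumes "0 < s" "\<And>j. cmod (z $ j) + s \<le> r"
  obtains c :: "('d \<Rightarrow> nat) \<Rightarrow> 'd \<Rightarrow> complex" where
    "\<And>a j. (\<lambda>\<alpha>. cmod (a \<alpha>) * r ^ msize \<alpha>) summable_on UNIV \<Longrightarrow>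
       (\<lambda>\<alpha>. a \<alpha> * c \<alpha> j) summable_on UNIV"
    "\<And>a h. (\<lambda>\<alpha>. cmod (a \<alpha>) * r ^ msize \<alpha>) summable_on UNIV \<Longrightarrow> norm h \<le> s \<Longrightarrow>
       cmod ((\<Sum>\<^sub>\<infinity>\<alpha>. a \<alpha> * mpower (z + h) \<alpha>) - (\<Sum>\<^sub>\<infinity>\<alpha>. a \<alpha> * mpower z \<alpha>) -
         (\<Sum>j\<in>UNIV. h $ j * (\<Sum>\<^sub>\<infinity>\<alpha>. a \<alpha> * c \<alpha> j)))
       \<le> (norm h / s)\<^sup>2 * (\<Sum>\<^sub>\<infinity>\<alpha>. cmod (a \<alpha>) * r ^ msize \<alpha>)"
proof -
  obtain c :: "('d \<Rightarrow> nat) \<Rightarrow> 'd \<Rightarrow> complex" where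
    c1: "\<And>\<alpha> j. cmod (c \<alpha> j) \<le> r ^ msize \<alpha> / s" and
    c2: "\<And>\<alpha> h. norm h \<le> s \<Longrightarrow> cmod (mpower (z + h) \<alpha> - mpower z \<alpha> - (\<Sum>j\<in>UNIV. h $ j * c \<alpha> j))
       \<le> (norm h / s)\<^sup>2 * r ^ msize \<alpha>"
    using mpower_first_order[OF assms] by metis
  show ?thesis
  proof (rule that[of c])
    fix a :: "('d \<Rightarrow> nat) \<Rightarrow> complex"
    assume sm: "(\<lambda>\<alpha>. cmod (a \<alpha>) * r ^ msize \<alpha>) summable_on UNIV"
    show smc: "(\<lambda>\<alpha>. a \<alpha> * c \<alpha> j) summable_on UNIV" for j
    proof (rule Infinite_Sum.abs_summable_summable,
        rule Infinite_Sum.abs_summable_on_comparison_test')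
      show "(\<lambda>\<alpha>. cmod (a \<alpha>) * r ^ msize \<alpha> * (1 / s)) summable_on UNIV"
        by (rule summable_on_cmult_left[OF sm])
      show "cmod (a \<alpha> * c \<alpha> j) \<le> cmod (a \<alpha>) * r ^ msize \<alpha> * (1 / s)" for \<alpha>
        using mult_left_mono[OF c1[of \<alpha> j], of "cmod (a \<alpha>)"] by (simp add: norm_mult)
    qed
    fix h :: "complex ^ 'd" assume h: "norm h \<le> s"
    have coord: "cmod ((z + h) $ j) \<le> r" "cmod (z $ j) \<le> r" for j
      using assms(2)[of j] \<open>0 < s\<close> h Finite_Cartesian_Product.norm_nth_le[of h j]
        norm_triangle_ineq[of "z $ j" "h $ j"] by auto
    have s1: "(\<lambda>\<alpha>. a \<alpha> * mpower (z + h) \<alpha>) summable_on UNIV"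
      and s2: "(\<lambda>\<alpha>. a \<alpha> * mpower z \<alpha>) summable_on UNIV"
      by (rule Infinite_Sum.abs_summable_summable, rule multi_series_abs_summable[OF sm coord(1)],
          rule Infinite_Sum.abs_summable_summable, rule multi_series_abs_summable[OF sm coord(2)])
    have "((\<lambda>\<alpha>. a \<alpha> * mpower (z + h) \<alpha> - a \<alpha> * mpower z \<alpha> - (\<Sum>j\<in>UNIV. h $ j * (a \<alpha> * c \<alpha> j)))
      has_sum ((\<Sum>\<^sub>\<infinity>\<alpha>. a \<alpha> * mpower (z + h) \<alpha>) - (\<Sum>\<^sub>\<infinity>\<alpha>. a \<alpha> * mpower z \<alpha>) -
         (\<Sum>j\<in>UNIV. h $ j * (\<Sum>\<^sub>\<infinity>\<alpha>. a \<alpha> * c \<alpha> j)))) UNIV"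
      using s1 s2 smc unfolding diff_conv_add_uminus
      by (intro has_sum_add has_sum_uminusI has_sum_sum has_sum_cmult_right has_sum_infsum)
    moreover have "((\<lambda>\<alpha>. (norm h / s)\<^sup>2 * (cmod (a \<alpha>) * r ^ msize \<alpha>)) has_sum
        ((norm h / s)\<^sup>2 * (\<Sum>\<^sub>\<infinity>\<alpha>. cmod (a \<alpha>) * r ^ msize \<alpha>))) UNIV"
      using sm by (intro has_sum_cmult_right has_sum_infsum)
    moreover have "cmod (a \<alpha> * mpower (z + h) \<alpha> - a \<alpha> * mpower z \<alpha> -
        (\<Sum>j\<in>UNIV. h $ j * (a \<alpha> * c \<alpha> j))) \<le> (norm h / s)\<^sup>2 * (cmod (a \<alpha>) * r ^ msize \<alpha>)" for \<alpha>
    proof -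
      have "a \<alpha> * mpower (z + h) \<alpha> - a \<alpha> * mpower z \<alpha> - (\<Sum>j\<in>UNIV. h $ j * (a \<alpha> * c \<alpha> j)) =
        a \<alpha> * (mpower (z + h) \<alpha> - mpower z \<alpha> - (\<Sum>j\<in>UNIV. h $ j * c \<alpha> j))"
        by (simp add: algebra_simps sum_distrib_left)
      then show ?thesis
        using mult_left_mono[OF c2[OF h, of \<alpha>], of "cmod (a \<alpha>)"]
        by (simp only: norm_mult norm_ge_zero mult.left_commute)
    qed
    ultimately show "cmod ((\<Sum>\<^sub>\<infinity>\<alpha>. a \<alpha> * mpower (z + h) \<alpha>) - (\<Sum>\<^sub>\<infinity>\<alpha>. a \<alpha> * mpower z \<alpha>) -
         (\<Sum>j\<in>UNIV. h $ j * (\<Sum>\<^sub>\<infinity>\<alpha>. a \<alpha> * c \<alpha> j)))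
       \<le> (norm h / s)\<^sup>2 * (\<Sum>\<^sub>\<infinity>\<alpha>. cmod (a \<alpha>) * r ^ msize \<alpha>)"
      by (rule norm_infsum_le)
  qed
qed

section \<open>Hilbert spaces and square-summable families\<close>

context complex_hilbert_space
begin

lemma carrier_add: "x \<in> hcarrier H \<Longrightarrow> y \<in> hcarrier H \<Longrightarrow> x + y \<in> hcarrier H"
  and carrier_scale: "x \<in> hcarrier H \<Longrightarrow> hscale H a x \<in> hcarrier H"
  and carrier_zero: "0 \<in> hcarrier H"
  and carrier_diff: "x \<in> hcarrier H \<Longrightarrow> y \<in> hcarrier H \<Longrightarrow> x - y \<in> hcarrier H"
  using carrier_subspace subspace_add subspace_scale subspace_0 subspace_diff by blast+

lemma inner_diff:
  "x \<in> hcarrier H \<Longrightarrow> y \<in> hcarrier H \<Longrightarrow> z \<in> hcarrier H \<Longrightarrow>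
    hinner H (x - y) z = hinner H x z - hinner H y z"
  using inner_add[of "x - y" y z] carrier_diff by simp

lemma inner_zero_left: "x \<in> hcarrier H \<Longrightarrow> hinner H 0 x = 0"
  using inner_diff[of x x x] by simp

lemma inner_self_Re: "x \<in> hcarrier H \<Longrightarrow> hinner H x x = complex_of_real (Re (hinner H x x))"
  using inner_commute[of x x] by (metis Reals_cnj_iff of_real_Re)

lemma inner_self_nonneg: "x \<in> hcarrier H \<Longrightarrow> 0 \<le> Re (hinner H x x)"
  using inner_pos[of x] inner_zero_left[of 0] by (cases "x = 0") (auto simp: carrier_zero)

lemma hnorm_nonneg: "0 \<le> hnorm H x" if "x \<in> hcarrier H"
  using inner_self_nonneg[OF that] by (simp add: hnorm_def)

lemma hnorm_sq: "x \<in> hcarrier H \<Longrightarrow> hinner H x x = complex_of_real ((hnorm H x)\<^sup>2)"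
  using inner_self_Re inner_self_nonneg by (simp add: hnorm_def)

lemma hnorm_pos: "x \<in> hcarrier H \<Longrightarrow> x \<noteq> 0 \<Longrightarrow> 0 < hnorm H x"
  using inner_pos by (simp add: hnorm_def)

lemma cauchy_schwarz:
  assumes "x \<in> hcarrier H" "y \<in> hcarrier H"
  shows "cmod (hinner H x y) \<le> hnorm H x * hnorm H y"
proof (cases "y = 0")
  case True
  then show ?thesis
    using assms inner_commute[of x 0] inner_zero_left[of x] inner_zero_left[of 0]
    by (simp add: hnorm_def)
next
  case False
  define n where "n = hnorm H y"
  have n: "n > 0" using hnorm_pos assms False by (simp add: n_def)
  define b where "b = hinner H x y / of_real (n\<^sup>2)"
  have y: "hscale H b y \<in> hcarrier H" using assms carrier_scale by blast
  then have xy: "x - hscale H b y \<in> hcarrier H" using assms carrier_diff by blast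
  have "hinner H (x - hscale H b y) (x - hscale H b y) =
      hinner H x (x - hscale H b y) - b * hinner H y (x - hscale H b y)"
    using assms xy y inner_diff inner_scale by simp
  also have "hinner H y (x - hscale H b y) = cnj (hinner H x y - b * hinner H y y)"
    using inner_commute[OF assms(2) xy] assms y inner_diff[OF assms(1) y assms(2)] inner_scale by simp
  also have "\<dots> = 0"
    using n assms by (simp add: b_def hnorm_sq n_def[symmetric])
  also have "hinner H x (x - hscale H b y) = cnj (hinner H x x - b * hinner H y x)"
    using inner_commute[OF assms(1) xy] assms y inner_diff[OF assms(1) y assms(1)] inner_scale by simp
  also have "b * hinner H y x = of_real ((cmod (hinner H x y))\<^sup>2 / n\<^sup>2)"
    using inner_commute[OF assms(2,1)] complex_norm_square[of "hinner H x y"] by (simp add: b_def)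
  finally have "Re (hinner H (x - hscale H b y) (x - hscale H b y)) =
      (hnorm H x)\<^sup>2 - (cmod (hinner H x y))\<^sup>2 / n\<^sup>2"
    using assms by (simp add: hnorm_sq)
  then have "(cmod (hinner H x y))\<^sup>2 / n\<^sup>2 \<le> (hnorm H x)\<^sup>2"
    using inner_self_nonneg[OF xy] by simp
  then have "(cmod (hinner H x y))\<^sup>2 \<le> (hnorm H x * n)\<^sup>2"
    using n by (simp add: divide_le_eq power_mult_distrib)
  then show ?thesis
    using n hnorm_nonneg[OF assms(1)] power2_le_imp_le[of "cmod (hinner H x y)" "hnorm H x * n"]
    by (simp add: n_def)
qed

lemma inner_eqI:
  assumes "x \<in> hcarrier H" "y \<in> hcarrier H"
    and "\<And>z. z \<in> hcarrier H \<Longrightarrow> hinner H z x = hinner H z y"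
  shows "x = y"
proof (rule ccontr)
  assume "x \<noteq> y"
  have xy: "x - y \<in> hcarrier H" using assms carrier_diff by blast
  have "hinner H (x - y) (x - y) = 0"
    unfolding inner_diff[OF assms(1,2) xy] inner_commute[OF assms(1) xy] inner_commute[OF assms(2) xy]
    using assms(3)[OF xy] by simp
  then show False using inner_pos[OF xy] \<open>x \<noteq> y\<close> by simp
qed

end

section \<open>Square-summable functions\<close>

lemma ell2_simps:
  "f \<in> hcarrier (ell2 V) \<longleftrightarrow> (\<forall>v. v \<notin> V \<longrightarrow> f v = 0) \<and> (\<lambda>v. (cmod (f v))\<^sup>2) summable_on V"
  "hscale (ell2 V) = (\<lambda>a f v. a * f v)"
  "hinner (ell2 V) f g = (\<Sum>\<^sub>\<infinity>v\<in>V. f v * cnj (g v))"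
  by (simp_all add: ell2_def)

lemma ell2_finite_bound:
  assumes "\<And>v. v \<notin> V \<Longrightarrow> f v = 0"
    and "\<And>F. finite F \<Longrightarrow> F \<subseteq> V \<Longrightarrow> (\<Sum>v\<in>F. (cmod (f v))\<^sup>2) \<le> C"
  shows "f \<in> hcarrier (ell2 V)" "hnorm (ell2 V) f \<le> sqrt C"
proof -
  have sm: "(\<lambda>v. (cmod (f v))\<^sup>2) summable_on V"
    by (rule nonneg_bounded_partial_sums_imp_summable_on[where C = C])
      (use assms(2) in \<open>auto intro: eventually_finite_subsets_at_top_weakI\<close>)
  then show "f \<in> hcarrier (ell2 V)" using assms(1) by (simp add: ell2_simps)
  have "(\<Sum>\<^sub>\<infinity>v\<in>V. (cmod (f v))\<^sup>2) \<le> C"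
    using sm assms(2) by (intro infsum_le_finite_sums) auto
  moreover have "(\<Sum>\<^sub>\<infinity>v\<in>V. f v * cnj (f v)) = complex_of_real (\<Sum>\<^sub>\<infinity>v\<in>V. (cmod (f v))\<^sup>2)"
    unfolding complex_norm_square[symmetric]
    by (rule infsumI, subst has_sum_of_real_iff, rule has_sum_infsum[OF sm])
  ultimately show "hnorm (ell2 V) f \<le> sqrt C" by (simp add: hnorm_def ell2_simps)
qed

lemma ell2_hnorm_sq:
  assumes "f \<in> hcarrier (ell2 V)"
  shows "(hnorm (ell2 V) f)\<^sup>2 = (\<Sum>\<^sub>\<infinity>v\<in>V. (cmod (f v))\<^sup>2)"
proof -
  have sm: "(\<lambda>v. (cmod (f v))\<^sup>2) summable_on V" using assms by (simp add: ell2_simps)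
  have "(\<Sum>\<^sub>\<infinity>v\<in>V. f v * cnj (f v)) = complex_of_real (\<Sum>\<^sub>\<infinity>v\<in>V. (cmod (f v))\<^sup>2)"
    unfolding complex_norm_square[symmetric]
    by (rule infsumI, subst has_sum_of_real_iff, rule has_sum_infsum[OF sm])
  then show ?thesis by (simp add: hnorm_def ell2_simps infsum_nonneg)
qed

lemma ell2_sum_le:
  assumes "f \<in> hcarrier (ell2 V)" "finite F" "F \<subseteq> V"
  shows "(\<Sum>v\<in>F. (cmod (f v))\<^sup>2) \<le> (hnorm (ell2 V) f)\<^sup>2"
  using assms unfolding ell2_hnorm_sq[OF assms(1)] by (intro finite_sum_le_infsum) (auto simp: ell2_simps)

lemma ell2_hnorm_nonneg: "0 \<le> hnorm (ell2 V) f"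
proof -
  have "0 \<le> Re (\<Sum>\<^sub>\<infinity>v\<in>V. f v * cnj (f v))"
  proof (cases "(\<lambda>v. f v * cnj (f v)) summable_on V")
    case True
    then have "Re (\<Sum>\<^sub>\<infinity>v\<in>V. f v * cnj (f v)) = (\<Sum>\<^sub>\<infinity>v\<in>V. Re (f v * cnj (f v)))"
      by (metis has_sum_Re has_sum_infsum infsumI)
    then show ?thesis by (simp add: infsum_nonneg)
  qed (simp add: infsum_not_exists)
  then show ?thesis by (simp add: hnorm_def ell2_simps)
qed

lemma ell2_pointwise:
  assumes "f \<in> hcarrier (ell2 V)"
  shows "cmod (f v) \<le> hnorm (ell2 V) f"
proof (cases "v \<in> V")
  case True
  then show ?thesis using ell2_sum_le[OF assms, of "{v}"] ell2_hnorm_nonneg[of V f]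
      power2_le_imp_le[of "cmod (f v)" "hnorm (ell2 V) f"] by simp
next
  case False
  then show ?thesis using assms ell2_hnorm_nonneg[of V f] by (simp add: ell2_simps)
qed

lemma ell2_finite_support:
  assumes "finite B" "B \<subseteq> V" "\<And>v. v \<notin> B \<Longrightarrow> f v = 0"
  shows "f \<in> hcarrier (ell2 V)" "(hnorm (ell2 V) f)\<^sup>2 = (\<Sum>v\<in>B. (cmod (f v))\<^sup>2)"
    "hinner (ell2 V) g f = (\<Sum>v\<in>B. g v * cnj (f v))" "hinner (ell2 V) f g = (\<Sum>v\<in>B. f v * cnj (g v))"
proof -
  have hs: "((\<lambda>v. (cmod (f v))\<^sup>2) has_sum (\<Sum>v\<in>B. (cmod (f v))\<^sup>2)) V"
    using assms by (intro has_sum_finite_neutralI) auto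
  then show f: "f \<in> hcarrier (ell2 V)"
    using assms by (auto simp: ell2_simps summable_on_def)
  show "(hnorm (ell2 V) f)\<^sup>2 = (\<Sum>v\<in>B. (cmod (f v))\<^sup>2)"
    using hs ell2_hnorm_sq[OF f] by (simp add: infsumI)
  show "hinner (ell2 V) g f = (\<Sum>v\<in>B. g v * cnj (f v))" "hinner (ell2 V) f g = (\<Sum>v\<in>B. f v * cnj (g v))"
    unfolding ell2_simps
    by (rule infsumI, rule has_sum_finite_neutralI, use assms in auto)+
qed

lemma ell2_indicator: "v \<in> V \<Longrightarrow> (indicator {v} :: 'v \<Rightarrow> complex) \<in> hcarrier (ell2 V)"
  by (rule ell2_finite_support(1)[of "{v}"]) (auto simp: indicator_def)

lemma ell2_abs_summable_inner:
  assumes "f \<in> hcarrier (ell2 V)" "g \<in> hcarrier (ell2 V)"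
  shows "(\<lambda>v. cmod (f v * cnj (g v))) summable_on V"
proof (rule Infinite_Sum.abs_summable_on_comparison_test')
  show "(\<lambda>v. (cmod (f v))\<^sup>2 + (cmod (g v))\<^sup>2) summable_on V"
    using assms by (intro summable_on_add) (auto simp: ell2_simps)
  show "cmod (f v * cnj (g v)) \<le> (cmod (f v))\<^sup>2 + (cmod (g v))\<^sup>2" for v
  proof -
    have "0 \<le> cmod (f v) * cmod (g v)" by simp
    then show ?thesis
      using sum_squares_bound[of "cmod (f v)" "cmod (g v)"] unfolding norm_mult complex_mod_cnj
      by linarith
  qed
qed

lemma ell2_summable_inner:
  "f \<in> hcarrier (ell2 V) \<Longrightarrow> g \<in> hcarrier (ell2 V) \<Longrightarrow> (\<lambda>v. f v * cnj (g v)) summable_on V"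
  by (rule Infinite_Sum.abs_summable_summable) (rule ell2_abs_summable_inner)

lemma ell2_add:
  assumes "f \<in> hcarrier (ell2 V)" "g \<in> hcarrier (ell2 V)"
  shows "f + g \<in> hcarrier (ell2 V)"
proof -
  have "(\<lambda>v. (cmod ((f + g) v))\<^sup>2) summable_on V"
  proof (rule summable_on_comparison_test)
    show "(\<lambda>v. 2 * (cmod (f v))\<^sup>2 + 2 * (cmod (g v))\<^sup>2) summable_on V"
      using assms by (intro summable_on_add summable_on_cmult_right) (auto simp: ell2_simps)
    show "(cmod ((f + g) v))\<^sup>2 \<le> 2 * (cmod (f v))\<^sup>2 + 2 * (cmod (g v))\<^sup>2" for v
    proof -
      have "(cmod ((f + g) v))\<^sup>2 \<le> (cmod (f v) + cmod (g v))\<^sup>2"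
        by (simp add: norm_triangle_ineq power_mono)
      also have "\<dots> \<le> 2 * (cmod (f v))\<^sup>2 + 2 * (cmod (g v))\<^sup>2"
        using sum_squares_bound[of "cmod (f v)" "cmod (g v)"] by (simp add: power2_sum)
      finally show ?thesis .
    qed
  qed auto
  then show ?thesis using assms by (simp add: ell2_simps)
qed

lemma ell2_scale:
  assumes "f \<in> hcarrier (ell2 V)"
  shows "(\<lambda>v. a * f v) \<in> hcarrier (ell2 V)"
proof -
  have "(\<lambda>v. (cmod a)\<^sup>2 * (cmod (f v))\<^sup>2) summable_on V"
    using assms by (intro summable_on_cmult_right) (simp add: ell2_simps)
  then show ?thesis using assms by (simp add: ell2_simps norm_mult power_mult_distrib)
qed

lemma ell2_diff:
  assumes "f \<in> hcarrier (ell2 V)" "g \<in> hcarrier (ell2 V)"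
  shows "f - g \<in> hcarrier (ell2 V)"
proof -
  have "f - g = f + (\<lambda>v. -1 * g v)" by (auto simp: fun_eq_iff)
  then show ?thesis using ell2_add[OF assms(1) ell2_scale[OF assms(2), of "-1"]] by (simp only:)
qed

text \<open>Coordinates are dominated by the norm, so a pointwise limit exists. The Cauchy bound on
  a finite set passes to that limit with a constant free of the set, which gives membership and
  convergence at once.\<close>

lemma ell2_complete:
  assumes X: "\<And>n. X n \<in> hcarrier (ell2 V)"
    and cauchy: "\<And>e. 0 < e \<Longrightarrow> \<exists>N. \<forall>m\<ge>N. \<forall>n\<ge>N. hnorm (ell2 V) (X m - X n) < e"
  shows "\<exists>x\<in>hcarrier (ell2 V). (\<lambda>n. hnorm (ell2 V) (X n - x)) \<longlonglongrightarrow> 0"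
proof -
  have "Cauchy (\<lambda>n. X n v)" for v
  proof (rule metric_CauchyI)
    fix e :: real assume "0 < e"
    then obtain N where N: "\<forall>m\<ge>N. \<forall>n\<ge>N. hnorm (ell2 V) (X m - X n) < e" using cauchy by blast
    have "dist (X m v) (X n v) \<le> hnorm (ell2 V) (X m - X n)" for m n
      using ell2_pointwise[OF ell2_diff[OF X X], of m n v] by (simp add: dist_norm)
    then show "\<exists>M. \<forall>m\<ge>M. \<forall>n\<ge>M. dist (X m v) (X n v) < e" using N by (meson le_less_trans)
  qed
  then have "\<forall>v. \<exists>l. (\<lambda>n. X n v) \<longlonglongrightarrow> l"
    by (simp add: Cauchy_convergent_iff convergent_def)
  then obtain x where x: "\<And>v. (\<lambda>n. X n v) \<longlonglongrightarrow> x v" by metis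
  have x0: "x v = 0" if "v \<notin> V" for v
    using x[of v] X that by (simp add: ell2_simps LIMSEQ_const_iff)
  have tail: "\<exists>N. \<forall>m\<ge>N. X m - x \<in> hcarrier (ell2 V) \<and> hnorm (ell2 V) (X m - x) \<le> e" if "0 < e" for e
  proof -
    obtain N where N: "\<forall>m\<ge>N. \<forall>n\<ge>N. hnorm (ell2 V) (X m - X n) < e"
      using cauchy[OF \<open>0 < e\<close>] by blast
    have "(\<Sum>v\<in>F. (cmod ((X m - x) v))\<^sup>2) \<le> e\<^sup>2" if F: "finite F" "F \<subseteq> V" and m: "m \<ge> N" for F m
    proof (rule tendsto_upperbound)
      show "(\<lambda>n. \<Sum>v\<in>F. (cmod ((X m - X n) v))\<^sup>2) \<longlonglongrightarrow> (\<Sum>v\<in>F. (cmod ((X m - x) v))\<^sup>2)"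
        by (auto intro!: tendsto_intros x)
      show "\<forall>\<^sub>F n in sequentially. (\<Sum>v\<in>F. (cmod ((X m - X n) v))\<^sup>2) \<le> e\<^sup>2"
        using eventually_ge_at_top[of N]
      proof eventually_elim
        case (elim n)
        have "(\<Sum>v\<in>F. (cmod ((X m - X n) v))\<^sup>2) \<le> (hnorm (ell2 V) (X m - X n))\<^sup>2"
          by (rule ell2_sum_le[OF ell2_diff[OF X X] F])
        also have "\<dots> \<le> e\<^sup>2" using N m elim by (intro power_mono less_imp_le ell2_hnorm_nonneg) auto
        finally show ?case .
      qed
    qed auto
    then have "X m - x \<in> hcarrier (ell2 V) \<and> hnorm (ell2 V) (X m - x) \<le> e" if "m \<ge> N" for m
      using ell2_finite_bound[of V "X m - x" "e\<^sup>2"] that x0 X \<open>0 < e\<close> by (simp add: ell2_simps)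
    then show ?thesis by blast
  qed
  obtain N where "X N - x \<in> hcarrier (ell2 V)" using tail[of 1] by auto
  then have xc: "x \<in> hcarrier (ell2 V)" using ell2_diff[OF X[of N], of "X N - x"] by simp
  have "(\<lambda>n. hnorm (ell2 V) (X n - x)) \<longlonglongrightarrow> 0"
  proof (rule metric_LIMSEQ_I)
    fix e :: real assume "0 < e"
    then obtain N where "\<forall>m\<ge>N. hnorm (ell2 V) (X m - x) \<le> e / 2" using tail[of "e / 2"] by auto
    then show "\<exists>N. \<forall>n\<ge>N. dist (hnorm (ell2 V) (X n - x)) 0 < e"
      using \<open>0 < e\<close> by (intro exI[of _ N]) (fastforce simp: dist_norm abs_of_nonneg[OF ell2_hnorm_nonneg])
  qed
  then show ?thesis using xc by blast
qed

lemma vector_space_pointwise: "vector_space (\<lambda>a (f :: 'v \<Rightarrow> complex) v. a * f v)"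
  by unfold_locales (auto simp: fun_eq_iff algebra_simps)

lemma complex_hilbert_space_ell2: "complex_hilbert_space (ell2 V)"
proof -
  interpret vector_space "hscale (ell2 V)" using vector_space_pointwise by (simp add: ell2_simps)
  show ?thesis
  proof unfold_locales
    show "subspace (hcarrier (ell2 V))"
      by (rule subspaceI) (auto intro: ell2_add ell2_scale simp: ell2_simps(2), simp add: ell2_simps)
    show "hinner (ell2 V) (x + y) z = hinner (ell2 V) x z + hinner (ell2 V) y z"
      if "x \<in> hcarrier (ell2 V)" "y \<in> hcarrier (ell2 V)" "z \<in> hcarrier (ell2 V)" for x y z
      using that by (simp add: ell2_simps(3) infsum_add[symmetric] ell2_summable_inner algebra_simps)
    show "hinner (ell2 V) (hscale (ell2 V) a x) y = a * hinner (ell2 V) x y" for a x y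
      by (simp add: ell2_simps(2,3) infsum_cmult_right'[symmetric] mult.assoc)
    show "hinner (ell2 V) x y = cnj (hinner (ell2 V) y x)" for x y
      by (simp add: ell2_simps(3) infsum_cnj[symmetric] mult.commute)
    show "0 < Re (hinner (ell2 V) x x)" if "x \<in> hcarrier (ell2 V)" "x \<noteq> 0" for x
    proof -
      obtain v where "x v \<noteq> 0" using \<open>x \<noteq> 0\<close> by (auto simp: fun_eq_iff)
      then have "0 < hnorm (ell2 V) x" using ell2_pointwise[OF that(1), of v]
        by (simp add: less_le_trans[of 0 "cmod (x v)"])
      then show ?thesis by (simp add: hnorm_def)
    qed
  qed (rule ell2_complete)
qed

text \<open>The representing vector is given by its entries, the conjugate values on indicators,
  because later uses read those entries off. Testing on truncations of \<open>k\<close> bounds its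
  norm; the defect on a truncation of \<open>f\<close> is controlled by the tail of
  \<open>f\<close>.\<close>

lemma ell2_riesz:
  fixes \<phi> :: "('v \<Rightarrow> complex) \<Rightarrow> complex"
  assumes add: "\<And>f g. f \<in> hcarrier (ell2 V) \<Longrightarrow> g \<in> hcarrier (ell2 V) \<Longrightarrow> \<phi> (f + g) = \<phi> f + \<phi> g"
    and scale: "\<And>a f. f \<in> hcarrier (ell2 V) \<Longrightarrow> \<phi> (\<lambda>v. a * f v) = a * \<phi> f"
    and bound: "\<And>f. f \<in> hcarrier (ell2 V) \<Longrightarrow> cmod (\<phi> f) \<le> C * hnorm (ell2 V) f"
  defines "k \<equiv> \<lambda>v. if v \<in> V then cnj (\<phi> (indicator {v})) else 0"
  shows "k \<in> hcarrier (ell2 V)" "f \<in> hcarrier (ell2 V) \<Longrightarrow> \<phi> f = hinner (ell2 V) f k"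
proof -
  define cut where "cut F f = (\<lambda>v. if v \<in> F then f v else (0::complex))" for F and f :: "'v \<Rightarrow> complex"
  have cut: "cut F f \<in> hcarrier (ell2 V)" if "finite F" "F \<subseteq> V" for F f
    using ell2_finite_support(1)[OF that, of "cut F f"] by (auto simp: cut_def)
  have phi_cut: "\<phi> (cut F f) = (\<Sum>v\<in>F. f v * cnj (k v))" if "finite F" "F \<subseteq> V" for F f
    using that
  proof (induction F rule: finite_induct)
    case empty
    have "cut {} f = (\<lambda>v. 0 * cut {} f v)" by (auto simp: cut_def)
    then show ?case using scale[OF cut[of "{}" f], of 0] by simp
  next
    case (insert w F)
    have "cut (insert w F) f = cut F f + (\<lambda>v. f w * indicator {w} v)"
      using insert by (auto simp: cut_def fun_eq_iff indicator_def)
    then have "\<phi> (cut (insert w F) f) = \<phi> (cut F f) + \<phi> (\<lambda>v. f w * indicator {w} v)"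
      using insert by (simp only:) (intro add cut ell2_scale ell2_indicator, auto)
    then show ?case using insert scale[OF ell2_indicator] by (simp add: k_def)
  qed
  have "(\<Sum>v\<in>F. (cmod (k v))\<^sup>2) \<le> C\<^sup>2" if F: "finite F" "F \<subseteq> V" for F
  proof -
    define n where "n = hnorm (ell2 V) (cut F k)"
    have n2: "n\<^sup>2 = (\<Sum>v\<in>F. (cmod (k v))\<^sup>2)"
      using ell2_finite_support(2)[OF F, of "cut F k"] by (simp add: n_def cut_def)
    have "(\<Sum>v\<in>F. k v * cnj (k v)) = complex_of_real (n\<^sup>2)"
      unfolding n2 of_real_sum complex_norm_square ..
    then have "\<phi> (cut F k) = complex_of_real (n\<^sup>2)" using phi_cut[OF F, of k] by simp
    then have "n\<^sup>2 \<le> C * n"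
      using bound[OF cut[OF F], of k] unfolding n_def[symmetric] by (simp add: norm_power)
    moreover have "0 \<le> n" by (simp add: n_def ell2_hnorm_nonneg)
    ultimately have "n \<le> \<bar>C\<bar>"
      using mult_right_le_imp_le[of n n C] by (cases "n = 0") (auto simp: power2_eq_square)
    then have "n\<^sup>2 \<le> C\<^sup>2" using \<open>0 \<le> n\<close> power_mono[of n "\<bar>C\<bar>" 2] by simp
    then show ?thesis by (simp add: n2)
  qed
  then show k: "k \<in> hcarrier (ell2 V)" by (intro ell2_finite_bound(1)[of V k "C\<^sup>2"]) (auto simp: k_def)
  show "\<phi> f = hinner (ell2 V) f k" if f: "f \<in> hcarrier (ell2 V)"
  proof -
    let ?S = "\<Sum>\<^sub>\<infinity>v\<in>V. (cmod (f v))\<^sup>2" and ?L = "finite_subsets_at_top V"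
    have "((\<lambda>F. \<Sum>v\<in>F. f v * cnj (k v)) \<longlongrightarrow> hinner (ell2 V) f k) ?L"
      using has_sum_infsum[OF ell2_summable_inner[OF f k]] by (simp add: has_sum_def ell2_simps)
    moreover have "((\<lambda>F. \<Sum>v\<in>F. f v * cnj (k v)) \<longlongrightarrow> \<phi> f) ?L"
    proof -
      have "((\<lambda>F. C * sqrt (?S - (\<Sum>v\<in>F. (cmod (f v))\<^sup>2))) \<longlongrightarrow> C * sqrt (?S - ?S)) ?L"
        using f has_sum_infsum[of "\<lambda>v. (cmod (f v))\<^sup>2" V]
        by (intro tendsto_intros) (simp_all add: has_sum_def ell2_simps)
      moreover have "\<forall>\<^sub>F F in ?L. cmod ((\<Sum>v\<in>F. f v * cnj (k v)) - \<phi> f) \<le>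
          C * sqrt (?S - (\<Sum>v\<in>F. (cmod (f v))\<^sup>2))"
      proof (rule eventually_finite_subsets_at_top_weakI)
        fix F assume F: "finite F" "F \<subseteq> V"
        have fd: "f - cut F f \<in> hcarrier (ell2 V)" using ell2_diff[OF f cut[OF F]] .
        have "\<phi> f = \<phi> (f - cut F f) + \<phi> (cut F f)" using add[OF fd cut[OF F], of f] by simp
        then have "cmod ((\<Sum>v\<in>F. f v * cnj (k v)) - \<phi> f) = cmod (\<phi> (f - cut F f))"
          using phi_cut[OF F, of f] by (simp add: norm_minus_commute)
        also have "\<dots> \<le> C * hnorm (ell2 V) (f - cut F f)" by (rule bound[OF fd])
        also have "hnorm (ell2 V) (f - cut F f) = sqrt (?S - (\<Sum>v\<in>F. (cmod (f v))\<^sup>2))"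
        proof -
          have s: "(\<lambda>v. (cmod (f v))\<^sup>2) summable_on V" using f by (simp add: ell2_simps)
          have h1: "((\<lambda>v. - of_bool (v \<in> F) * (cmod (f v))\<^sup>2) has_sum (\<Sum>v\<in>F. - (cmod (f v))\<^sup>2)) V"
            using F by (intro has_sum_finite_neutralI) auto
          have "((\<lambda>v. (cmod (f v))\<^sup>2 + - of_bool (v \<in> F) * (cmod (f v))\<^sup>2) has_sum
              (?S + (\<Sum>v\<in>F. - (cmod (f v))\<^sup>2))) V"
            by (rule has_sum_add[OF has_sum_infsum[OF s] h1])
          moreover have "(\<lambda>v. (cmod (f v))\<^sup>2 + - of_bool (v \<in> F) * (cmod (f v))\<^sup>2) =
              (\<lambda>v. (cmod ((f - cut F f) v))\<^sup>2)"
            by (auto simp: cut_def fun_eq_iff)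
          ultimately have "(hnorm (ell2 V) (f - cut F f))\<^sup>2 = ?S - (\<Sum>v\<in>F. (cmod (f v))\<^sup>2)"
            unfolding ell2_hnorm_sq[OF fd] by (simp add: infsumI sum_negf)
          then show ?thesis by (intro real_sqrt_unique[symmetric] ell2_hnorm_nonneg)
        qed
        finally show "cmod ((\<Sum>v\<in>F. f v * cnj (k v)) - \<phi> f) \<le>
          C * sqrt (?S - (\<Sum>v\<in>F. (cmod (f v))\<^sup>2))" .
      qed
      ultimately have "((\<lambda>F. (\<Sum>v\<in>F. f v * cnj (k v)) - \<phi> f) \<longlongrightarrow> 0) ?L"
        using Lim_null_comparison[where net = ?L] by simp
      then show ?thesis by (rule LIM_zero_cancel)
    qed
    ultimately show ?thesis
      by (intro tendsto_unique[OF finite_subsets_at_top_neq_bot])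
  qed
qed

section \<open>Shifts on products of trees\<close>

lemma product_verts_iff: "v \<in> product_verts T \<longleftrightarrow> (\<forall>j. v j \<in> pverts (T j))"
  by (simp add: product_digraph_def)

locale tree_product =
  fixes T :: "'d::finite \<Rightarrow> 'a pair_pre_digraph"
  assumes tree: "\<And>j. leafless_tree (T j)"
    and finite_index: "finite_joint_branching_index T"
begin

abbreviation V :: "('d \<Rightarrow> 'a) set" where "V \<equiv> product_verts T"

text \<open>The domain for all the algebra, free of summability. Vanishing is required because
  \<open>down j (up j f)\<close> is 0 wherever the j-th coordinate is not a vertex.\<close>

definition vanishes_off :: "(('d \<Rightarrow> 'a) \<Rightarrow> complex) \<Rightarrow> bool" where
  "vanishes_off f \<longleftrightarrow> (\<forall>v. v \<notin> V \<longrightarrow> f v = 0)"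

definition nchi :: "'d \<Rightarrow> 'a \<Rightarrow> complex" where
  "nchi j x = complex_of_real (sqrt (real (card (Chi (T j) x))))"

text \<open>\<open>up j\<close> is the multishift with constant weights along each set of children, normalised to be
  isometric in the direction \<open>j\<close>; \<open>down j\<close> is its adjoint, and \<open>wander j\<close> is the projection
  onto the kernel of \<open>down j\<close>.\<close>

definition down :: "'d \<Rightarrow> (('d \<Rightarrow> 'a) \<Rightarrow> complex) \<Rightarrow> ('d \<Rightarrow> 'a) \<Rightarrow> complex" where
  "down j f v = (\<Sum>x\<in>Chi (T j) (v j). f (v(j := x))) / nchi j (v j)"

definition up :: "'d \<Rightarrow> (('d \<Rightarrow> 'a) \<Rightarrow> complex) \<Rightarrow> ('d \<Rightarrow> 'a) \<Rightarrow> complex" where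
  "up j f v = (if v j \<in> pverts (T j) \<and> v j \<noteq> root_of (T j)
     then f (v(j := par (T j) (v j))) / nchi j (par (T j) (v j)) else 0)"

definition wander :: "'d \<Rightarrow> (('d \<Rightarrow> 'a) \<Rightarrow> complex) \<Rightarrow> ('d \<Rightarrow> 'a) \<Rightarrow> complex" where
  "wander j f = f - up j (down j f)"

text \<open>The n-th coefficient in the Wold decomposition of the isometry \<open>up j\<close>,
  moved back into the kernel of \<open>down j\<close>.\<close>

definition wander_down :: "'d \<Rightarrow> nat \<Rightarrow> (('d \<Rightarrow> 'a) \<Rightarrow> complex) \<Rightarrow> ('d \<Rightarrow> 'a) \<Rightarrow> complex" where
  "wander_down j n f = wander j ((down j ^^ n) f)"

definition coeffs_along ::
    "'d list \<Rightarrow> ('d \<Rightarrow> nat) \<Rightarrow> (('d \<Rightarrow> 'a) \<Rightarrow> complex) \<Rightarrow> ('d \<Rightarrow> 'a) \<Rightarrow> complex" where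
  "coeffs_along js \<alpha> f = foldr (\<lambda>j. wander_down j (\<alpha> j)) js f"

text \<open>An arbitrary enumeration, which turns the product over the directions into a fold
  amenable to list induction; operators of different directions commute.\<close>

definition directions :: "'d list" where
  "directions = (SOME js. set js = UNIV \<and> distinct js)"

definition coeff :: "('d \<Rightarrow> nat) \<Rightarrow> (('d \<Rightarrow> 'a) \<Rightarrow> complex) \<Rightarrow> ('d \<Rightarrow> 'a) \<Rightarrow> complex" where
  "coeff = coeffs_along directions"

lemma directions: "set directions = (UNIV :: 'd set)" "distinct (directions :: 'd list)"
  using someI_ex[OF finite_distinct_list[OF finite[of "UNIV :: 'd set"]]]
  unfolding directions_def by auto

section \<open>Relations between the isometries and their adjoints\<close>

lemma nchi_nonzero: "x \<in> pverts (T j) \<Longrightarrow> nchi j x \<noteq> 0"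
  and nchi_sq: "nchi j x * nchi j x = of_nat (card (Chi (T j) x))"
  using leafless_tree.card_Chi_pos[OF tree, of x j]
  by (auto simp: nchi_def simp flip: of_real_mult)

lemma cnj_nchi [simp]: "cnj (nchi j x) = nchi j x"
  by (simp add: nchi_def)

lemma upd_in_V: "v \<in> V \<Longrightarrow> x \<in> pverts (T j) \<Longrightarrow> v(j := x) \<in> V"
  by (auto simp: product_verts_iff)

lemma upd_off_V: "v \<notin> V \<Longrightarrow> v j \<in> pverts (T j) \<Longrightarrow> v(j := x) \<notin> V"
  by (auto simp: product_verts_iff split: if_splits)

lemma vanishes_off_down: "vanishes_off f \<Longrightarrow> vanishes_off (down j f)"
proof -
  assume f: "vanishes_off f"
  have "(\<Sum>x\<in>Chi (T j) (v j). f (v(j := x))) = 0" if "v \<notin> V" for v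
    using f upd_off_V[OF that, of j] leafless_tree.Chi_vert[OF tree, of _ j "v j"]
    by (intro sum.neutral) (auto simp: vanishes_off_def)
  then show ?thesis by (simp add: vanishes_off_def down_def)
qed

lemma vanishes_off_up: "vanishes_off f \<Longrightarrow> vanishes_off (up j f)"
  using upd_off_V by (auto simp: vanishes_off_def up_def)

lemma vanishes_off_diff: "vanishes_off f \<Longrightarrow> vanishes_off g \<Longrightarrow> vanishes_off (f - g)"
  by (simp add: vanishes_off_def)

lemma vanishes_off_wander: "vanishes_off f \<Longrightarrow> vanishes_off (wander j f)"
  unfolding wander_def by (intro vanishes_off_diff vanishes_off_up vanishes_off_down)

lemma vanishes_off_down_funpow: "vanishes_off f \<Longrightarrow> vanishes_off ((down j ^^ n) f)"
  by (induction n) (auto intro: vanishes_off_down)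

lemma vanishes_off_wander_down: "vanishes_off f \<Longrightarrow> vanishes_off (wander_down j n f)"
  unfolding wander_down_def by (intro vanishes_off_wander vanishes_off_down_funpow)

lemma coeffs_along_simps [simp]:
  "coeffs_along [] \<alpha> f = f"
  "coeffs_along (j # js) \<alpha> f = wander_down j (\<alpha> j) (coeffs_along js \<alpha> f)"
  "coeffs_along (is @ js) \<alpha> f = coeffs_along is \<alpha> (coeffs_along js \<alpha> f)"
  by (simp_all add: coeffs_along_def)

lemma vanishes_off_coeffs_along: "vanishes_off f \<Longrightarrow> vanishes_off (coeffs_along js \<alpha> f)"
  by (induction js) (auto intro: vanishes_off_wander_down)

lemma down_lin: "down j (\<lambda>v. a * f v + g v) = (\<lambda>v. a * down j f v + down j g v)"
  by (auto simp: down_def sum.distrib sum_distrib_left[symmetric] add_divide_distrib)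

lemma up_lin: "up j (\<lambda>v. a * f v + g v) = (\<lambda>v. a * up j f v + up j g v)"
  by (auto simp: up_def fun_eq_iff add_divide_distrib)

lemma wander_lin: "wander j (\<lambda>v. a * f v + g v) = (\<lambda>v. a * wander j f v + wander j g v)"
  unfolding wander_def down_lin up_lin by (auto simp: fun_eq_iff algebra_simps)

lemma wander_down_lin:
  "wander_down j n (\<lambda>v. a * f v + g v) = (\<lambda>v. a * wander_down j n f v + wander_down j n g v)"
proof -
  have "(down j ^^ n) (\<lambda>v. a * f v + g v) = (\<lambda>v. a * (down j ^^ n) f v + (down j ^^ n) g v)"
    by (induction n) (simp_all add: down_lin)
  then show ?thesis by (simp add: wander_down_def wander_lin)
qed

lemma coeffs_along_lin:
  "coeffs_along js \<alpha> (\<lambda>v. a * f v + g v) = (\<lambda>v. a * coeffs_along js \<alpha> f v + coeffs_along js \<alpha> g v)"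
  by (induction js) (simp_all add: wander_down_lin)

lemma down_0: "down j (\<lambda>v. 0) = (\<lambda>v. 0)"
  and up_0: "up j (\<lambda>v. 0) = (\<lambda>v. 0)"
  and wander_0: "wander j (\<lambda>v. 0) = (\<lambda>v. 0)"
  by (auto simp: down_def up_def wander_def fun_eq_iff)

lemma down_funpow_0: "(down j ^^ n) (\<lambda>v. 0) = (\<lambda>v. 0)"
  by (induction n) (simp_all add: down_0)

lemma coeffs_along_0: "coeffs_along js \<alpha> (\<lambda>v. 0) = (\<lambda>v. 0)"
  by (induction js) (simp_all add: wander_down_def down_funpow_0 wander_0)

lemma down_down_commute: "i \<noteq> j \<Longrightarrow> down i (down j f) = down j (down i f)"
proof
  fix v assume "i \<noteq> j"
  then have "down i (down j f) v = (\<Sum>x\<in>Chi (T i) (v i). \<Sum>y\<in>Chi (T j) (v j).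
      f (v(j := y, i := x))) / (nchi i (v i) * nchi j (v j))"
    by (simp add: down_def sum_divide_distrib[symmetric] fun_upd_twist)
  also have "\<dots> = down j (down i f) v"
    using \<open>i \<noteq> j\<close> by (subst sum.swap) (simp add: down_def sum_divide_distrib[symmetric] mult.commute)
  finally show "down i (down j f) v = down j (down i f) v" .
qed

lemma down_up_commute: "i \<noteq> j \<Longrightarrow> down i (up j f) = up j (down i f)"
  by (auto simp: down_def up_def fun_eq_iff fun_upd_twist sum_divide_distrib[symmetric] mult.commute)

lemma up_up_commute: "i \<noteq> j \<Longrightarrow> up i (up j f) = up j (up i f)"
  by (auto simp: up_def fun_eq_iff fun_upd_twist mult.commute)

lemma down_minus: "down j (f - g) = down j f - down j g"
  using down_lin[of j "-1" g f] by (simp add: fun_eq_iff fun_diff_def)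

lemma up_minus: "up j (f - g) = up j f - up j g"
  using up_lin[of j "-1" g f] by (simp add: fun_eq_iff fun_diff_def)

lemma wander_down_commute: "i \<noteq> j \<Longrightarrow> down i (wander j f) = wander j (down i f)"
  by (simp add: wander_def down_minus down_up_commute down_down_commute)

lemma wander_up_commute: "i \<noteq> j \<Longrightarrow> up i (wander j f) = wander j (up i f)"
  by (simp add: wander_def up_minus down_up_commute up_up_commute)

text \<open>Here \<open>X\<close> will be \<open>up k\<close> or \<open>down k\<close> in a
  direction \<open>k\<close> outside \<open>js\<close>.\<close>

lemma coeffs_along_commute:
  assumes "\<And>j f. j \<in> set js \<Longrightarrow> X (down j f) = down j (X f)"
    and "\<And>j f. j \<in> set js \<Longrightarrow> X (wander j f) = wander j (X f)"
  shows "X (coeffs_along js \<alpha> f) = coeffs_along js \<alpha> (X f)"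
  using assms
proof (induction js)
  case (Cons j js)
  have "X ((down j ^^ n) h) = (down j ^^ n) (X h)" for n h
    by (induction n) (simp_all add: Cons.prems)
  then show ?case using Cons by (simp add: wander_down_def)
qed simp

lemma coeffs_along_down: "k \<notin> set js \<Longrightarrow> down k (coeffs_along js \<alpha> f) = coeffs_along js \<alpha> (down k f)"
  by (rule coeffs_along_commute) (auto intro: down_down_commute wander_down_commute)

lemma coeffs_along_up: "k \<notin> set js \<Longrightarrow> up k (coeffs_along js \<alpha> f) = coeffs_along js \<alpha> (up k f)"
  by (rule coeffs_along_commute) (auto intro: down_up_commute[symmetric] wander_up_commute)

text \<open>There is one equal term for each child, and it is divided twice by the square root of
  the number of children.\<close>

lemma down_up: "vanishes_off f \<Longrightarrow> down j (up j f) = f"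
proof
  fix v assume f: "vanishes_off f"
  show "down j (up j f) v = f v"
  proof (cases "v j \<in> pverts (T j)")
    case True
    have "up j f (v(j := x)) = f v / nchi j (v j)" if "x \<in> Chi (T j) (v j)" for x
      using leafless_tree.Chi_vert[OF tree that] leafless_tree.par_Chi[OF tree that]
      by (simp add: up_def)
    then have "down j (up j f) v = of_nat (card (Chi (T j) (v j))) * f v / (nchi j (v j) * nchi j (v j))"
      by (simp add: down_def)
    also have "\<dots> = f v" using leafless_tree.card_Chi_pos[OF tree True] by (simp add: nchi_sq)
    finally show ?thesis .
  next
    case False
    then have "v \<notin> V" by (auto simp: product_verts_iff)
    then show ?thesis using f vanishes_off_down[OF vanishes_off_up[OF f]] by (simp add: vanishes_off_def)
  qed
qed

lemma wander_up: "vanishes_off f \<Longrightarrow> wander j (up j f) = (\<lambda>v. 0)"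
  by (simp add: wander_def down_up fun_eq_iff)

lemma down_wander: "vanishes_off f \<Longrightarrow> down j (wander j f) = (\<lambda>v. 0)"
  by (simp add: wander_def down_minus down_up vanishes_off_down fun_eq_iff)

lemma wander_down_up:
  "vanishes_off f \<Longrightarrow> wander_down j n (up j f) = (if n = 0 then \<lambda>v. 0 else wander_down j (n - 1) f)"
  by (cases n) (simp_all add: wander_down_def wander_up funpow_swap1 down_up)

lemma wander_down_Suc: "wander_down j n (down j f) = wander_down j (Suc n) f"
  by (simp add: wander_down_def funpow_swap1)

lemma coeffs_along_cong: "(\<And>j. j \<in> set js \<Longrightarrow> \<alpha> j = \<beta> j) \<Longrightarrow> coeffs_along js \<alpha> f = coeffs_along js \<beta> f"
  by (induction js) auto

lemma split_directions:
  fixes k :: 'd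
  obtains "is" js where "directions = is @ k # js" "k \<notin> set is" "k \<notin> set js"
proof -
  obtain "is" js where d: "directions = is @ k # js"
    using directions(1) split_list[of k directions] by auto
  have "distinct (is @ k # js)" using directions(2) unfolding d .
  then have "k \<notin> set is" "k \<notin> set js" by auto
  with d show ?thesis by (rule that)
qed

text \<open>On the family of coefficients \<open>up k\<close> acts as the forward shift in the k-th
  index and \<open>down k\<close>, in \<open>coeff_down\<close>, as the backward shift, because only
  the factor of direction \<open>k\<close> in the fold fails to commute with them.\<close>

lemma coeff_up:
  assumes "vanishes_off f"
  shows "coeff \<alpha> (up k f) = (if \<alpha> k = 0 then \<lambda>v. 0 else coeff (\<alpha>(k := \<alpha> k - 1)) f)"
proof -
  obtain "is" js where d: "directions = is @ k # js" "k \<notin> set is" "k \<notin> set js"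
    by (rule split_directions)
  have "coeff \<alpha> (up k f) =
      coeffs_along is \<alpha> (wander_down k (\<alpha> k) (up k (coeffs_along js \<alpha> f)))"
    by (simp add: coeff_def d coeffs_along_up)
  moreover have "coeffs_along is \<alpha> h = coeffs_along is (\<alpha>(k := \<alpha> k - 1)) h"
    "coeffs_along js \<alpha> h = coeffs_along js (\<alpha>(k := \<alpha> k - 1)) h" for h
    using d by (auto intro: coeffs_along_cong)
  ultimately show ?thesis
    using vanishes_off_coeffs_along[OF assms]
    by (simp add: wander_down_up coeffs_along_0 coeff_def d)
qed

lemma coeff_down: "coeff \<alpha> (down k f) = coeff (\<alpha>(k := Suc (\<alpha> k))) f"
proof -
  obtain "is" js where d: "directions = is @ k # js" "k \<notin> set is" "k \<notin> set js"
    by (rule split_directions)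
  have "coeff \<alpha> (down k f) =
      coeffs_along is \<alpha> (wander_down k (\<alpha> k) (down k (coeffs_along js \<alpha> f)))"
    by (simp add: coeff_def d coeffs_along_down)
  moreover have "coeffs_along is \<alpha> h = coeffs_along is (\<alpha>(k := Suc (\<alpha> k))) h"
    "coeffs_along js \<alpha> h = coeffs_along js (\<alpha>(k := Suc (\<alpha> k))) h" for h
    using d by (auto intro: coeffs_along_cong)
  ultimately show ?thesis by (simp add: wander_down_Suc coeff_def d)
qed

text \<open>After passing the other directions \<open>down k\<close> meets \<open>wander k\<close>,
  whose range it annihilates.\<close>

lemma down_coeff:
  assumes "vanishes_off f"
  shows "down k (coeff \<alpha> f) = (\<lambda>v. 0)"
proof -
  obtain "is" js where d: "directions = is @ k # js" "k \<notin> set is" "k \<notin> set js"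
    by (rule split_directions)
  have "down k (wander_down k (\<alpha> k) (coeffs_along js \<alpha> f)) = (\<lambda>v. 0)"
    unfolding wander_down_def
    by (intro down_wander vanishes_off_down_funpow vanishes_off_coeffs_along assms)
  then show ?thesis by (simp add: coeff_def d coeffs_along_down coeffs_along_0)
qed

text \<open>If all \<open>wander_down j n f\<close> vanish, then \<open>f = up j (down j f)\<close>, and the same holds for all
  iterates \<open>down j ^^ n\<close>, so \<open>f\<close> vanishes at every finite depth.\<close>

lemma wander_down_injective:
  assumes "vanishes_off f" "\<And>n. wander_down j n f = (\<lambda>v. 0)"
  shows "f = (\<lambda>v. 0)"
proof -
  have "f v = 0" if "v \<in> V" "depth (T j) (v j) = m" for v m
    using assms that
  proof (induction m arbitrary: f v)
    case 0
    then have "v j = root_of (T j)"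
      using leafless_tree.depth_eq_0[OF tree] by (auto simp: product_verts_iff)
    then show ?case using fun_cong[OF "0.prems"(2)[of 0], of v]
      by (simp add: wander_down_def wander_def up_def)
  next
    case (Suc m)
    have vj: "v j \<in> pverts (T j)" "v j \<noteq> root_of (T j)"
      using Suc.prems leafless_tree.depth_root[OF tree, of j] by (auto simp: product_verts_iff)
    let ?v = "v(j := par (T j) (v j))"
    have "down j f ?v = 0"
    proof (rule Suc.IH)
      show "vanishes_off (down j f)" using Suc.prems by (intro vanishes_off_down)
      show "wander_down j n (down j f) = (\<lambda>v. 0)" for n
        using Suc.prems by (simp add: wander_down_Suc)
      show "?v \<in> V" using Suc.prems leafless_tree.par_vert[OF tree vj] by (intro upd_in_V)
      show "depth (T j) (?v j) = m"
        using Suc.prems leafless_tree.depth_par[OF tree vj] by simp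
    qed
    moreover have "f v - up j (down j f) v = 0"
      using fun_cong[OF Suc.prems(2)[of 0], of v] by (simp add: wander_down_def wander_def)
    ultimately show ?case by (simp add: up_def)
  qed
  then show ?thesis using assms(1) unfolding vanishes_off_def by blast
qed

lemma coeffs_along_injective:
  assumes "distinct js" "vanishes_off f" "\<And>\<alpha>. coeffs_along js \<alpha> f = (\<lambda>v. 0)"
  shows "f = (\<lambda>v. 0)"
  using assms
proof (induction js)
  case Nil
  then show ?case by simp
next
  case (Cons j js)
  have "coeffs_along js \<alpha> f = (\<lambda>v. 0)" for \<alpha>
  proof (rule wander_down_injective)
    show "vanishes_off (coeffs_along js \<alpha> f)" using Cons by (intro vanishes_off_coeffs_along)
    show "wander_down j n (coeffs_along js \<alpha> f) = (\<lambda>v. 0)" for n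
    proof -
      \<comment> \<open>As \<open>j\<close> is not in \<open>js\<close>, changing its exponent
        leaves the inner coefficients alone, so every \<open>n\<close> is available for the outer
        factor.\<close>
      have "coeffs_along js \<alpha> f = coeffs_along js (\<alpha>(j := n)) f"
        using Cons.prems by (intro coeffs_along_cong) auto
      then show ?thesis using Cons.prems(3)[of "\<alpha>(j := n)"]
        by (simp only: coeffs_along_simps fun_upd_same)
    qed
  qed
  then show ?case using Cons by simp
qed

lemma coeff_injective: "vanishes_off f \<Longrightarrow> (\<And>\<alpha>. coeff \<alpha> f = (\<lambda>v. 0)) \<Longrightarrow> f = (\<lambda>v. 0)"
  unfolding coeff_def by (rule coeffs_along_injective[OF directions(2)])

end

section \<open>The wandering subspace and elements dual to the coefficients\<close>

context tree_product
begin

text \<open>The joint kernel described through the adjoint isometries alone, without the weights;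
  \<open>E_carrier\<close> identifies it with \<open>E\<close>.\<close>

definition wandering :: "(('d \<Rightarrow> 'a) \<Rightarrow> complex) \<Rightarrow> bool" where
  "wandering g \<longleftrightarrow> vanishes_off g \<and> (\<forall>k. down k g = (\<lambda>v. 0))"

definition finitely_supported :: "(('d \<Rightarrow> 'a) \<Rightarrow> complex) \<Rightarrow> bool" where
  "finitely_supported g \<longleftrightarrow> vanishes_off g \<and> finite {v. g v \<noteq> 0}"

lemma wandering_coeff: "vanishes_off f \<Longrightarrow> wandering (coeff \<alpha> f)"
  using down_coeff vanishes_off_coeffs_along by (simp add: wandering_def coeff_def)

lemma wander_wandering: "wandering g \<Longrightarrow> wander j g = g"
  by (simp add: wandering_def wander_def up_0) (simp add: fun_eq_iff)

text \<open>A non-zero index contains some \<open>down k\<close>, which kills \<open>g\<close>; for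
  the zero index only the projections remain, and they fix \<open>g\<close>.\<close>

lemma coeff_wandering:
  assumes "wandering g"
  shows "coeff \<alpha> g = (if \<alpha> = (\<lambda>_. 0) then g else (\<lambda>v. 0))"
proof (cases "\<alpha> = (\<lambda>_. 0)")
  case True
  have "coeffs_along js (\<lambda>_. 0) g = g" for js
    using assms by (induction js) (simp_all add: wander_down_def wander_wandering)
  then show ?thesis using True by (simp add: coeff_def)
next
  case False
  then obtain k where k: "\<alpha> k \<noteq> 0" by auto
  then have "coeff \<alpha> g = coeff (\<alpha>(k := \<alpha> k - 1)) (down k g)"
    by (simp add: coeff_down)
  then show ?thesis using assms False by (simp add: wandering_def coeff_def coeffs_along_0)
qed

lemma finitely_supported_pairing:
  assumes "finitely_supported g"
  shows "hinner (ell2 V) f g = (\<Sum>v\<in>{v. g v \<noteq> 0}. f v * cnj (g v))"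
    "hinner (ell2 V) g f = (\<Sum>v\<in>{v. g v \<noteq> 0}. g v * cnj (f v))"
  by (rule ell2_finite_support[where B = "{v. g v \<noteq> 0}"],
      use assms in \<open>auto simp: finitely_supported_def vanishes_off_def\<close>)+

lemma finitely_supported_up:
  assumes "finitely_supported g"
  shows "finitely_supported (up j g)"
proof -
  have "{w. up j g w \<noteq> 0} \<subseteq> (\<lambda>(v, x). v(j := x)) ` (SIGMA v:{v. g v \<noteq> 0}. Chi (T j) (v j))"
  proof
    fix w assume "w \<in> {w. up j g w \<noteq> 0}"
    then have w: "w j \<in> pverts (T j)" "w j \<noteq> root_of (T j)" "g (w(j := par (T j) (w j))) \<noteq> 0"
      by (auto simp: up_def split: if_splits)
    then show "w \<in> (\<lambda>(v, x). v(j := x)) ` (SIGMA v:{v. g v \<noteq> 0}. Chi (T j) (v j))"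
      using leafless_tree.Chi_par[OF tree w(1,2)]
      by (intro image_eqI[of _ _ "(w(j := par (T j) (w j)), w j)"]) auto
  qed
  moreover have "finite (SIGMA v:{v. g v \<noteq> 0}. Chi (T j) (v j))"
    using assms leafless_tree.finite_Chi[OF tree] by (simp add: finitely_supported_def)
  ultimately show ?thesis
    using assms by (auto simp: finitely_supported_def intro: vanishes_off_up finite_subset)
qed

text \<open>Both sides are sums over pairs of a vertex in the support of \<open>g\<close> and one of
  its children in direction \<open>j\<close>. As that support is finite, \<open>f\<close> may be
  arbitrary.\<close>

lemma down_up_adjoint:
  assumes g: "finitely_supported g"
  shows "hinner (ell2 V) (down j f) g = hinner (ell2 V) f (up j g)"
proof -
  let ?B = "{v. g v \<noteq> 0}" and ?h = "\<lambda>(v, x). v(j := x)"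
  let ?S = "SIGMA v:?B. Chi (T j) (v j)"
  have fin: "finite ?B" using g by (simp add: finitely_supported_def)
  have up: "up j g (v(j := x)) = g v / nchi j (v j)" if "x \<in> Chi (T j) (v j)" for v x
    using leafless_tree.Chi_vert[OF tree that] leafless_tree.par_Chi[OF tree that]
    by (simp add: up_def)
  have inj: "inj_on ?h ?S"
  proof (rule inj_onI, clarsimp)
    fix v x v' x' assume e: "v(j := x) = v'(j := x')" and x: "x \<in> Chi (T j) (v j)" "x' \<in> Chi (T j) (v' j)"
    then have "x = x'" by (metis fun_upd_same)
    then have "v j = v' j" using x leafless_tree.par_Chi[OF tree] by metis
    then show "v = v' \<and> x = x'" using e \<open>x = x'\<close> by (metis fun_upd_triv fun_upd_upd)
  qed
  have nz: "nchi j (v j) \<noteq> 0" if "x \<in> Chi (T j) (v j)" for v x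
    using nchi_nonzero leafless_tree.Chi_vert[OF tree that] by blast
  have "{w. up j g w \<noteq> 0} = ?h ` ?S"
  proof
    show "?h ` ?S \<subseteq> {w. up j g w \<noteq> 0}" using up nz by auto
    show "{w. up j g w \<noteq> 0} \<subseteq> ?h ` ?S"
    proof
      fix w assume "w \<in> {w. up j g w \<noteq> 0}"
      then have w: "w j \<in> pverts (T j)" "w j \<noteq> root_of (T j)" "g (w(j := par (T j) (w j))) \<noteq> 0"
        by (auto simp: up_def split: if_splits)
      then show "w \<in> ?h ` ?S"
        using leafless_tree.Chi_par[OF tree w(1,2)]
        by (intro image_eqI[of _ _ "(w(j := par (T j) (w j)), w j)"]) auto
    qed
  qed
  then have "hinner (ell2 V) f (up j g) = (\<Sum>w\<in>?h ` ?S. f w * cnj (up j g w))"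
    using finitely_supported_pairing[OF finitely_supported_up[OF g]] by simp
  also have "\<dots> = (\<Sum>(v, x)\<in>?S. f (v(j := x)) * cnj (g v / nchi j (v j)))"
    using up by (subst sum.reindex[OF inj]) (auto intro!: sum.cong)
  also have "\<dots> = (\<Sum>v\<in>?B. \<Sum>x\<in>Chi (T j) (v j). f (v(j := x)) * cnj (g v / nchi j (v j)))"
    using fin leafless_tree.finite_Chi[OF tree] by (subst sum.Sigma) auto
  also have "\<dots> = (\<Sum>v\<in>?B. down j f v * cnj (g v))"
    by (simp add: down_def sum_distrib_right sum_divide_distrib)
  finally show ?thesis using finitely_supported_pairing[OF g] by simp
qed

lemma up_perp_wandering:
  assumes g: "finitely_supported g" "wandering g"
  shows "hinner (ell2 V) (up j h) g = 0"
proof -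
  let ?B = "{v. g v \<noteq> 0}"
  have fin: "finite ?B" using g by (simp add: finitely_supported_def)
  have BV: "?B \<subseteq> V" using g by (auto simp: finitely_supported_def vanishes_off_def)
  \<comment> \<open>Only the values of \<open>h\<close> at j-parents of the support of
    \<open>g\<close> matter. Cutting \<open>h\<close> down to these makes it the finitely supported
    side of the adjoint relation.\<close>
  define C where "C = V \<inter> (\<lambda>w. w(j := par (T j) (w j))) ` ?B"
  define h' where "h' v = (if v \<in> C then h v else 0)" for v
  have h': "finitely_supported h'"
    using fin by (auto simp: finitely_supported_def vanishes_off_def h'_def C_def intro: finite_subset)
  have "up j h w = up j h' w" if "w \<in> ?B" for w
  proof (cases "w j \<in> pverts (T j) \<and> w j \<noteq> root_of (T j)")
    case True
    then have "w(j := par (T j) (w j)) \<in> C"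
      using that BV leafless_tree.par_vert[OF tree] upd_in_V[of w] by (auto simp: C_def)
    then show ?thesis by (simp add: up_def h'_def)
  qed (auto simp: up_def)
  then have "hinner (ell2 V) (up j h) g = hinner (ell2 V) (up j h') g"
    unfolding finitely_supported_pairing[OF g(1)] by (intro sum.cong) auto
  also have "\<dots> = cnj (hinner (ell2 V) g (up j h'))"
    unfolding finitely_supported_pairing[OF g(1)] by (simp add: mult.commute)
  also have "\<dots> = cnj (hinner (ell2 V) (down j g) h')" by (simp add: down_up_adjoint[OF h'])
  also have "\<dots> = 0" using g(2) by (simp add: wandering_def ell2_simps)
  finally show ?thesis .
qed

text \<open>The zeroth coefficient is a composite of the projections \<open>wander j\<close>, each
  of which differs from the identity by an element of the range of \<open>up j\<close>, and that
  range is orthogonal to \<open>g\<close>.\<close>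

lemma coeff_0_pairing:
  assumes g: "finitely_supported g" "wandering g"
  shows "hinner (ell2 V) (coeff (\<lambda>_. 0) f) g = hinner (ell2 V) f g"
proof -
  have "hinner (ell2 V) (wander j h) g = hinner (ell2 V) h g - hinner (ell2 V) (up j (down j h)) g" for j h
    unfolding finitely_supported_pairing[OF g(1)] wander_def
    by (simp add: algebra_simps sum_subtractf)
  then have w: "hinner (ell2 V) (wander j h) g = hinner (ell2 V) h g" for j h
    using up_perp_wandering[OF g] by simp
  have "hinner (ell2 V) (coeffs_along js (\<lambda>_. 0) f) g = hinner (ell2 V) f g" for js
    by (induction js) (simp_all add: wander_down_def w)
  then show ?thesis by (simp add: coeff_def)
qed

text \<open>The element is J^\<beta> g in the notation of the overview, built one
  \<open>up k\<close> at a time. It isolates the index \<beta> in two ways: its own coefficients are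
  concentrated there, and pairing with it extracts that coefficient from any function.\<close>

lemma coeff_dual:
  assumes g: "finitely_supported g" "wandering g"
  shows "\<exists>b. finitely_supported b \<and> (\<forall>\<alpha>. coeff \<alpha> b = (if \<alpha> = \<beta> then g else (\<lambda>v. 0))) \<and>
    (\<forall>f. hinner (ell2 V) f b = hinner (ell2 V) (coeff \<beta> f) g)"
proof (induction "msize \<beta>" arbitrary: \<beta>)
  case 0
  then have "\<beta> = (\<lambda>_. 0)" by (auto simp: msize_def)
  then show ?case using g coeff_wandering coeff_0_pairing by (intro exI[of _ g]) auto
next
  case (Suc n)
  have "\<not> (\<forall>k. \<beta> k = 0)"
  proof
    assume "\<forall>k. \<beta> k = 0"
    then have "msize \<beta> = 0" by (simp add: msize_def)
    then show False using Suc.hyps(2) by simp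
  qed
  then obtain k where k: "\<beta> k \<noteq> 0" by blast
  let ?\<gamma> = "\<beta>(k := \<beta> k - 1)"
  have "msize \<beta> = Suc (msize ?\<gamma>)"
    using k by (simp add: msize_def sum.remove[OF finite UNIV_I, of _ k])
  then obtain b where b: "finitely_supported b" "\<And>\<alpha>. coeff \<alpha> b = (if \<alpha> = ?\<gamma> then g else (\<lambda>v. 0))"
    "\<And>f. hinner (ell2 V) f b = hinner (ell2 V) (coeff ?\<gamma> f) g"
    using Suc.hyps(1)[of ?\<gamma>] Suc.hyps(2) by auto
  have "coeff \<alpha> (up k b) = (if \<alpha> = \<beta> then g else (\<lambda>v. 0))" for \<alpha>
  proof -
    have "\<alpha> i = \<beta> i" if "\<alpha> k \<noteq> 0" "\<alpha>(k := \<alpha> k - 1) = ?\<gamma>" for i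
      using fun_cong[OF that(2), of i] that(1) k by (cases "i = k") auto
    then have "\<alpha> k \<noteq> 0 \<and> \<alpha>(k := \<alpha> k - 1) = ?\<gamma> \<longleftrightarrow> \<alpha> = \<beta>"
      using k by blast
    moreover have "vanishes_off b" using b(1) by (simp add: finitely_supported_def)
    ultimately show ?thesis unfolding coeff_up[OF \<open>vanishes_off b\<close>] b(2) by (cases "\<alpha> k = 0") simp_all
  qed
  moreover have "hinner (ell2 V) f (up k b) = hinner (ell2 V) (coeff \<beta> f) g" for f
    using k b(3)[of "down k f"] by (simp add: down_up_adjoint[OF b(1), symmetric] coeff_down)
  ultimately show ?case using finitely_supported_up[OF b(1)] by blast
qed

section \<open>Multipliers depending on the depth only\<close>

lemma mdepth_child:
  "x \<in> Chi (T k) (v k) \<Longrightarrow> mdepth T (v(k := x)) = (mdepth T v)(k := Suc (mdepth T v k))"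
  using leafless_tree.depth_Chi[OF tree] by (auto simp: mdepth_def fun_eq_iff)

lemma down_multiplier:
  "down k (\<lambda>v. \<psi> (mdepth T v) * f v) = (\<lambda>v. \<psi> ((mdepth T v)(k := Suc (mdepth T v k))) * down k f v)"
  by (auto simp: down_def mdepth_child sum_distrib_left intro!: sum.cong)

lemma up_multiplier:
  "up k (\<lambda>v. \<psi> ((mdepth T v)(k := Suc (mdepth T v k))) * f v) = (\<lambda>v. \<psi> (mdepth T v) * up k f v)"
proof
  fix w
  have "(mdepth T (w(k := par (T k) (w k))))(k := Suc (mdepth T (w(k := par (T k) (w k))) k)) = mdepth T w"
    if "w k \<in> pverts (T k)" "w k \<noteq> root_of (T k)"
    using mdepth_child[of "w k" k "w(k := par (T k) (w k))"] leafless_tree.Chi_par[OF tree that]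
    by simp
  then show "up k (\<lambda>v. \<psi> ((mdepth T v)(k := Suc (mdepth T v k))) * f v) w = \<psi> (mdepth T w) * up k f w"
    by (simp add: up_def)
qed

text \<open>\<open>down\<close> moves the argument of the multiplier one level deeper and
  \<open>up\<close> moves it back, so the projection commutes with multipliers.\<close>

lemma wander_multiplier:
  "wander k (\<lambda>v. \<psi> (mdepth T v) * f v) = (\<lambda>v. \<psi> (mdepth T v) * wander k f v)"
  unfolding wander_def down_multiplier up_multiplier by (auto simp: fun_eq_iff algebra_simps)

text \<open>Each application of \<open>down k\<close> shifts the argument by one in the k-th entry,
  while the projections leave it alone. This puts the weight at depth \<delta> + \<alpha> into the
  coefficients of \<open>S j f\<close>.\<close>

lemma coeff_multiplier:
  "coeff \<alpha> (\<lambda>v. \<psi> (mdepth T v) * f v) = (\<lambda>v. \<psi> (\<lambda>j. mdepth T v j + \<alpha> j) * coeff \<alpha> f v)"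
proof -
  have fp: "(down k ^^ n) (\<lambda>v. \<psi> (mdepth T v) * f v) =
      (\<lambda>v. \<psi> ((mdepth T v)(k := mdepth T v k + n)) * (down k ^^ n) f v)" for k n \<psi> f
  proof (induction n)
    case (Suc n)
    have "down k (\<lambda>v. \<psi> ((mdepth T v)(k := mdepth T v k + n)) * h v) =
        (\<lambda>v. \<psi> ((mdepth T v)(k := mdepth T v k + Suc n)) * down k h v)" for h
      using down_multiplier[of k "\<lambda>\<delta>. \<psi> (\<delta>(k := \<delta> k + n))" h] by simp
    then show ?case by (simp only: funpow.simps o_apply Suc.IH)
  qed simp
  have "coeffs_along js \<alpha> (\<lambda>v. \<psi> (mdepth T v) * f v) =
      (\<lambda>v. \<psi> (\<lambda>j. mdepth T v j + (if j \<in> set js then \<alpha> j else 0)) * coeffs_along js \<alpha> f v)"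
    if "distinct js" for js
    using that
  proof (induction js)
    case (Cons k js)
    let ?\<psi> = "\<lambda>\<delta>. \<psi> (\<lambda>j. \<delta> j + (if j \<in> set js then \<alpha> j else 0))"
    have "coeffs_along (k # js) \<alpha> (\<lambda>v. \<psi> (mdepth T v) * f v) =
        (\<lambda>v. ?\<psi> ((mdepth T v)(k := mdepth T v k + \<alpha> k)) * coeffs_along (k # js) \<alpha> f v)"
      using Cons fp[where k = k and n = "\<alpha> k" and \<psi> = ?\<psi>] wander_multiplier[of k "\<lambda>\<delta>. ?\<psi> (\<delta>(k := \<delta> k + \<alpha> k))"]
      by (simp add: wander_down_def)
    moreover have "(\<lambda>j. ((mdepth T v)(k := mdepth T v k + \<alpha> k)) j + (if j \<in> set js then \<alpha> j else 0)) =
        (\<lambda>j. mdepth T v j + (if j \<in> set (k # js) then \<alpha> j else 0))" for v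
      using Cons.prems by (auto simp: fun_eq_iff)
    ultimately show ?case by (simp only:)
  qed simp
  then show ?thesis using directions by (simp add: coeff_def)
qed

section \<open>Consequences of the finite joint branching index\<close>

definition depth_bound :: nat where
  "depth_bound = (SOME K. \<forall>j. \<forall>u\<in>branching_vertices (T j). depth (T j) u \<le> K)"

text \<open>The extra level accounts for the children of branching vertices at depth
  \<open>depth_bound\<close>.\<close>

definition core :: "('d \<Rightarrow> 'a) set" where
  "core = {v\<in>V. \<forall>j. depth (T j) (v j) \<le> Suc depth_bound}"

lemma branching_depth: "u \<in> branching_vertices (T j) \<Longrightarrow> depth (T j) u \<le> depth_bound"
proof -
  have "\<exists>K. \<forall>u\<in>branching_vertices (T j). depth (T j) u \<le> K" for j
    using finite_index by (auto simp: finite_joint_branching_index_def bdd_above_def)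
  then obtain K where K: "\<And>j u. u \<in> branching_vertices (T j) \<Longrightarrow> depth (T j) u \<le> K j" by metis
  have "depth (T j) u \<le> (\<Sum>i\<in>UNIV. K i)" if "u \<in> branching_vertices (T j)" for j u
    by (rule order_trans[OF K[OF that]]) (simp add: member_le_sum)
  then have "\<exists>K. \<forall>j. \<forall>u\<in>branching_vertices (T j). depth (T j) u \<le> K" by blast
  from someI_ex[OF this] show "u \<in> branching_vertices (T j) \<Longrightarrow> depth (T j) u \<le> depth_bound"
    unfolding depth_bound_def by blast
qed

lemma finite_core: "finite core"
proof -
  have "core \<subseteq> (\<Pi>\<^sub>E j\<in>UNIV. {x \<in> pverts (T j). depth (T j) x \<le> Suc depth_bound})"
    by (auto simp: core_def product_verts_iff)
  moreover have "finite \<dots>"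
    using leafless_tree.finite_levels[OF tree] by (intro finite_PiE) auto
  ultimately show ?thesis by (rule finite_subset)
qed

lemma core_V: "core \<subseteq> V" by (auto simp: core_def)

text \<open>At a vertex outside \<open>core\<close> some coordinate \<open>v j\<close> is an only
  child, so the condition on \<open>down j g\<close> at its parent consists of a single term, a
  non-zero multiple of \<open>g v\<close>.\<close>

lemma wandering_off_core:
  assumes "wandering g" "v \<notin> core"
  shows "g v = 0"
proof (cases "v \<in> V")
  case True
  then obtain j where j: "depth (T j) (v j) > Suc depth_bound"
    using assms by (auto simp: core_def not_le)
  have vj: "v j \<in> pverts (T j)" "v j \<noteq> root_of (T j)"
    using True j leafless_tree.depth_root[OF tree, of j] by (auto simp: product_verts_iff)
  let ?p = "par (T j) (v j)"
  have "?p \<notin> branching_vertices (T j)"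
    using branching_depth[of ?p j] j leafless_tree.depth_par[OF tree vj] by auto
  then have "Chi (T j) ?p = {v j}"
    using leafless_tree.Chi_nonbranching[OF tree leafless_tree.Chi_par[OF tree vj]] by simp
  then have "down j g (v(j := ?p)) = g v / nchi j ?p" by (simp add: down_def)
  then show ?thesis
    using assms nchi_nonzero[OF leafless_tree.par_vert[OF tree vj]] by (auto simp: wandering_def)
next
  case False
  then show ?thesis using assms by (simp add: wandering_def vanishes_off_def)
qed

lemma wandering_finitely_supported: "wandering g \<Longrightarrow> finitely_supported g"
proof -
  assume g: "wandering g"
  then have "{v. g v \<noteq> 0} \<subseteq> core" using wandering_off_core by blast
  then show ?thesis
    using g finite_subset[OF _ finite_core] by (simp add: finitely_supported_def wandering_def)
qed

lemma card_Chi_bounded: "\<exists>M\<ge>1. \<forall>j x. sqrt (real (card (Chi (T j) x))) \<le> M"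
proof -
  \<comment> \<open>The 1 covers the non-branching vertices and keeps the set non-empty.\<close>
  let ?A = "insert 1 (\<Union>j. (\<lambda>x. card (Chi (T j) x)) ` {x\<in>pverts (T j). depth (T j) x \<le> depth_bound})"
  have fin: "finite ?A" using leafless_tree.finite_levels[OF tree] by auto
  have "card (Chi (T j) x) \<le> Max ?A" for j x
  proof (cases "x \<in> branching_vertices (T j)")
    case True
    then have "card (Chi (T j) x) \<in> ?A" using branching_depth by (auto simp: branching_vertices_def)
    then show ?thesis using fin by (rule Max_ge[rotated])
  next
    case False
    then have "card (Chi (T j) x) \<le> 1"
    proof (cases "Chi (T j) x = {}")
      case False
      then obtain y where "y \<in> Chi (T j) x" by blast
      then have "Chi (T j) x = {y}"
        using leafless_tree.Chi_nonbranching[OF tree _ \<open>x \<notin> _\<close>] by blast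
      then show ?thesis by simp
    qed simp
    also have "1 \<le> Max ?A" using fin by (intro Max_ge) auto
    finally show ?thesis .
  qed
  moreover have "1 \<le> Max ?A" using fin by (intro Max_ge) auto
  ultimately show ?thesis by (intro exI[of _ "sqrt (real (Max ?A))"]) auto
qed

definition branch_bound :: real where
  "branch_bound = (SOME M. 1 \<le> M \<and> (\<forall>j x. sqrt (real (card (Chi (T j) x))) \<le> M))"

lemma branch_bound: "1 \<le> branch_bound" "sqrt (real (card (Chi (T j) x))) \<le> branch_bound"
  using someI_ex[OF card_Chi_bounded] unfolding branch_bound_def by auto

lemma down_bound:
  assumes "\<And>v. cmod (f v) \<le> a"
  shows "cmod (down j f v) \<le> branch_bound * a"
proof -
  let ?n = "real (card (Chi (T j) (v j)))"
  have a: "0 \<le> a" using assms[of v] norm_ge_zero order_trans by blast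
  have "cmod (\<Sum>x\<in>Chi (T j) (v j). f (v(j := x))) \<le> ?n * a"
    using sum_norm_bound[of "Chi (T j) (v j)" "\<lambda>x. f (v(j := x))" a] assms by simp
  then have "cmod (down j f v) \<le> ?n * a / sqrt ?n"
    by (simp add: down_def nchi_def norm_divide divide_right_mono)
  also have "\<dots> = sqrt ?n * a" by (simp add: real_div_sqrt flip: times_divide_eq_left)
  also have "\<dots> \<le> branch_bound * a" using branch_bound(2) a by (rule mult_right_mono)
  finally show ?thesis .
qed

lemma up_bound:
  assumes "\<And>v. cmod (f v) \<le> a"
  shows "cmod (up j f v) \<le> a"
proof (cases "v j \<in> pverts (T j) \<and> v j \<noteq> root_of (T j)")
  case True
  let ?n = "real (card (Chi (T j) (par (T j) (v j))))"
  have "?n \<ge> 1" using True leafless_tree.card_Chi_pos[OF tree leafless_tree.par_vert[OF tree, of "v j" j]]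
    by simp
  then have "cmod (f (v(j := par (T j) (v j)))) / sqrt ?n \<le> cmod (f (v(j := par (T j) (v j)))) / 1"
    by (intro divide_left_mono) auto
  then show ?thesis using True assms[of "v(j := par (T j) (v j))"]
    by (simp add: up_def nchi_def norm_divide)
next
  case False
  then have "up j f v = 0" by (auto simp: up_def)
  then show ?thesis using order_trans[OF norm_ge_zero assms[of v]] by simp
qed

text \<open>Every \<open>down\<close> costs a factor \<open>branch_bound\<close> and every
  \<open>wander\<close> a factor \<open>1 + branch_bound\<close>. The l2 norm would give no growth
  in \<alpha>, but exponential growth is harmless, since some positive radius is all that is
  claimed.\<close>

lemma coeff_bound:
  assumes "\<And>v. cmod (f v) \<le> a"
  shows "cmod (coeff \<alpha> f v) \<le> (1 + branch_bound) ^ CARD('d) * branch_bound ^ msize \<alpha> * a"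
proof -
  let ?M = branch_bound
  have wd: "cmod (wander_down j n h v) \<le> (1 + ?M) * ?M ^ n * a"
    if h: "\<And>v. cmod (h v) \<le> a" for h a v n j
  proof -
    have fp: "cmod ((down j ^^ n) h v) \<le> ?M ^ n * a" for v n
    proof (induction n arbitrary: v)
      case (Suc n)
      then show ?case using down_bound[of "(down j ^^ n) h" "?M ^ n * a"] by (simp add: mult.assoc)
    qed (simp add: h)
    have "cmod (wander_down j n h v) \<le> cmod ((down j ^^ n) h v) + cmod (up j (down j ((down j ^^ n) h)) v)"
      by (simp add: wander_down_def wander_def norm_triangle_ineq4)
    also have "\<dots> \<le> ?M ^ n * a + ?M * (?M ^ n * a)"
      by (intro add_mono fp up_bound down_bound)
    finally show ?thesis by (simp add: algebra_simps)
  qed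
  have "cmod (coeffs_along js \<alpha> f v) \<le> (1 + ?M) ^ length js * ?M ^ (\<Sum>j\<in>set js. \<alpha> j) * a"
    if "distinct js" for js v
    using that
  proof (induction js arbitrary: v)
    case (Cons j js)
    have "cmod (coeffs_along js \<alpha> f v) \<le> (1 + ?M) ^ length js * ?M ^ (\<Sum>j\<in>set js. \<alpha> j) * a" for v
      using Cons by simp
    from wd[OF this, where j = j and n = "\<alpha> j" and v = v] show ?case
      using Cons.prems by (simp add: power_add mult_ac)
  qed (simp add: assms)
  from this[OF directions(2), where v = v] show ?thesis
    using distinct_card[OF directions(2)] directions(1) by (simp add: coeff_def msize_def)
qed

end

section \<open>The multishift and its joint kernel\<close>

locale weighted_multishift = tree_product T for T :: "'d::finite \<Rightarrow> 'a pair_pre_digraph" +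
  fixes c :: "nat \<Rightarrow> real" and S :: "'d \<Rightarrow> (('d \<Rightarrow> 'a) \<Rightarrow> complex) \<Rightarrow> (('d \<Rightarrow> 'a) \<Rightarrow> complex)"
  assumes c_pos: "\<And>n. 0 < c n" and c_inf: "0 < (INF n. c n)"
    and multishift: "is_multishift T c S"
begin

text \<open>The diagonal factor: what remains of the weight once the number of children is absorbed
  into \<open>up j\<close>.\<close>

definition depth_weight :: "'d \<Rightarrow> ('d \<Rightarrow> nat) \<Rightarrow> real" where
  "depth_weight j \<delta> =
     sqrt (c (msize \<delta>)) * sqrt ((real (\<delta> j) + 1) / (real (msize \<delta>) + real CARD('d)))"

text \<open>The reciprocal of the product of the squared weights met on the way from depth \<delta>
  to \<delta> + \<alpha>, in any order of the steps; \<open>kernel_coeff_depth_weight\<close> is a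
  single step.\<close>

definition kernel_coeff :: "('d \<Rightarrow> nat) \<Rightarrow> ('d \<Rightarrow> nat) \<Rightarrow> real" where
  "kernel_coeff \<delta> \<alpha> = real (mfact \<delta>) / real (mfact (\<lambda>j. \<delta> j + \<alpha> j)) *
       (\<Prod>j<msize \<alpha>. (real (msize \<delta>) + real CARD('d) + real j) / c (msize \<delta> + j))"

lemma kernel_term_eq:
  "kernel_term c \<delta> z w \<alpha> = complex_of_real (kernel_coeff \<delta> \<alpha>) * cnj (mpower w \<alpha>) * mpower z \<alpha>"
  by (simp add: kernel_term_def kernel_coeff_def)

section \<open>Size of the kernel coefficients\<close>

lemma depth_weight_pos: "0 < depth_weight j \<delta>"
  using c_pos by (simp add: depth_weight_def add_nonneg_pos)

lemma depth_weight_sq: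
  "(depth_weight j \<delta>)\<^sup>2 = c (msize \<delta>) * (real (\<delta> j) + 1) / (real (msize \<delta>) + real CARD('d))"
  using c_pos[of "msize \<delta>"] by (simp add: depth_weight_def power_mult_distrib)

lemma mfact_pos: "0 < mfact \<delta>"
  by (simp add: mfact_def prod_pos)

lemma msize_plus_card_pos: "0 < real (msize (\<delta> :: 'd \<Rightarrow> nat)) + real CARD('d) + real n"
  by (intro add_pos_nonneg add_nonneg_pos) auto

lemma kernel_coeff_pos: "0 < kernel_coeff \<delta> \<alpha>"
  unfolding kernel_coeff_def using c_pos mfact_pos msize_plus_card_pos
  by (intro mult_pos_pos divide_pos_pos prod_pos ballI) auto

lemma msize_Suc: "msize (\<alpha>(k := Suc (\<alpha> k))) = Suc (msize \<alpha>)" for \<alpha> :: "'d \<Rightarrow> nat"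
  by (simp add: msize_def sum.remove[OF finite UNIV_I, of _ k])

lemma msize_add: "msize (\<lambda>j. \<delta> j + \<alpha> j) = msize \<delta> + msize \<alpha>" for \<alpha> :: "'d \<Rightarrow> nat"
  by (simp add: msize_def sum.distrib)

lemma kernel_coeff_step:
  "kernel_coeff \<delta> (\<alpha>(k := Suc (\<alpha> k))) = kernel_coeff \<delta> \<alpha> *
     ((real (msize \<delta>) + real CARD('d) + real (msize \<alpha>)) /
       (c (msize \<delta> + msize \<alpha>) * (real (\<delta> k + \<alpha> k) + 1)))"
proof -
  have "mfact (\<lambda>j. \<delta> j + (\<alpha>(k := Suc (\<alpha> k))) j) = Suc (\<delta> k + \<alpha> k) * mfact (\<lambda>j. \<delta> j + \<alpha> j)"
    by (simp add: mfact_def prod.remove[OF finite UNIV_I, of _ k] algebra_simps)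
  then have "real (mfact (\<lambda>j. \<delta> j + (\<alpha>(k := Suc (\<alpha> k))) j)) =
      (real (\<delta> k + \<alpha> k) + 1) * real (mfact (\<lambda>j. \<delta> j + \<alpha> j))"
    by (simp only: of_nat_mult of_nat_Suc add.commute[of 1])
  then show ?thesis
    unfolding kernel_coeff_def msize_Suc prod.lessThan_Suc by (simp only: times_divide_times_eq
      times_divide_eq_left times_divide_eq_right mult_ac divide_divide_eq_left)
qed

text \<open>The identity behind the intertwining relation: raising the k-th exponent divides the
  coefficient by the square of the weight that \<open>S k\<close> applies at depth \<delta> +
  \<alpha>.\<close>

lemma kernel_coeff_depth_weight:
  "kernel_coeff \<delta> (\<alpha>(k := Suc (\<alpha> k))) * (depth_weight k (\<lambda>j. \<delta> j + \<alpha> j))\<^sup>2 = kernel_coeff \<delta> \<alpha>"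
proof -
  let ?n = "real (msize \<delta>) + real CARD('d) + real (msize \<alpha>)"
  have pos: "?n > 0" "c (msize \<delta> + msize \<alpha>) > 0" "real (\<delta> k + \<alpha> k) + 1 > 0"
    using c_pos msize_plus_card_pos by auto
  have "(depth_weight k (\<lambda>j. \<delta> j + \<alpha> j))\<^sup>2 =
      c (msize \<delta> + msize \<alpha>) * (real (\<delta> k + \<alpha> k) + 1) / ?n"
    by (simp add: depth_weight_sq msize_add add_ac)
  then show ?thesis unfolding kernel_coeff_step using pos by simp
qed

text \<open>Let N = |\<delta>| + d and let n be the size before a step that leads to a maximal
  entry. The denominator of that step is at least inf c times (n + 1) / d, and its numerator N + n
  is at most 2 (n + 1) once n \<ge> N; the quotient is this constant.\<close>

definition growth :: real where
  "growth = 2 * real CARD('d) / (INF n. c n)"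

lemma growth_pos: "0 < growth"
  using c_inf by (simp add: growth_def)

lemma c_ge_inf: "(INF n. c n) \<le> c n"
  by (rule cINF_lower) (auto intro!: bdd_belowI[of _ 0] less_imp_le c_pos)

text \<open>Removing a unit from a maximal entry of \<open>\<alpha>\<close> divides the coefficient by at most \<open>growth\<close>,
  up to a factor \<open>N\<close> that occurs at most \<open>N\<close> times.\<close>

lemma kernel_coeff_bound_aux:
  fixes \<delta> :: "'d \<Rightarrow> nat"
  defines "N \<equiv> msize \<delta> + CARD('d)"
  shows "kernel_coeff \<delta> \<alpha> \<le> growth ^ msize \<alpha> * real N ^ min (msize \<alpha>) N"
proof (induction "msize \<alpha>" arbitrary: \<alpha>)
  case 0
  then have "\<alpha> = (\<lambda>_. 0)" by (auto simp: msize_def)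
  then show ?case using mfact_pos[of \<delta>] by (simp add: kernel_coeff_def msize_def)
next
  case (Suc n)
  obtain k where k: "\<And>j. \<alpha> j \<le> \<alpha> k"
  proof -
    have "Max (range \<alpha>) \<in> range \<alpha>" by (intro Max_in) auto
    then obtain k where k: "Max (range \<alpha>) = \<alpha> k" by blast
    have "\<alpha> j \<le> \<alpha> k" for j unfolding k[symmetric] by simp
    then show ?thesis by (rule that)
  qed
  have "msize \<alpha> \<le> CARD('d) * \<alpha> k"
    unfolding msize_def using sum_bounded_above[of UNIV \<alpha> "\<alpha> k"] k by simp
  then have dk: "Suc n \<le> CARD('d) * \<alpha> k" using Suc.hyps(2) by simp
  then have k0: "\<alpha> k \<noteq> 0" by (intro notI) simp
  define \<beta> where "\<beta> = \<alpha>(k := \<alpha> k - 1)"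
  have \<alpha>: "\<alpha> = \<beta>(k := Suc (\<beta> k))" using k0 by (simp add: \<beta>_def)
  have n: "msize \<beta> = n" using Suc.hyps(2) msize_Suc[of \<beta> k] \<alpha> by simp
  have N1: "1 \<le> N" by (simp add: N_def Suc_leI)
  let ?m = "INF n. c n" and ?g = "if n < N then real N else 1"
  have frac: "A / X \<le> 2 * D / m * g" if "0 < m" "0 < X" "A * m \<le> 2 * g * (D * X)" for A X D m g :: real
    using that by (simp add: field_simps)
  have "(real (msize \<delta>) + real CARD('d) + real n) / (c (msize \<delta> + n) * (real (\<delta> k + \<beta> k) + 1))
      \<le> growth * ?g"
  proof -
    \<comment> \<open>A maximal entry is at least the average of all entries, and
      \<open>\<beta> k + 1\<close> is that entry.\<close>
    have "real (Suc n) \<le> real CARD('d) * (real (\<delta> k + \<beta> k) + 1)"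
    proof -
      have "Suc n \<le> CARD('d) * (\<delta> k + \<beta> k + 1)"
        using dk k0 by (simp add: \<beta>_def) (meson le_trans mult_le_mono2 le_add2)
      then show ?thesis by (metis of_nat_1 of_nat_add of_nat_le_iff of_nat_mult)
    qed
    then have "real (Suc n) * ?m \<le> (real CARD('d) * (real (\<delta> k + \<beta> k) + 1)) * c (msize \<delta> + n)"
      using c_inf by (intro mult_mono c_ge_inf) auto
    then have a: "real (Suc n) * ?m \<le> real CARD('d) * (c (msize \<delta> + n) * (real (\<delta> k + \<beta> k) + 1))"
      by (simp only: mult_ac)
    have "real N + real n \<le> 2 * real (Suc n) * ?g"
    proof (cases "n < N")
      case True
      have "real N + real n \<le> 2 * real N" using True by simp
      also have "\<dots> \<le> 2 * real (Suc n) * real N" by (rule mult_right_mono) auto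
      finally show ?thesis using True by simp
    qed simp
    then have "(real N + real n) * ?m \<le> (2 * real (Suc n) * ?g) * ?m"
      using c_inf by (intro mult_right_mono) auto
    also have "\<dots> = 2 * ?g * (real (Suc n) * ?m)" by simp
    also have "\<dots> \<le> 2 * ?g * (real CARD('d) * (c (msize \<delta> + n) * (real (\<delta> k + \<beta> k) + 1)))"
      using a by (rule mult_left_mono) simp
    finally have "(real N + real n) / (c (msize \<delta> + n) * (real (\<delta> k + \<beta> k) + 1)) \<le>
        2 * real CARD('d) / ?m * ?g"
      using frac[of ?m "c (msize \<delta> + n) * (real (\<delta> k + \<beta> k) + 1)"] c_inf c_pos by simp
    then show ?thesis by (simp add: growth_def N_def)
  qed
  then have "kernel_coeff \<delta> \<alpha> \<le> kernel_coeff \<delta> \<beta> * (growth * ?g)"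
    unfolding \<alpha> kernel_coeff_step n using kernel_coeff_pos[of \<delta> \<beta>] by (intro mult_left_mono) auto
  also have "\<dots> \<le> (growth ^ n * real N ^ min n N) * (growth * ?g)"
    using Suc.hyps(1)[of \<beta>] n growth_pos by (intro mult_right_mono) auto
  also have "\<dots> = growth ^ Suc n * real N ^ min (Suc n) N"
    by (cases "n < N") (simp_all add: min_absorb1 min_absorb2)
  finally show ?case using Suc.hyps(2) by simp
qed

text \<open>The rate \<open>growth\<close> is independent of \<delta>, which affects only the
  constant. Hence a single radius works at every depth.\<close>

lemma kernel_coeff_bound:
  "kernel_coeff \<delta> \<alpha> \<le> real (msize \<delta> + CARD('d)) ^ (msize \<delta> + CARD('d)) * growth ^ msize \<alpha>"
proof -
  let ?N = "msize \<delta> + CARD('d)"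
  have "real ?N ^ min (msize \<alpha>) ?N \<le> real ?N ^ ?N"
    by (rule power_increasing) (auto simp: Suc_leI simp flip: of_nat_add)
  then show ?thesis
    using kernel_coeff_bound_aux[of \<delta> \<alpha>] growth_pos
    by (intro order_trans[OF kernel_coeff_bound_aux]) (simp add: mult.commute mult_left_mono)
qed

section \<open>Factorisation of the multishift and identification of its joint kernel\<close>

lemma Chi_at_eq: "v \<in> V \<Longrightarrow> Chi_at T j v = (\<lambda>x. v(j := x)) ` Chi (T j) (v j)"
  using leafless_tree.Chi_vert[OF tree] upd_in_V[of v]
  by (auto simp: Chi_at_def image_iff fun_eq_iff intro!: bexI)

lemma card_Chi_at: "v \<in> V \<Longrightarrow> card (Chi_at T j v) = card (Chi (T j) (v j))"
  unfolding Chi_at_eq by (rule card_image, rule inj_onI) (metis fun_upd_same)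

lemma shift_weight_child:
  assumes "v \<in> V" "x \<in> Chi (T j) (v j)"
  shows "complex_of_real (shift_weight T c j (v(j := x))) =
    complex_of_real (depth_weight j (mdepth T v)) / nchi j (v j)"
  using leafless_tree.par_Chi[OF tree assms(2)] card_Chi_at[OF assms(1)]
  by (simp add: shift_weight_def Let_def depth_weight_def nchi_def real_sqrt_divide)

lemma S_indicator:
  assumes "v \<in> V"
  shows "S j (indicator {v}) = up j (\<lambda>u. complex_of_real (depth_weight j (mdepth T u)) * indicator {v} u)"
proof
  fix w
  have "S j (indicator {v}) w =
      (\<Sum>w'\<in>Chi_at T j v. complex_of_real (shift_weight T c j w') * indicator {w'} w)"
  proof -
    have "sum g A x = (\<Sum>i\<in>A. g i x)" for g :: "'i \<Rightarrow> ('d \<Rightarrow> 'a) \<Rightarrow> complex" and A x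
      by (induction A rule: infinite_finite_induct) auto
    then show ?thesis using multishift assms by (simp add: is_multishift_def)
  qed
  also have "\<dots> = (if w \<in> Chi_at T j v then complex_of_real (shift_weight T c j w) else 0)"
    using leafless_tree.finite_Chi[OF tree] Chi_at_eq[OF assms]
    by (simp add: indicator_def if_distrib cong: if_cong)
  also have "\<dots> = up j (\<lambda>u. complex_of_real (depth_weight j (mdepth T u)) * indicator {v} u) w"
  proof (cases "w \<in> Chi_at T j v")
    case True
    then obtain x where x: "x \<in> Chi (T j) (v j)" "w = v(j := x)" using Chi_at_eq[OF assms] by blast
    then show ?thesis
      using True leafless_tree.par_Chi[OF tree x(1)] leafless_tree.Chi_vert[OF tree x(1)]
        shift_weight_child[OF assms x(1)] by (simp add: up_def)
  next
    case False
    have "w(j := par (T j) (w j)) \<noteq> v" if "w j \<in> pverts (T j)" "w j \<noteq> root_of (T j)"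
    proof
      assume v: "w(j := par (T j) (w j)) = v"
      then have "w = v(j := w j)" "w j \<in> Chi (T j) (v j)"
        using leafless_tree.Chi_par[OF tree that] by auto
      then show False using False Chi_at_eq[OF assms] by blast
    qed
    then show ?thesis using False by (auto simp: up_def)
  qed
  finally show "S j (indicator {v}) w = \<dots>" .
qed

sublocale ell2: complex_hilbert_space "ell2 V"
  by (rule complex_hilbert_space_ell2)

lemma S_bounded:
  obtains C where "0 \<le> C" "\<And>f. f \<in> hcarrier (ell2 V) \<Longrightarrow> hnorm (ell2 V) (S j f) \<le> C * hnorm (ell2 V) f"
proof -
  have "bounded_operator (ell2 V) (ell2 V) (S j)" using multishift by (simp add: is_multishift_def)
  then obtain C where C: "\<And>f. f \<in> hcarrier (ell2 V) \<Longrightarrow> hnorm (ell2 V) (S j f) \<le> C * hnorm (ell2 V) f"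
    unfolding bounded_operator_def by blast
  have "hnorm (ell2 V) (S j f) \<le> \<bar>C\<bar> * hnorm (ell2 V) f" if "f \<in> hcarrier (ell2 V)" for f
    by (rule order_trans[OF C[OF that]]) (simp add: mult_right_mono ell2_hnorm_nonneg)
  then show ?thesis using that[of "\<bar>C\<bar>"] by simp
qed

lemma S_linear:
  assumes "f \<in> hcarrier (ell2 V)"
  shows "S j f \<in> hcarrier (ell2 V)" "S j (\<lambda>v. a * f v) = (\<lambda>v. a * S j f v)"
    "g \<in> hcarrier (ell2 V) \<Longrightarrow> S j (f + g) = S j f + S j g"
  using multishift assms by (auto simp: is_multishift_def bounded_operator_def ell2_simps(2))

text \<open>Boundedness extends the formula from indicators: taking the entry of
  \<open>S j f\<close> at \<open>w\<close> is a bounded functional of \<open>f\<close>, whose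
  representing vector is supported at most at the vertex having \<open>w\<close> as a child in
  direction \<open>j\<close>.\<close>

lemma S_eq:
  assumes f: "f \<in> hcarrier (ell2 V)"
  shows "S j f = up j (\<lambda>v. complex_of_real (depth_weight j (mdepth T v)) * f v)"
proof
  fix w
  obtain C where C: "0 \<le> C"
    "\<And>f. f \<in> hcarrier (ell2 V) \<Longrightarrow> hnorm (ell2 V) (S j f) \<le> C * hnorm (ell2 V) f"
    using S_bounded by blast
  let ?D = "\<lambda>v. complex_of_real (depth_weight j (mdepth T v))" and ?p = "w(j := par (T j) (w j))"
  let ?k = "\<lambda>v. if v \<in> V then cnj (S j (indicator {v}) w) else 0"
  have "S j f w = hinner (ell2 V) f ?k"
  proof (rule ell2_riesz(2)[of V "\<lambda>f. S j f w" C, OF _ _ _ f])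
    show "cmod (S j f w) \<le> C * hnorm (ell2 V) f" if "f \<in> hcarrier (ell2 V)" for f
      using ell2_pointwise[OF S_linear(1)[OF that], of j w] C(2)[OF that] by linarith
  qed (simp_all add: S_linear)
  also have "\<dots> = up j (\<lambda>v. ?D v * f v) w"
  proof (cases "w j \<in> pverts (T j) \<and> w j \<noteq> root_of (T j)")
    case True
    have k: "?k v = (if v \<in> V \<and> v = ?p then ?D v / nchi j (par (T j) (w j)) else 0)" for v
      using True by (auto simp: S_indicator up_def indicator_def)
    show ?thesis
    proof (cases "?p \<in> V")
      case p: True
      have "hinner (ell2 V) f ?k = (\<Sum>v\<in>{?p}. f v * cnj (?k v))"
        by (rule ell2_finite_support(3)) (use p k in auto)
      then show ?thesis using True p by (simp only: k) (simp add: up_def)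
    next
      case False
      then have "?k = (\<lambda>v. 0)" using k by (intro ext) (simp only: k, auto)
      moreover have "f ?p = 0" using f False by (simp add: ell2_simps)
      ultimately show ?thesis by (simp only: ell2_simps) (simp add: up_def)
    qed
  next
    case False
    then have "?k = (\<lambda>v. 0)" by (intro ext) (auto simp: S_indicator up_def)
    then show ?thesis using False by (simp only: ell2_simps) (auto simp: up_def)
  qed
  finally show "S j f w = up j (\<lambda>v. ?D v * f v) w" .
qed

lemma ell2_vanishes: "f \<in> hcarrier (ell2 V) \<Longrightarrow> vanishes_off f"
  by (simp add: ell2_simps vanishes_off_def)

text \<open>The adjoint is \<open>down j\<close> followed by multiplication with positive weights,
  so the two have the same kernel. Existence of the adjoint vector, which the definite description
  requires, comes from the Riesz representation.\<close>

lemma adjoint_S_zero_iff: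
  assumes f: "f \<in> hcarrier (ell2 V)"
  shows "hilbert_adjoint (ell2 V) (S j) f = 0 \<longleftrightarrow> down j f = (\<lambda>v. 0)"
proof -
  obtain C where C: "0 \<le> C"
    "\<And>f. f \<in> hcarrier (ell2 V) \<Longrightarrow> hnorm (ell2 V) (S j f) \<le> C * hnorm (ell2 V) f"
    using S_bounded by blast
  let ?D = "\<lambda>v. complex_of_real (depth_weight j (mdepth T v))"
  let ?\<phi> = "\<lambda>z. hinner (ell2 V) (S j z) f"
  let ?y = "\<lambda>v. if v \<in> V then cnj (?\<phi> (indicator {v})) else 0"
  have "?\<phi> (z + z') = ?\<phi> z + ?\<phi> z'" "?\<phi> (\<lambda>v. a * z v) = a * ?\<phi> z"
    "cmod (?\<phi> z) \<le> (C * hnorm (ell2 V) f) * hnorm (ell2 V) z"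
    if "z \<in> hcarrier (ell2 V)" "z' \<in> hcarrier (ell2 V)" for z z' a
  proof -
    show "?\<phi> (z + z') = ?\<phi> z + ?\<phi> z'" using that f by (simp add: S_linear ell2.inner_add)
    show "?\<phi> (\<lambda>v. a * z v) = a * ?\<phi> z"
      using ell2.inner_scale[OF S_linear(1)[OF that(1)] f] S_linear(2)[OF that(1)]
      by (simp add: ell2_simps(2))
    have "cmod (?\<phi> z) \<le> hnorm (ell2 V) (S j z) * hnorm (ell2 V) f"
      by (rule ell2.cauchy_schwarz[OF S_linear(1)[OF that(1)] f])
    also have "\<dots> \<le> (C * hnorm (ell2 V) z) * hnorm (ell2 V) f"
      by (rule mult_right_mono[OF C(2)[OF that(1)] ell2_hnorm_nonneg])
    finally show "cmod (?\<phi> z) \<le> (C * hnorm (ell2 V) f) * hnorm (ell2 V) z" by (simp add: mult_ac)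
  qed
  note \<phi> = this
  have y: "?y \<in> hcarrier (ell2 V)" "\<And>z. z \<in> hcarrier (ell2 V) \<Longrightarrow> ?\<phi> z = hinner (ell2 V) z ?y"
    by (rule ell2_riesz[of V ?\<phi> "C * hnorm (ell2 V) f"]; use \<phi> in blast)+
  have "hilbert_adjoint (ell2 V) (S j) f = ?y"
    unfolding hilbert_adjoint_def
  proof (rule the_equality)
    show "?y \<in> hcarrier (ell2 V) \<and> (\<forall>z\<in>hcarrier (ell2 V). ?\<phi> z = hinner (ell2 V) z ?y)"
      using y by blast
    fix y' assume y': "y' \<in> hcarrier (ell2 V) \<and> (\<forall>z\<in>hcarrier (ell2 V). ?\<phi> z = hinner (ell2 V) z y')"
    show "y' = ?y"
      by (rule ell2.inner_eqI) (use y y' in \<open>auto simp del: if_splits\<close>)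
  qed
  moreover have "?y v = ?D v * down j f v" for v
  proof (cases "v \<in> V")
    case True
    let ?e = "\<lambda>u. ?D u * indicator {v} u"
    have e: "finitely_supported ?e" "{u. ?e u \<noteq> 0} = {v}"
      using True depth_weight_pos[of j "mdepth T v"]
      by (auto simp: finitely_supported_def vanishes_off_def indicator_def)
    have "cnj (?\<phi> (indicator {v})) = hinner (ell2 V) f (up j ?e)"
      using S_indicator[OF True]
        finitely_supported_pairing[OF finitely_supported_up[OF e(1)], where f = f] by (simp add: mult.commute)
    also have "\<dots> = hinner (ell2 V) (down j f) ?e" by (rule down_up_adjoint[OF e(1), symmetric])
    also have "\<dots> = ?D v * down j f v"
      using finitely_supported_pairing(1)[OF e(1)] unfolding e(2) by (simp add: mult.commute)
    finally show ?thesis using True by simp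
  next
    case False
    then show ?thesis using vanishes_off_down[OF ell2_vanishes[OF f]] by (simp add: vanishes_off_def)
  qed
  then have "?y = 0 \<longleftrightarrow> down j f = (\<lambda>v. 0)"
    using depth_weight_pos[of j] by (simp add: fun_eq_iff less_imp_neq[symmetric] del: if_splits)
  ultimately show ?thesis by simp
qed

definition E where "E = joint_kernel T S"

lemma E_simps: "hscale E = (\<lambda>a f v. a * f v)" "hinner E = hinner (ell2 V)" "hnorm E = hnorm (ell2 V)"
  by (auto simp: E_def joint_kernel_def hnorm_def ell2_simps fun_eq_iff)

lemma wandering_ell2: "wandering f \<Longrightarrow> f \<in> hcarrier (ell2 V)"
  by (rule ell2_finite_support(1)[OF finite_core core_V]) (rule wandering_off_core)

lemma E_carrier: "f \<in> hcarrier E \<longleftrightarrow> wandering f"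
proof -
  have "f \<in> hcarrier E \<longleftrightarrow> f \<in> hcarrier (ell2 V) \<and> (\<forall>j. hilbert_adjoint (ell2 V) (S j) f = 0)"
    by (auto simp: E_def joint_kernel_def)
  then show ?thesis
    using adjoint_S_zero_iff[of f] wandering_ell2[of f] ell2_vanishes[of f]
    by (auto simp: wandering_def)
qed

end

section \<open>The function model\<close>

text \<open>The image carries the inner product of \<open>K\<close>, so completeness and unitarity
  need no description of the image.\<close>

definition transported_space ::
    "(complex \<Rightarrow> 'c \<Rightarrow> 'c) \<Rightarrow> 'b::ab_group_add hspace \<Rightarrow> ('b \<Rightarrow> 'c::ab_group_add) \<Rightarrow> 'c hspace" where
  "transported_space scl K U =
     \<lparr> hcarrier = U ` hcarrier K, hscale = scl,
       hinner = (\<lambda>f g. hinner K (inv_into (hcarrier K) U f) (inv_into (hcarrier K) U g)) \<rparr>"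

lemma transported_space:
  fixes K :: "'b::ab_group_add hspace" and U :: "'b \<Rightarrow> 'c::ab_group_add"
  assumes K: "complex_hilbert_space K" and scl: "vector_space scl"
    and add: "\<And>x y. x \<in> hcarrier K \<Longrightarrow> y \<in> hcarrier K \<Longrightarrow> U (x + y) = U x + U y"
    and scale: "\<And>a x. x \<in> hcarrier K \<Longrightarrow> U (hscale K a x) = scl a (U x)"
    and inj: "\<And>x. x \<in> hcarrier K \<Longrightarrow> U x = 0 \<Longrightarrow> x = 0"
  shows "complex_hilbert_space (transported_space scl K U)"
    and "unitary_operator K (transported_space scl K U) U"
    and "x \<in> hcarrier K \<Longrightarrow> hnorm (transported_space scl K U) (U x) = hnorm K x"
    and "x \<in> hcarrier K \<Longrightarrow> y \<in> hcarrier K \<Longrightarrow>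
      hinner (transported_space scl K U) (U x) (U y) = hinner K x y"
proof -
  let ?H = "transported_space scl K U"
  interpret K: complex_hilbert_space K by (rule K)
  interpret scl: vector_space scl by (rule scl)
  have H: "hcarrier ?H = U ` hcarrier K" "hscale ?H = scl" by (simp_all add: transported_space_def)
  have diff: "U (x - y) = U x - U y" if "x \<in> hcarrier K" "y \<in> hcarrier K" for x y
    using add[of "x - y" y] that K.carrier_diff by simp
  have U0: "U 0 = 0" using diff[of 0 0] K.carrier_zero by simp
  have inj_on: "inj_on U (hcarrier K)"
  proof (rule inj_onI)
    fix x y assume xy: "x \<in> hcarrier K" "y \<in> hcarrier K" "U x = U y"
    then show "x = y" using inj[of "x - y"] diff K.carrier_diff by simp
  qed
  show inner: "hinner ?H (U x) (U y) = hinner K x y" if "x \<in> hcarrier K" "y \<in> hcarrier K" for x y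
    using that by (simp add: transported_space_def inv_into_f_f[OF inj_on])
  show norm: "hnorm ?H (U x) = hnorm K x" if "x \<in> hcarrier K" for x
    using that by (simp add: hnorm_def inner)
  have vs: "vector_space (hscale ?H)" using scl by (simp add: H)
  show "complex_hilbert_space ?H"
  proof (rule complex_hilbert_space.intro[OF vs], unfold_locales)
    have "scl.subspace (U ` hcarrier K)"
    proof (rule scl.subspaceI)
      show "0 \<in> U ` hcarrier K" using U0 K.carrier_zero by (metis imageI)
      show "f + g \<in> U ` hcarrier K" if "f \<in> U ` hcarrier K" "g \<in> U ` hcarrier K" for f g
        using that by (auto simp: add[symmetric] K.carrier_add)
      show "scl a f \<in> U ` hcarrier K" if "f \<in> U ` hcarrier K" for a f
        using that by (auto simp: scale[symmetric] K.carrier_scale)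
    qed
    then show "module.subspace (hscale ?H) (hcarrier ?H)" by (simp add: H)
    show "hinner ?H (f + g) h = hinner ?H f h + hinner ?H g h"
      if "f \<in> hcarrier ?H" "g \<in> hcarrier ?H" "h \<in> hcarrier ?H" for f g h
      using that by (auto simp: H add[symmetric] inner K.carrier_add K.inner_add)
    show "hinner ?H (hscale ?H a f) g = a * hinner ?H f g"
      if "f \<in> hcarrier ?H" "g \<in> hcarrier ?H" for f g a
      using that by (auto simp: H scale[symmetric] inner K.carrier_scale K.inner_scale)
    show "hinner ?H f g = cnj (hinner ?H g f)" if fg: "f \<in> hcarrier ?H" "g \<in> hcarrier ?H" for f g
    proof -
      obtain x y where "x \<in> hcarrier K" "y \<in> hcarrier K" "f = U x" "g = U y" using fg by (auto simp: H)
      then show ?thesis using K.inner_commute[of x y] by (simp add: inner)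
    qed
    show "0 < Re (hinner ?H f f)" if f: "f \<in> hcarrier ?H" "f \<noteq> 0" for f
    proof -
      obtain x where x: "x \<in> hcarrier K" "f = U x" using f by (auto simp: H)
      then have "x \<noteq> 0" using f U0 by auto
      then show ?thesis using x K.inner_pos by (simp add: inner)
    qed
    show "\<exists>f\<in>hcarrier ?H. (\<lambda>n. hnorm ?H (X n - f)) \<longlonglongrightarrow> 0"
      if X: "\<And>n. X n \<in> hcarrier ?H"
        and cauchy: "\<And>e. 0 < e \<Longrightarrow> \<exists>N. \<forall>m\<ge>N. \<forall>n\<ge>N. hnorm ?H (X m - X n) < e" for X
    proof -
      have "\<forall>n. \<exists>y\<in>hcarrier K. X n = U y" using X by (auto simp: H)
      then obtain Y where Y: "\<And>n. Y n \<in> hcarrier K" "\<And>n. X n = U (Y n)" by metis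
      have d: "hnorm ?H (U x - U y) = hnorm K (x - y)" if "x \<in> hcarrier K" "y \<in> hcarrier K" for x y
        using that by (simp add: diff[symmetric] norm K.carrier_diff)
      have "\<exists>x\<in>hcarrier K. (\<lambda>n. hnorm K (Y n - x)) \<longlonglongrightarrow> 0"
        using cauchy Y by (intro K.complete) (simp_all add: d)
      then obtain x where x: "x \<in> hcarrier K" "(\<lambda>n. hnorm K (Y n - x)) \<longlonglongrightarrow> 0" by blast
      then show ?thesis using Y d by (intro bexI[of _ "U x"]) (auto simp: H)
    qed
  qed
  have "bounded_operator K ?H U"
    unfolding bounded_operator_def using add scale norm by (auto simp: H intro!: exI[of _ 1])
  then show "unitary_operator K ?H U"
    unfolding unitary_operator_def using inner inj_on by (auto simp: H bij_betw_def)
qed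

section \<open>The model map: convergence and intertwining\<close>

context weighted_multishift
begin

text \<open>Model coefficients grow at most like the powers of
  \<open>sqrt growth * branch_bound\<close>; the factor 2 turns the majorant into a geometric series
  of ratio 1/2.\<close>

definition radius :: real where
  "radius = 1 / (2 * sqrt growth * branch_bound)"

definition model_coeff :: "(('d \<Rightarrow> 'a) \<Rightarrow> complex) \<Rightarrow> ('d \<Rightarrow> 'a) \<Rightarrow> ('d \<Rightarrow> nat) \<Rightarrow> complex" where
  "model_coeff f v \<alpha> = complex_of_real (sqrt (kernel_coeff (mdepth T v) \<alpha>)) * coeff \<alpha> f v"

text \<open>Formally \<open>f = (\<Sum>\<alpha>. S\<^sup>\<alpha> g\<^sub>\<alpha>)\<close> with \<open>g\<^sub>\<alpha> v = model_coeff f v \<alpha>\<close> in the joint kernel, and \<open>f\<close> is sent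
  to \<open>z \<mapsto> \<Sum>\<alpha>. z\<^sup>\<alpha> g\<^sub>\<alpha>\<close>.\<close>

definition model :: "(('d \<Rightarrow> 'a) \<Rightarrow> complex) \<Rightarrow> complex ^ 'd \<Rightarrow> ('d \<Rightarrow> 'a) \<Rightarrow> complex" where
  "model f z = (if z \<in> ball 0 radius then \<lambda>v. \<Sum>\<^sub>\<infinity>\<alpha>. model_coeff f v \<alpha> * mpower z \<alpha> else 0)"

definition kernel_sum :: "('d \<Rightarrow> nat) \<Rightarrow> complex ^ 'd \<Rightarrow> complex ^ 'd \<Rightarrow> complex" where
  "kernel_sum \<delta> z w = (\<Sum>\<^sub>\<infinity>\<alpha>. kernel_term c \<delta> z w \<alpha>)"

text \<open>Depth is constant on each sibling class, so on \<open>E\<close> this multiplier is the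
  sum of scalars times projections that \<open>kernel_operator_sum\<close> recovers.\<close>

definition kappa :: "complex ^ 'd \<Rightarrow> complex ^ 'd \<Rightarrow> (('d \<Rightarrow> 'a) \<Rightarrow> complex) \<Rightarrow> ('d \<Rightarrow> 'a) \<Rightarrow> complex" where
  "kappa z w g = (\<lambda>v. kernel_sum (mdepth T v) z w * g v)"

definition model_space :: "(complex ^ 'd \<Rightarrow> ('d \<Rightarrow> 'a) \<Rightarrow> complex) hspace" where
  "model_space = transported_space (\<lambda>a F z. hscale E a (F z)) (ell2 V) model"

lemma radius_pos: "0 < radius"
  using growth_pos branch_bound(1) by (simp add: radius_def)

lemma radius_scaled: "sqrt growth * branch_bound * radius = 1 / 2"
  using growth_pos branch_bound(1) by (simp add: radius_def)

lemma radius_sq: "growth * radius\<^sup>2 \<le> 1 / 2"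
proof -
  have "growth * radius\<^sup>2 * (branch_bound * branch_bound) = (sqrt growth * branch_bound * radius)\<^sup>2"
    using growth_pos by (simp add: power_mult_distrib power2_eq_square mult_ac)
  also have "\<dots> = 1 / 4" by (simp add: radius_scaled power2_eq_square)
  finally have e: "growth * radius\<^sup>2 * (branch_bound * branch_bound) = 1 / 4" .
  have "1 \<le> branch_bound * branch_bound" using mult_mono[of 1 branch_bound 1 branch_bound] branch_bound(1) by simp
  then have "growth * radius\<^sup>2 * 1 \<le> growth * radius\<^sup>2 * (branch_bound * branch_bound)"
    using growth_pos by (intro mult_left_mono) auto
  then show ?thesis using e by simp
qed

abbreviation geometric :: "('d \<Rightarrow> nat) \<Rightarrow> real" where
  "geometric \<equiv> \<lambda>\<alpha>. (1 / 2) ^ msize \<alpha>"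

lemma geometric_summable: "geometric summable_on UNIV"
  by (rule summable_on_geometric_multiindex) auto

definition eval_const :: "('d \<Rightarrow> 'a) \<Rightarrow> real" where
  "eval_const v = sqrt (real (msize (mdepth T v) + CARD('d)) ^ (msize (mdepth T v) + CARD('d))) *
     (1 + branch_bound) ^ CARD('d)"

lemma model_coeff_bound:
  assumes "f \<in> hcarrier (ell2 V)"
  shows "cmod (model_coeff f v \<alpha>) * radius ^ msize \<alpha> \<le> eval_const v * hnorm (ell2 V) f * geometric \<alpha>"
proof -
  let ?N = "msize (mdepth T v) + CARD('d)"
  have "sqrt (kernel_coeff (mdepth T v) \<alpha>) \<le> sqrt (real ?N ^ ?N * growth ^ msize \<alpha>)"
    by (rule real_sqrt_le_mono) (rule kernel_coeff_bound)
  also have "\<dots> = sqrt (real ?N ^ ?N) * sqrt growth ^ msize \<alpha>"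
    by (simp add: real_sqrt_mult real_sqrt_power)
  finally have 1: "sqrt (kernel_coeff (mdepth T v) \<alpha>) \<le> sqrt (real ?N ^ ?N) * sqrt growth ^ msize \<alpha>" .
  have 2: "cmod (coeff \<alpha> f v) \<le> (1 + branch_bound) ^ CARD('d) * branch_bound ^ msize \<alpha> * hnorm (ell2 V) f"
    by (rule coeff_bound) (rule ell2_pointwise[OF assms])
  have "cmod (model_coeff f v \<alpha>) = sqrt (kernel_coeff (mdepth T v) \<alpha>) * cmod (coeff \<alpha> f v)"
    using kernel_coeff_pos[of "mdepth T v" \<alpha>] by (simp add: model_coeff_def norm_mult)
  also have "\<dots> \<le> (sqrt (real ?N ^ ?N) * sqrt growth ^ msize \<alpha>) *
      ((1 + branch_bound) ^ CARD('d) * branch_bound ^ msize \<alpha> * hnorm (ell2 V) f)"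
    using 1 2 growth_pos by (intro mult_mono) auto
  finally have "cmod (model_coeff f v \<alpha>) * radius ^ msize \<alpha> \<le>
      (sqrt (real ?N ^ ?N) * sqrt growth ^ msize \<alpha>) *
      ((1 + branch_bound) ^ CARD('d) * branch_bound ^ msize \<alpha> * hnorm (ell2 V) f) * radius ^ msize \<alpha>"
    using radius_pos by (intro mult_right_mono) auto
  also have "\<dots> = eval_const v * hnorm (ell2 V) f * (sqrt growth * branch_bound * radius) ^ msize \<alpha>"
    by (simp only: eval_const_def power_mult_distrib mult_ac)
  finally show ?thesis by (simp only: radius_scaled)
qed

lemma model_coeff_summable:
  assumes "f \<in> hcarrier (ell2 V)"
  shows "(\<lambda>\<alpha>. cmod (model_coeff f v \<alpha>) * radius ^ msize \<alpha>) summable_on UNIV"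
  by (rule summable_on_comparison_test[OF summable_on_cmult_right[OF geometric_summable]])
    (use model_coeff_bound[OF assms] radius_pos in auto)

lemma ball_coord_le: "z \<in> ball 0 r \<Longrightarrow> cmod (z $ j) \<le> r" for z :: "complex ^ 'd"
  using ball_coord[of z r j] by simp

lemma model_abs_summable:
  assumes "f \<in> hcarrier (ell2 V)" "z \<in> ball 0 radius"
  shows "(\<lambda>\<alpha>. cmod (model_coeff f v \<alpha> * mpower z \<alpha>)) summable_on UNIV"
    "(\<lambda>\<alpha>. model_coeff f v \<alpha> * mpower z \<alpha>) summable_on UNIV"
proof -
  show s: "(\<lambda>\<alpha>. cmod (model_coeff f v \<alpha> * mpower z \<alpha>)) summable_on UNIV"
    using model_coeff_summable[OF assms(1)] ball_coord_le[OF assms(2)] by (rule multi_series_abs_summable)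
  then show "(\<lambda>\<alpha>. model_coeff f v \<alpha> * mpower z \<alpha>) summable_on UNIV"
    by (rule Infinite_Sum.abs_summable_summable)
qed

lemma model_pointwise:
  assumes f: "f \<in> hcarrier (ell2 V)"
  shows "cmod (model f z v) \<le> eval_const v * (\<Sum>\<^sub>\<infinity>\<alpha>. geometric \<alpha>) * hnorm (ell2 V) f"
proof (cases "z \<in> ball 0 radius")
  case True
  have "cmod (model f z v) \<le> (eval_const v * hnorm (ell2 V) f) * (\<Sum>\<^sub>\<infinity>\<alpha>. geometric \<alpha>)"
  proof (rule norm_infsum_le)
    show "((\<lambda>\<alpha>. model_coeff f v \<alpha> * mpower z \<alpha>) has_sum model f z v) UNIV"
      using has_sum_infsum[OF model_abs_summable(2)[OF f True]] True by (simp add: model_def)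
    show "((\<lambda>\<alpha>. (eval_const v * hnorm (ell2 V) f) * geometric \<alpha>) has_sum
        ((eval_const v * hnorm (ell2 V) f) * (\<Sum>\<^sub>\<infinity>\<alpha>. geometric \<alpha>))) UNIV"
      by (intro has_sum_cmult_right has_sum_infsum geometric_summable)
    fix \<alpha> :: "'d \<Rightarrow> nat"
    have "cmod (model_coeff f v \<alpha> * mpower z \<alpha>) \<le> cmod (model_coeff f v \<alpha>) * radius ^ msize \<alpha>"
      unfolding norm_mult by (rule mult_left_mono[OF norm_mpower_le[OF ball_coord_le[OF True]]]) simp
    also have "\<dots> \<le> eval_const v * hnorm (ell2 V) f * geometric \<alpha>"
      by (rule model_coeff_bound[OF f])
    finally show "cmod (model_coeff f v \<alpha> * mpower z \<alpha>) \<le> eval_const v * hnorm (ell2 V) f * geometric \<alpha>" .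
  qed
  then show ?thesis by (simp add: mult_ac)
next
  case False
  have "0 \<le> eval_const v" using branch_bound(1) by (simp add: eval_const_def)
  then show ?thesis using False
    by (simp add: model_def infsum_nonneg ell2_hnorm_nonneg)
qed

lemma wandering_multiplier: "wandering g \<Longrightarrow> wandering (\<lambda>v. \<psi> (mdepth T v) * g v)"
  by (simp add: wandering_def down_multiplier) (simp add: vanishes_off_def)

text \<open>By local finiteness \<open>down k\<close> is a finite sum at each vertex, hence passes
  under a pointwise infinite sum.\<close>

lemma wandering_infsum:
  fixes h :: "'i \<Rightarrow> ('d \<Rightarrow> 'a) \<Rightarrow> complex"
  assumes "\<And>i. wandering (h i)" "\<And>v. (\<lambda>i. h i v) summable_on I"
  shows "wandering (\<lambda>v. \<Sum>\<^sub>\<infinity>i\<in>I. h i v)"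
  unfolding wandering_def
proof (intro conjI allI ext)
  show "vanishes_off (\<lambda>v. \<Sum>\<^sub>\<infinity>i\<in>I. h i v)"
    using assms(1) by (auto simp: wandering_def vanishes_off_def)
  fix k v
  let ?A = "Chi (T k) (v k)"
  have "((\<lambda>i. \<Sum>x\<in>?A. h i (v(k := x))) has_sum (\<Sum>x\<in>?A. \<Sum>\<^sub>\<infinity>i\<in>I. h i (v(k := x)))) I"
    by (intro has_sum_sum has_sum_infsum assms(2))
  then have "((\<lambda>i. (\<Sum>x\<in>?A. h i (v(k := x))) * (1 / nchi k (v k))) has_sum
      ((\<Sum>x\<in>?A. \<Sum>\<^sub>\<infinity>i\<in>I. h i (v(k := x))) * (1 / nchi k (v k)))) I"
    by (rule has_sum_cmult_left)
  moreover have "(\<Sum>x\<in>?A. h i (v(k := x))) * (1 / nchi k (v k)) = 0" for i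
  proof -
    have "down k (h i) v = 0" using assms(1)[of i] by (simp add: wandering_def)
    then show ?thesis by (simp add: down_def)
  qed
  ultimately have "((\<lambda>i::'i. 0) has_sum
      ((\<Sum>x\<in>?A. \<Sum>\<^sub>\<infinity>i\<in>I. h i (v(k := x))) * (1 / nchi k (v k)))) I"
    by (simp only:)
  then have "(\<Sum>x\<in>?A. \<Sum>\<^sub>\<infinity>i\<in>I. h i (v(k := x))) * (1 / nchi k (v k)) = 0"
    by (rule has_sum_unique) (simp add: has_sum_0)
  then show "down k (\<lambda>v. \<Sum>\<^sub>\<infinity>i\<in>I. h i v) v = 0" by (simp add: down_def)
qed

lemma wandering_model_coeff: "vanishes_off f \<Longrightarrow> wandering (\<lambda>v. model_coeff f v \<alpha> * a)"
  using wandering_multiplier[OF wandering_coeff, of f "\<lambda>\<delta>. complex_of_real (sqrt (kernel_coeff \<delta> \<alpha>)) * a" \<alpha>]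
  by (simp add: model_coeff_def mult_ac)

lemma model_in_E:
  assumes f: "f \<in> hcarrier (ell2 V)" and z: "z \<in> ball 0 radius"
  shows "model f z \<in> hcarrier E"
proof -
  have "wandering (\<lambda>v. \<Sum>\<^sub>\<infinity>\<alpha>. model_coeff f v \<alpha> * mpower z \<alpha>)"
    by (rule wandering_infsum[OF wandering_model_coeff[OF ell2_vanishes[OF f]] model_abs_summable(2)[OF f z]])
  then show ?thesis using z by (simp add: E_carrier model_def)
qed

lemma coeff_lin: "coeff \<alpha> (\<lambda>v. a * f v + g v) = (\<lambda>v. a * coeff \<alpha> f v + coeff \<alpha> g v)"
  by (simp add: coeff_def coeffs_along_lin)

lemma model_lin:
  assumes "f \<in> hcarrier (ell2 V)" "g \<in> hcarrier (ell2 V)"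
  shows "model (\<lambda>v. a * f v + g v) = (\<lambda>z v. a * model f z v + model g z v)"
proof (intro ext)
  fix z v
  show "model (\<lambda>v. a * f v + g v) z v = a * model f z v + model g z v"
  proof (cases "z \<in> ball 0 radius")
    case True
    have "model_coeff (\<lambda>v. a * f v + g v) v \<alpha> * mpower z \<alpha> =
        a * (model_coeff f v \<alpha> * mpower z \<alpha>) + model_coeff g v \<alpha> * mpower z \<alpha>" for \<alpha>
      unfolding model_coeff_def coeff_lin by (simp add: algebra_simps)
    then have "model (\<lambda>v. a * f v + g v) z v =
        (\<Sum>\<^sub>\<infinity>\<alpha>. a * (model_coeff f v \<alpha> * mpower z \<alpha>) + model_coeff g v \<alpha> * mpower z \<alpha>)"
      using True by (simp add: model_def)
    also have "\<dots> = a * model f z v + model g z v"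
      using True model_abs_summable(2)[OF assms(1) True] model_abs_summable(2)[OF assms(2) True]
      by (simp add: model_def infsum_add summable_on_cmult_right infsum_cmult_right')
    finally show ?thesis .
  qed (simp add: model_def)
qed

lemma model_add:
  assumes "f \<in> hcarrier (ell2 V)" "g \<in> hcarrier (ell2 V)"
  shows "model (f + g) = model f + model g"
  using model_lin[OF assms, of 1] by (simp add: plus_fun_def)

lemma model_scale:
  assumes "f \<in> hcarrier (ell2 V)"
  shows "model (\<lambda>v. a * f v) = (\<lambda>z v. a * model f z v)"
proof -
  have z: "(\<lambda>v. 0) \<in> hcarrier (ell2 V)" using ell2.carrier_zero by (simp add: zero_fun_def)
  have "model (\<lambda>v. 0) z v = 0" for z v
    by (simp add: model_def model_coeff_def coeff_def coeffs_along_0)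
  then show ?thesis using model_lin[OF assms z, of a] by simp
qed

lemma model_injective:
  assumes f: "f \<in> hcarrier (ell2 V)" and zero: "model f = 0"
  shows "f = 0"
proof -
  have "model_coeff f v \<beta> = 0" for v \<beta>
  proof (rule multi_series_unique[OF radius_pos model_coeff_summable[OF f]])
    \<comment> \<open>Uniqueness is stated on polydiscs. This one fits into the ball because the
      norm is at most the sum of the moduli, here at most \<open>radius / 2\<close>.\<close>
    let ?s = "radius / (2 * real CARD('d))"
    show "0 < ?s" using radius_pos by simp
    have "1 \<le> CARD('d)" by (simp add: Suc_leI)
    then have "1 \<le> 2 * real CARD('d)" by linarith
    then show "?s \<le> radius"
      using radius_pos mult_left_mono[of 1 "2 * real CARD('d)" radius] by (simp add: divide_le_eq)
    fix z :: "complex ^ 'd" assume z: "\<And>j. cmod (z $ j) \<le> ?s"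
    have "norm z \<le> (\<Sum>j\<in>UNIV. cmod (z $ j))" 
      unfolding norm_vec_def by (rule L2_set_le_sum) simp
    also have "\<dots> \<le> real CARD('d) * ?s" using sum_bounded_above[of UNIV "\<lambda>j. cmod (z $ j)" ?s] z by simp
    also have "\<dots> < radius" using radius_pos by simp
    finally have "z \<in> ball 0 radius" by simp
    then show "(\<Sum>\<^sub>\<infinity>\<alpha>. model_coeff f v \<alpha> * mpower z \<alpha>) = 0"
      using fun_cong[OF fun_cong[OF zero, of z], of v] by (simp add: model_def)
  qed
  then have "coeff \<beta> f = (\<lambda>v. 0)" for \<beta>
    using kernel_coeff_pos[THEN less_imp_neq] by (simp add: model_coeff_def fun_eq_iff)
  then show ?thesis using coeff_injective[OF ell2_vanishes[OF f]] by (simp add: zero_fun_def)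
qed

text \<open>Terms with \<alpha> j = 0 vanish because \<open>S j f\<close> lies in the range of
  \<open>up j\<close>, and raising the j-th exponent in the others produces the factor
  \<open>z $ j\<close>. The weight inserted by \<open>S j\<close> cancels the ratio of the square
  roots of consecutive kernel coefficients.\<close>

lemma model_S:
  assumes f: "f \<in> hcarrier (ell2 V)"
  shows "model (S j f) z v = z $ j * model f z v"
proof (cases "z \<in> ball 0 radius")
  case True
  let ?D = "\<lambda>v. complex_of_real (depth_weight j (mdepth T v)) * f v"
  let ?h = "\<lambda>\<alpha>::'d \<Rightarrow> nat. \<alpha>(j := Suc (\<alpha> j))"
  have D: "vanishes_off ?D" using ell2_vanishes[OF f] by (simp add: vanishes_off_def)
  have term0: "model_coeff (S j f) v \<alpha> = 0" if "\<alpha> j = 0" for \<alpha>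
    using that by (simp add: model_coeff_def S_eq[OF f] coeff_up[OF D])
  have "model_coeff (S j f) v (?h \<alpha>) * mpower z (?h \<alpha>) = z $ j * (model_coeff f v \<alpha> * mpower z \<alpha>)" for \<alpha>
  proof -
    have "sqrt (kernel_coeff (mdepth T v) (?h \<alpha>)) * depth_weight j (\<lambda>i. mdepth T v i + \<alpha> i) =
        sqrt (kernel_coeff (mdepth T v) \<alpha>)"
      using depth_weight_pos[of j "\<lambda>i. mdepth T v i + \<alpha> i"]
      unfolding kernel_coeff_depth_weight[of "mdepth T v" \<alpha> j, symmetric]
      by (simp add: real_sqrt_mult)
    moreover have "coeff (?h \<alpha>) (S j f) v =
        complex_of_real (depth_weight j (\<lambda>i. mdepth T v i + \<alpha> i)) * coeff \<alpha> f v"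
      using coeff_multiplier[of \<alpha> "\<lambda>\<delta>. complex_of_real (depth_weight j \<delta>)" f]
      by (simp add: S_eq[OF f] coeff_up[OF D])
    ultimately have "model_coeff (S j f) v (?h \<alpha>) = model_coeff f v \<alpha>"
      by (simp add: model_coeff_def mult.assoc[symmetric] flip: of_real_mult)
    moreover have "mpower z (?h \<alpha>) = z $ j * mpower z \<alpha>"
      by (simp add: mpower_def prod.remove[OF finite UNIV_I, of _ j])
    ultimately show ?thesis by simp
  qed
  then have "(\<Sum>\<^sub>\<infinity>\<alpha>. z $ j * (model_coeff f v \<alpha> * mpower z \<alpha>)) =
      (\<Sum>\<^sub>\<infinity>\<alpha>. model_coeff (S j f) v (?h \<alpha>) * mpower z (?h \<alpha>))" by simp
  also have "\<dots> = (\<Sum>\<^sub>\<infinity>\<alpha>\<in>{\<alpha>. \<alpha> j \<noteq> 0}. model_coeff (S j f) v \<alpha> * mpower z \<alpha>)"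
    by (rule infsum_reindex_bij_betw, rule bij_betwI[of _ _ _ "\<lambda>\<alpha>. \<alpha>(j := \<alpha> j - 1)"]) auto
  also have "\<dots> = (\<Sum>\<^sub>\<infinity>\<alpha>. model_coeff (S j f) v \<alpha> * mpower z \<alpha>)"
    by (rule infsum_cong_neutral) (auto simp: term0)
  finally show ?thesis using True by (simp add: model_def infsum_cmult_right')
qed (simp add: model_def)

section \<open>The reproducing kernel space\<close>

lemma kernel_coeff_summable:
  assumes w: "w \<in> ball 0 radius"
  shows "(\<lambda>\<alpha>. cmod (complex_of_real (kernel_coeff \<delta> \<alpha>) * cnj (mpower w \<alpha>)) * radius ^ msize \<alpha>) summable_on UNIV"
proof (rule summable_on_comparison_test)
  let ?C = "real (msize \<delta> + CARD('d)) ^ (msize \<delta> + CARD('d))"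
  show "(\<lambda>\<alpha>. ?C * geometric \<alpha>) summable_on UNIV"
    by (rule summable_on_cmult_right[OF geometric_summable])
  fix \<alpha> :: "'d \<Rightarrow> nat"
  have "cmod (complex_of_real (kernel_coeff \<delta> \<alpha>) * cnj (mpower w \<alpha>)) * radius ^ msize \<alpha> =
      kernel_coeff \<delta> \<alpha> * cmod (mpower w \<alpha>) * radius ^ msize \<alpha>"
    using kernel_coeff_pos[of \<delta> \<alpha>] by (simp add: norm_mult)
  also have "\<dots> \<le> (?C * growth ^ msize \<alpha>) * radius ^ msize \<alpha> * radius ^ msize \<alpha>"
    using kernel_coeff_bound[of \<delta> \<alpha>] norm_mpower_le[OF ball_coord_le[OF w], of \<alpha>] radius_pos growth_pos
    by (intro mult_right_mono mult_mono) auto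
  also have "\<dots> = ?C * (growth * radius\<^sup>2) ^ msize \<alpha>"
    by (simp add: power_mult_distrib power2_eq_square mult_ac)
  also have "\<dots> \<le> ?C * geometric \<alpha>"
    using growth_pos by (intro mult_left_mono power_mono radius_sq) auto
  finally show "cmod (complex_of_real (kernel_coeff \<delta> \<alpha>) * cnj (mpower w \<alpha>)) * radius ^ msize \<alpha> \<le>
      ?C * geometric \<alpha>" .
qed (use radius_pos in auto)

lemma kernel_term_summable:
  assumes "z \<in> ball 0 radius" "w \<in> ball 0 radius"
  shows "kernel_term c (\<delta> :: 'd \<Rightarrow> nat) z w summable_on UNIV"
  unfolding kernel_term_eq[abs_def]
  by (rule Infinite_Sum.abs_summable_summable,
      rule multi_series_abs_summable[OF kernel_coeff_summable[OF assms(2)] ball_coord_le[OF assms(1)]])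

text \<open>Elements of \<open>E\<close> live on the finite set \<open>core\<close>, so finitely
  many entrywise bounds control the norm; this is where finite dimension enters the evaluation
  bounds.\<close>

lemma core_hnorm_bound:
  assumes "\<And>v. v \<notin> core \<Longrightarrow> f v = 0"
  shows "hnorm (ell2 V) f \<le> (\<Sum>v\<in>core. cmod (f v))"
proof -
  have "(hnorm (ell2 V) f)\<^sup>2 = (\<Sum>v\<in>core. (cmod (f v))\<^sup>2)"
    by (rule ell2_finite_support(2)[OF finite_core core_V assms])
  then have "hnorm (ell2 V) f = L2_set (\<lambda>v. cmod (f v)) core"
    unfolding L2_set_def by (intro real_sqrt_unique[symmetric] ell2_hnorm_nonneg)
  then show ?thesis by (simp add: L2_set_le_sum)
qed

lemma core_pairing:
  assumes "wandering g"
  shows "hinner (ell2 V) f g = (\<Sum>v\<in>core. f v * cnj (g v))"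
  by (rule ell2_finite_support(3)[OF finite_core core_V wandering_off_core[OF assms]])

lemma kappa_bounded: "bounded_operator E E (kappa z w)"
  unfolding bounded_operator_def E_simps
proof (intro conjI ballI allI)
  show "kappa z w g \<in> hcarrier E" if "g \<in> hcarrier E" for g
    using wandering_multiplier[of g "\<lambda>\<delta>. kernel_sum \<delta> z w"] that by (simp add: E_carrier kappa_def)
  show "kappa z w (f + g) = kappa z w f + kappa z w g" for f g
    by (auto simp: kappa_def algebra_simps)
  show "kappa z w (\<lambda>v. a * f v) = (\<lambda>v. a * kappa z w f v)" for a f
    by (simp add: kappa_def mult_ac)
  show "\<exists>C. \<forall>g\<in>hcarrier E. hnorm (ell2 V) (kappa z w g) \<le> C * hnorm (ell2 V) g"
  proof (intro exI ballI)
    fix g assume "g \<in> hcarrier E"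
    then have g: "wandering g" by (simp add: E_carrier)
    have "hnorm (ell2 V) (kappa z w g) \<le> (\<Sum>v\<in>core. cmod (kappa z w g v))"
      by (rule core_hnorm_bound) (simp add: kappa_def wandering_off_core[OF g])
    also have "\<dots> \<le> (\<Sum>v\<in>core. cmod (kernel_sum (mdepth T v) z w) * hnorm (ell2 V) g)"
      unfolding kappa_def norm_mult
      by (intro sum_mono mult_left_mono ell2_pointwise wandering_ell2 g) auto
    finally show "hnorm (ell2 V) (kappa z w g) \<le>
        (\<Sum>v\<in>core. cmod (kernel_sum (mdepth T v) z w)) * hnorm (ell2 V) g"
      by (simp add: sum_distrib_right)
  qed
qed

lemma model_space_simps:
  "hcarrier model_space = model ` hcarrier (ell2 V)" "hscale model_space = (\<lambda>a F z. hscale E a (F z))"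
  by (simp_all add: model_space_def transported_space_def)

lemma vector_space_E_valued: "vector_space (\<lambda>a (F :: complex ^ 'd \<Rightarrow> ('d \<Rightarrow> 'a) \<Rightarrow> complex) z. hscale E a (F z))"
  unfolding E_simps by unfold_locales (auto simp: fun_eq_iff algebra_simps)

lemma model_space:
  "complex_hilbert_space model_space"
  "unitary_operator (ell2 V) model_space model"
  "f \<in> hcarrier (ell2 V) \<Longrightarrow> hnorm model_space (model f) = hnorm (ell2 V) f"
  "f \<in> hcarrier (ell2 V) \<Longrightarrow> g \<in> hcarrier (ell2 V) \<Longrightarrow>
     hinner model_space (model f) (model g) = hinner (ell2 V) f g"
  unfolding model_space_def
  by (rule transported_space[OF complex_hilbert_space_ell2 vector_space_E_valued];
      simp add: model_add model_scale model_injective ell2_simps(2) E_simps(1))+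

lemma reproducing_model_space: "reproducing_kernel_space E (ball 0 radius) model_space"
  unfolding reproducing_kernel_space_def
proof (intro conjI ballI allI impI)
  fix F z assume F: "F \<in> hcarrier model_space"
  then obtain f where f: "f \<in> hcarrier (ell2 V)" "F = model f" by (auto simp: model_space_simps)
  show "F z \<in> hcarrier E" if "z \<in> ball 0 radius" using f model_in_E that by simp
  show "F z = 0" if "z \<notin> ball 0 radius" using f that by (simp add: model_def)
next
  fix z :: "complex ^ 'd" assume z: "z \<in> ball 0 radius"
  show "\<exists>C. \<forall>F\<in>hcarrier model_space. hnorm E (F z) \<le> C * hnorm model_space F"
  proof (intro exI ballI)
    fix F assume "F \<in> hcarrier model_space"
    then obtain f where f: "f \<in> hcarrier (ell2 V)" "F = model f" by (auto simp: model_space_simps)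
    have "wandering (model f z)" using model_in_E[OF f(1) z] by (simp add: E_carrier)
    then have "hnorm E (F z) \<le> (\<Sum>v\<in>core. cmod (model f z v))"
      unfolding E_simps f by (intro core_hnorm_bound wandering_off_core)
    also have "\<dots> \<le> (\<Sum>v\<in>core. eval_const v * (\<Sum>\<^sub>\<infinity>\<alpha>. geometric \<alpha>) * hnorm (ell2 V) f)"
      by (intro sum_mono model_pointwise[OF f(1)])
    finally show "hnorm E (F z) \<le> (\<Sum>v\<in>core. eval_const v * (\<Sum>\<^sub>\<infinity>\<alpha>. geometric \<alpha>)) * hnorm model_space F"
      using f by (simp add: model_space(3) sum_distrib_right)
  qed
qed (simp_all add: model_space(1) model_space_simps)

lemma mult_coord_model:
  "f \<in> hcarrier (ell2 V) \<Longrightarrow> mult_coord E j (model f) = model (S j f)"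
  by (simp add: mult_coord_def E_simps model_S fun_eq_iff)

lemma mult_coord_bounded: "bounded_operator model_space model_space (mult_coord E j)"
  unfolding bounded_operator_def
proof (intro conjI ballI allI)
  show "mult_coord E j F \<in> hcarrier model_space" if "F \<in> hcarrier model_space" for F
    using that by (auto simp: model_space_simps mult_coord_model S_linear)
  show "mult_coord E j (F + G) = mult_coord E j F + mult_coord E j G" for F G
    by (auto simp: mult_coord_def E_simps fun_eq_iff algebra_simps)
  show "mult_coord E j (hscale model_space a F) = hscale model_space a (mult_coord E j F)" for a F
    by (auto simp: mult_coord_def E_simps model_space_simps fun_eq_iff)
  obtain C where C: "\<And>f. f \<in> hcarrier (ell2 V) \<Longrightarrow> hnorm (ell2 V) (S j f) \<le> C * hnorm (ell2 V) f"
    using S_bounded by blast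
  show "\<exists>C. \<forall>F\<in>hcarrier model_space. hnorm model_space (mult_coord E j F) \<le> C * hnorm model_space F"
    using C by (intro exI[of _ C]) (auto simp: model_space_simps mult_coord_model model_space(3) S_linear)
qed

lemma unitarily_equivalent_model: "unitarily_equivalent (ell2 V) S model_space (mult_coord E)"
  unfolding unitarily_equivalent_def using model_space(2) mult_coord_model by (metis)

text \<open>The kernel function \<open>k\<close> is produced by the Riesz representation theorem; its coefficients are
  computed by pairing it with the elements dual to \<open>coeff \<beta>\<close>.\<close>

lemma kernel_function:
  assumes w: "w \<in> ball 0 radius" and g: "wandering g"
  obtains k where "k \<in> hcarrier (ell2 V)"
    "model k = (\<lambda>z. if z \<in> ball 0 radius then kappa z w g else 0)"
    "\<And>f. f \<in> hcarrier (ell2 V) \<Longrightarrow> hinner (ell2 V) (model f w) g = hinner (ell2 V) f k"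
proof -
  let ?\<phi> = "\<lambda>f. hinner (ell2 V) (model f w) g"
  let ?G = "\<Sum>\<^sub>\<infinity>\<alpha>::'d \<Rightarrow> nat. geometric \<alpha>"
  define k where "k v = (if v \<in> V then cnj (?\<phi> (indicator {v})) else 0)" for v
  have \<phi>: "?\<phi> f = (\<Sum>v\<in>core. model f w v * cnj (g v))" for f by (rule core_pairing[OF g])
  have add: "?\<phi> (f + h) = ?\<phi> f + ?\<phi> h" if "f \<in> hcarrier (ell2 V)" "h \<in> hcarrier (ell2 V)" for f h
    unfolding \<phi> using that by (simp add: model_add algebra_simps sum.distrib)
  have scale: "?\<phi> (\<lambda>v. a * f v) = a * ?\<phi> f" if "f \<in> hcarrier (ell2 V)" for a f
    unfolding \<phi> using that by (simp add: model_scale algebra_simps sum_distrib_left)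
  have bound: "cmod (?\<phi> f) \<le> (\<Sum>v\<in>core. eval_const v * ?G * cmod (g v)) * hnorm (ell2 V) f"
    if f: "f \<in> hcarrier (ell2 V)" for f
  proof -
    have "cmod (?\<phi> f) \<le> (\<Sum>v\<in>core. cmod (model f w v) * cmod (g v))"
      unfolding \<phi> by (rule order_trans[OF norm_sum]) (simp add: norm_mult)
    also have "\<dots> \<le> (\<Sum>v\<in>core. (eval_const v * ?G * hnorm (ell2 V) f) * cmod (g v))"
      by (intro sum_mono mult_right_mono model_pointwise[OF f]) auto
    finally show ?thesis unfolding sum_distrib_right by (simp only: mult_ac)
  qed
  have kc: "k \<in> hcarrier (ell2 V)"
    unfolding k_def by (rule ell2_riesz(1)[OF add scale bound])
  have k: "?\<phi> f = hinner (ell2 V) f k" if "f \<in> hcarrier (ell2 V)" for f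
    unfolding k_def by (rule ell2_riesz(2)[OF add scale bound that])
  have "coeff \<beta> k v = complex_of_real (sqrt (kernel_coeff (mdepth T v) \<beta>)) * cnj (mpower w \<beta>) * g v" for \<beta> v
  proof -
    let ?\<omega> = "\<lambda>\<delta>. complex_of_real (sqrt (kernel_coeff \<delta> \<beta>))"
    let ?h = "\<lambda>v. ?\<omega> (mdepth T v) * cnj (mpower w \<beta>) * g v"
    have h: "wandering ?h"
      using wandering_multiplier[OF g, of "\<lambda>\<delta>. ?\<omega> \<delta> * cnj (mpower w \<beta>)"] by simp
    have ck: "wandering (coeff \<beta> k)" by (rule wandering_coeff[OF ell2_vanishes[OF kc]])
    \<comment> \<open>The element dual to \<beta> has the single coefficient \<open>g'\<close>, so
      each entry of its model is a monomial and the functional can be evaluated on it.\<close>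
    have dual: "hinner (ell2 V) (coeff \<beta> k) g' = hinner (ell2 V) ?h g'" if g': "wandering g'" for g'
    proof -
      obtain b where b: "finitely_supported b" "\<And>\<alpha>. coeff \<alpha> b = (if \<alpha> = \<beta> then g' else (\<lambda>v. 0))"
        "\<And>f. hinner (ell2 V) f b = hinner (ell2 V) (coeff \<beta> f) g'"
        using coeff_dual[OF wandering_finitely_supported[OF g'] g'] by blast
      have bc: "b \<in> hcarrier (ell2 V)"
        by (rule ell2_finite_support(1)[of "{v. b v \<noteq> 0}"])
          (use b(1) in \<open>auto simp: finitely_supported_def vanishes_off_def\<close>)
      have "model b w v = ?\<omega> (mdepth T v) * g' v * mpower w \<beta>" for v
      proof -
        have "((\<lambda>\<alpha>. model_coeff b v \<alpha> * mpower w \<alpha>) has_sum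
            (\<Sum>\<alpha>\<in>{\<beta>}. model_coeff b v \<alpha> * mpower w \<alpha>)) UNIV"
          by (rule has_sum_finite_neutralI[where B = "{\<beta>}"]) (auto simp: model_coeff_def b(2))
        then have "(\<Sum>\<^sub>\<infinity>\<alpha>. model_coeff b v \<alpha> * mpower w \<alpha>) = model_coeff b v \<beta> * mpower w \<beta>"
          by (simp add: infsumI)
        then show ?thesis using w by (simp add: model_def model_coeff_def b(2))
      qed
      then have "?\<phi> b = (\<Sum>v\<in>core. ?\<omega> (mdepth T v) * g' v * mpower w \<beta> * cnj (g v))"
        unfolding \<phi> by simp
      then have "cnj (?\<phi> b) = hinner (ell2 V) ?h g'"
        unfolding core_pairing[OF g'] by (simp add: mult_ac)
      moreover have "hinner (ell2 V) (coeff \<beta> k) g' = cnj (?\<phi> b)"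
        using b(3)[of k] ell2.inner_commute[OF kc bc] k[OF bc] by simp
      ultimately show ?thesis by simp
    qed
    \<comment> \<open>The difference lies in the joint kernel, so it may be tested against
      itself.\<close>
    have "coeff \<beta> k - ?h = 0"
    proof (rule ccontr)
      assume nz: "coeff \<beta> k - ?h \<noteq> 0"
      have "down j (coeff \<beta> k - ?h) = (\<lambda>v. 0)" for j
        using ck h by (simp add: wandering_def down_minus fun_eq_iff)
      then have d: "wandering (coeff \<beta> k - ?h)"
        using ck h by (simp add: wandering_def vanishes_off_diff)
      have "hinner (ell2 V) (coeff \<beta> k - ?h) (coeff \<beta> k - ?h) = 0"
        using dual[OF d] ell2.inner_diff[OF wandering_ell2[OF ck] wandering_ell2[OF h] wandering_ell2[OF d]]
        by simp
      then show False using ell2.inner_pos[OF wandering_ell2[OF d] nz] by simp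
    qed
    then have "(coeff \<beta> k - ?h) v = 0" by simp
    then show ?thesis by simp
  qed
  then have mc: "model_coeff k v \<alpha> =
      complex_of_real (kernel_coeff (mdepth T v) \<alpha>) * cnj (mpower w \<alpha>) * g v" for v \<alpha>
    using kernel_coeff_pos[of "mdepth T v" \<alpha>]
    by (simp add: model_coeff_def mult.assoc[symmetric] flip: of_real_mult)
  have "model k z = kappa z w g" if z: "z \<in> ball 0 radius" for z
  proof
    fix v
    have "model k z v = (\<Sum>\<^sub>\<infinity>\<alpha>. g v * kernel_term c (mdepth T v) z w \<alpha>)"
      using z by (simp add: model_def mc kernel_term_eq mult_ac)
    then show "model k z v = kappa z w g v"
      by (simp add: kappa_def kernel_sum_def infsum_cmult_right' mult.commute)
  qed
  then have "model k = (\<lambda>z. if z \<in> ball 0 radius then kappa z w g else 0)"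
    by (auto simp: fun_eq_iff) (simp add: model_def)
  then show ?thesis using that[of k] kc k by blast
qed

lemma reproducing_kernel_model: "reproducing_kernel E (ball 0 radius) model_space kappa"
  unfolding reproducing_kernel_def
proof (intro conjI ballI)
  show "bounded_operator E E (kappa z w)" for z w by (rule kappa_bounded)
next
  fix w :: "complex ^ 'd" and g assume w: "w \<in> ball 0 radius" and "g \<in> hcarrier E"
  then have g: "wandering g" by (simp add: E_carrier)
  obtain k where k: "k \<in> hcarrier (ell2 V)"
    "model k = (\<lambda>z. if z \<in> ball 0 radius then kappa z w g else 0)"
    "\<And>f. f \<in> hcarrier (ell2 V) \<Longrightarrow> hinner (ell2 V) (model f w) g = hinner (ell2 V) f k"
    using kernel_function[OF w g] by blast
  show "(\<lambda>z. if z \<in> ball 0 radius then kappa z w g else 0) \<in> hcarrier model_space"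
    unfolding k(2)[symmetric] model_space_simps using k(1) by blast
  show "hinner model_space F (\<lambda>z. if z \<in> ball 0 radius then kappa z w g else 0) = hinner E (F w) g"
    if F: "F \<in> hcarrier model_space" for F
  proof -
    obtain f where "f \<in> hcarrier (ell2 V)" "F = model f" using F by (auto simp: model_space_simps)
    then show ?thesis unfolding k(2)[symmetric] using k(1,3) by (simp add: model_space(4) E_simps)
  qed
qed

text \<open>As all values are supported in \<open>core\<close>, the vector-valued derivative is
  assembled from finitely many scalar expansions with the same linear coefficients.\<close>

lemma holomorphic_model:
  assumes f: "f \<in> hcarrier (ell2 V)"
  shows "holomorphic_into E (ball 0 radius) (model f)"
  unfolding holomorphic_into_def
proof (intro conjI ballI)
  show "model f z \<in> hcarrier E" if "z \<in> ball 0 radius" for z by (rule model_in_E[OF f that])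
next
  fix z :: "complex ^ 'd" assume z: "z \<in> ball 0 radius"
  \<comment> \<open>Half the distance to the boundary leaves room for the majorant on the polydisc
    of radius \<open>s\<close> and keeps increments of norm at most \<open>s\<close> inside the
    ball.\<close>
  define s where "s = (radius - norm z) / 2"
  have s: "0 < s" "norm z + s < radius" using z by (auto simp: s_def field_simps)
  have zs: "cmod (z $ j) + s \<le> radius" for j
    using Finite_Cartesian_Product.norm_nth_le[of z j] s by simp
  obtain cf :: "('d \<Rightarrow> nat) \<Rightarrow> 'd \<Rightarrow> complex" where
    cs: "\<And>a j. (\<lambda>\<alpha>. cmod (a \<alpha>) * radius ^ msize \<alpha>) summable_on UNIV \<Longrightarrow>
       (\<lambda>\<alpha>. a \<alpha> * cf \<alpha> j) summable_on UNIV" and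
    ce: "\<And>a h. (\<lambda>\<alpha>. cmod (a \<alpha>) * radius ^ msize \<alpha>) summable_on UNIV \<Longrightarrow> norm h \<le> s \<Longrightarrow>
       cmod ((\<Sum>\<^sub>\<infinity>\<alpha>. a \<alpha> * mpower (z + h) \<alpha>) - (\<Sum>\<^sub>\<infinity>\<alpha>. a \<alpha> * mpower z \<alpha>) -
         (\<Sum>j\<in>UNIV. h $ j * (\<Sum>\<^sub>\<infinity>\<alpha>. a \<alpha> * cf \<alpha> j)))
       \<le> (norm h / s)\<^sup>2 * (\<Sum>\<^sub>\<infinity>\<alpha>. cmod (a \<alpha>) * radius ^ msize \<alpha>)"
    using multi_series_first_order[OF s(1) zs] by blast
  define A where "A j v = (\<Sum>\<^sub>\<infinity>\<alpha>. model_coeff f v \<alpha> * cf \<alpha> j)" for j v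
  define B where "B v = (\<Sum>\<^sub>\<infinity>\<alpha>. cmod (model_coeff f v \<alpha>) * radius ^ msize \<alpha>)" for v
  have A: "wandering (A j)" for j
    unfolding A_def[abs_def]
    by (rule wandering_infsum[OF wandering_model_coeff[OF ell2_vanishes[OF f]] cs[OF model_coeff_summable[OF f]]])
  let ?R = "\<lambda>w. model f w - model f z - (\<Sum>j\<in>UNIV. hscale E (w $ j - z $ j) (A j))"
  have sum_apply: "(\<Sum>j\<in>J. g j) v = (\<Sum>j\<in>J. g j v)" for g :: "'d \<Rightarrow> ('d \<Rightarrow> 'a) \<Rightarrow> complex" and J v
    by (induction J rule: infinite_finite_induct) auto
  have R: "hnorm E (?R w) \<le> (\<Sum>v\<in>core. B v) * (norm (w - z) / s)\<^sup>2" if w: "norm (w - z) \<le> s" for w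
  proof -
    have wb: "w \<in> ball 0 radius" using norm_triangle_sub[of w z] w s by simp
    have "hnorm E (?R w) \<le> (\<Sum>v\<in>core. cmod (?R w v))"
      unfolding E_simps(3)
    proof (rule core_hnorm_bound)
      fix v assume v: "v \<notin> core"
      have "model f w v = 0" "model f z v = 0" "\<And>j. A j v = 0"
        using model_in_E[OF f wb] model_in_E[OF f z] A wandering_off_core[OF _ v] by (auto simp: E_carrier)
      then show "?R w v = 0" by (simp add: sum_apply E_simps)
    qed
    also have "\<dots> \<le> (\<Sum>v\<in>core. (norm (w - z) / s)\<^sup>2 * B v)"
    proof (rule sum_mono)
      fix v
      show "cmod (?R w v) \<le> (norm (w - z) / s)\<^sup>2 * B v"
        using ce[OF model_coeff_summable[OF f, of v] w] wb z
        by (simp add: model_def sum_apply E_simps A_def B_def)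
    qed
    finally show ?thesis unfolding sum_distrib_right by (simp only: mult.commute)
  qed
  have "((\<lambda>w. hnorm E (?R w) / norm (w - z)) \<longlongrightarrow> 0) (at z)"
  proof (rule Lim_null_comparison)
    show "\<forall>\<^sub>F w in at z. norm (hnorm E (?R w) / norm (w - z)) \<le> (\<Sum>v\<in>core. B v) / s\<^sup>2 * norm (w - z)"
      unfolding eventually_at
    proof (intro exI[of _ s] conjI ballI impI)
      fix w assume w: "w \<noteq> z \<and> dist w z < s"
      then have n: "0 < norm (w - z)" "norm (w - z) \<le> s" by (auto simp: dist_norm)
      have "hnorm E (?R w) / norm (w - z) \<le> (\<Sum>v\<in>core. B v) * (norm (w - z) / s)\<^sup>2 / norm (w - z)"
        using R[OF n(2)] n by (intro divide_right_mono) auto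
      also have "\<dots> = (\<Sum>v\<in>core. B v) / s\<^sup>2 * norm (w - z)"
        using n by (simp add: power2_eq_square)
      finally show "norm (hnorm E (?R w) / norm (w - z)) \<le> (\<Sum>v\<in>core. B v) / s\<^sup>2 * norm (w - z)"
        using ell2_hnorm_nonneg[of V "?R w"] by (simp add: E_simps(3))
    qed (rule s)
    have "((\<lambda>w. (\<Sum>v\<in>core. B v) / s\<^sup>2 * norm (w - z)) \<longlongrightarrow> (\<Sum>v\<in>core. B v) / s\<^sup>2 * norm (z - z)) (at z)"
      by (intro tendsto_intros)
    then show "((\<lambda>w. (\<Sum>v\<in>core. B v) / s\<^sup>2 * norm (w - z)) \<longlongrightarrow> 0) (at z)" by simp
  qed
  then show "\<exists>A. (\<forall>j. A j \<in> hcarrier E) \<and>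
      ((\<lambda>w. hnorm E (model f w - model f z - (\<Sum>j\<in>UNIV. hscale E (w $ j - z $ j) (A j))) / norm (w - z))
        \<longlongrightarrow> 0) (at z)"
    using A by (intro exI[of _ A]) (simp add: E_carrier)
qed

end

section \<open>The decomposition of the joint kernel\<close>

context weighted_multishift
begin

section \<open>Sibling classes\<close>

lemma Phi_vert: "u \<in> Phi T F \<Longrightarrow> u \<in> V"
  and Phi_root: "u \<in> Phi T F \<Longrightarrow> j \<in> F \<longleftrightarrow> u j \<noteq> root_of (T j)"
  and Phi_pverts: "u \<in> Phi T F \<Longrightarrow> u j \<in> pverts (T j)"
  by (auto simp: Phi_def product_verts_iff)

lemma sib_iff:
  assumes "x \<in> pverts (T j)" "x \<noteq> root_of (T j)"
  shows "x \<in> sib (T j) y \<longleftrightarrow> par (T j) x = par (T j) y"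
  unfolding sib_def
  using leafless_tree.Chi_par[OF tree assms] leafless_tree.par_Chi[OF tree, of x j] by metis

lemma sib_set_sym:
  assumes "u \<in> Phi T F" "v \<in> Phi T F"
  shows "u \<in> sib_set T F v \<longleftrightarrow> v \<in> sib_set T F u"
proof -
  have "u j \<in> sib (T j) (v j) \<longleftrightarrow> v j \<in> sib (T j) (u j)" if "j \<in> F" for j
    using assms that by (simp add: sib_iff Phi_root[symmetric] Phi_pverts eq_commute)
  then show ?thesis using assms by (auto simp: sib_set_def Phi_vert)
qed

lemma sib_set_Phi:
  assumes u: "u \<in> Phi T F" and v: "v \<in> sib_set T F u"
  shows "v \<in> Phi T F"
proof -
  have "j \<in> F \<longleftrightarrow> v j \<noteq> root_of (T j)" for j
  proof (cases "j \<in> F")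
    case True
    then have "v j \<in> Chi (T j) (par (T j) (u j))" using v by (simp add: sib_set_def sib_def)
    then show ?thesis using True leafless_tree.Chi_vert[OF tree] by blast
  next
    case False
    then have "v j = u j" using v by (simp add: sib_set_def)
    then show ?thesis using False Phi_root[OF u] by simp
  qed
  then show ?thesis using v by (simp add: Phi_def sib_set_def)
qed

text \<open>Siblings share a parent, hence a depth. Thus the scalar kernel series belongs to the
  class and not to its representative.\<close>

lemma mdepth_sib_set:
  assumes u: "u \<in> Phi T F" and v: "v \<in> sib_set T F u"
  shows "mdepth T v = mdepth T u"
proof
  fix j
  show "mdepth T v j = mdepth T u j"
  proof (cases "j \<in> F")
    case True
    then have "v j \<in> Chi (T j) (par (T j) (u j))" using v by (simp add: sib_set_def sib_def)
    moreover have "u j \<in> Chi (T j) (par (T j) (u j))"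
      using u True by (intro leafless_tree.Chi_par[OF tree] Phi_pverts[OF u]) (simp add: Phi_root[symmetric])
    ultimately show ?thesis using leafless_tree.depth_Chi[OF tree] by (simp add: mdepth_def)
  next
    case False
    then show ?thesis using v by (simp add: sib_set_def mdepth_def)
  qed
qed

lemma finite_sib_set: "finite (sib_set T F u)"
proof -
  have "sib_set T F u \<subseteq> (\<Pi>\<^sub>E j\<in>UNIV. insert (u j) (sib (T j) (u j)))"
    by (auto simp: sib_set_def)
  moreover have "finite \<dots>"
    using leafless_tree.finite_Chi[OF tree] by (intro finite_PiE) (auto simp: sib_def)
  ultimately show ?thesis by (rule finite_subset)
qed

lemma sib_set_V: "sib_set T F u \<subseteq> V"
  by (auto simp: sib_set_def)

lemma ell2_sib_set: "f \<in> hcarrier (ell2 (sib_set T F u)) \<longleftrightarrow> (\<forall>v. v \<notin> sib_set T F u \<longrightarrow> f v = 0)"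
  using finite_sib_set by (auto simp: ell2_simps summable_on_finite)

section \<open>Projections on the summands of the joint kernel\<close>

lemma L_space_subset_ell2: "f \<in> L_space T c u F \<Longrightarrow> f \<in> hcarrier (ell2 V)"
  by (rule ell2_finite_support(1)[OF finite_sib_set[of F u] sib_set_V])
    (auto simp: L_space_def ell2_sib_set)

lemma L_space_diff:
  assumes "f \<in> L_space T c u F" "g \<in> L_space T c u F"
  shows "f - g \<in> L_space T c u F"
  using assms by (simp add: L_space_def ell2_sib_set algebra_simps sum_subtractf)

lemma sib_at_eq: "sib_at T j q = Chi_at T j (q(j := par (T j) (q j)))"
  by (auto simp: sib_at_def Chi_at_def sib_def)

text \<open>Weights are constant along siblings, so the defining equation at \<open>j\<close> and
  \<open>p\<close> is a multiple of the vanishing of \<open>down j g\<close> at the common parent.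
  All siblings in the sum belong to the class, so restricting \<open>g\<close> does not change
  it.\<close>

lemma restrict_in_L_space:
  assumes u: "u \<in> Phi T F" and g: "wandering g"
  shows "(\<lambda>v. if v \<in> sib_set T F u then g v else 0) \<in> L_space T c u F"
  unfolding L_space_def mem_Collect_eq ell2_sib_set
proof (intro conjI ballI)
  fix j p assume j: "j \<in> F" and p: "p \<in> sib_restrict T F (F - {j}) u"
  let ?q = "p(j := u j)" and ?g = "\<lambda>v. if v \<in> sib_set T F u then g v else 0"
  let ?p = "par (T j) (u j)"
  let ?v = "p(j := ?p)"
  obtain v where v: "v \<in> sib_set T F u" "p = vrestrict T (F - {j}) v"
    using p by (auto simp: sib_restrict_def)
  \<comment> \<open>Outside \<open>F\<close> the restriction inserts the root, which is the
    coordinate of \<open>v\<close> already.\<close>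
  have pi: "p i = v i" if "i \<noteq> j" for i
  proof (cases "i \<in> F")
    case False
    then have "v i = root_of (T i)"
      using v(1) Phi_root[OF u, of i] by (simp add: sib_set_def)
    then show ?thesis using False by (simp add: v(2) vrestrict_def)
  qed (use that v(2) in \<open>simp add: vrestrict_def\<close>)
  have uj: "u j \<in> pverts (T j)" "u j \<noteq> root_of (T j)"
    using u j Phi_pverts Phi_root[OF u] by auto
  have vV: "v \<in> V" using v(1) sib_set_V by blast
  have eq: "?v = v(j := ?p)" using pi by (auto simp: fun_eq_iff)
  have vV': "?v \<in> V" unfolding eq using vV leafless_tree.par_vert[OF tree uj] by (rule upd_in_V)
  have mem: "?v(j := x) \<in> sib_set T F u" if "x \<in> Chi (T j) ?p" for x
  proof -
    have "v(j := x) \<in> V" using vV leafless_tree.Chi_vert[OF tree that] by (intro upd_in_V) auto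
    then show ?thesis using that v(1) j unfolding eq by (auto simp: sib_set_def sib_def)
  qed
  have "sib_at T j ?q = (\<lambda>x. ?v(j := x)) ` Chi (T j) ?p"
    using Chi_at_eq[OF vV', of j] by (simp add: sib_at_eq)
  moreover have "inj_on (\<lambda>x. ?v(j := x)) (Chi (T j) ?p)"
    by (rule inj_onI) (metis fun_upd_same)
  ultimately have "(\<Sum>w\<in>sib_at T j ?q. ?g w * complex_of_real (shift_weight T c j w)) =
      (\<Sum>x\<in>Chi (T j) ?p. ?g (?v(j := x)) * complex_of_real (shift_weight T c j (?v(j := x))))"
    by (simp only: sum.reindex o_def)
  also have "\<dots> = (\<Sum>x\<in>Chi (T j) ?p. g (?v(j := x)) *
      (complex_of_real (depth_weight j (mdepth T ?v)) / nchi j ?p))"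
    using mem shift_weight_child[OF vV', of _ j] by (intro sum.cong refl) simp
  also have "\<dots> = complex_of_real (depth_weight j (mdepth T ?v)) * down j g ?v"
    by (simp add: down_def sum_distrib_left sum_divide_distrib mult.commute)
  also have "\<dots> = 0" using g by (simp add: wandering_def)
  finally show "(\<Sum>w\<in>sib_at T j ?q. ?g w * complex_of_real (shift_weight T c j w)) = 0" .
qed simp

text \<open>What is cut off from \<open>g\<close> has support disjoint from the class, hence is
  orthogonal to everything supported there; uniqueness follows by testing the difference of two
  candidates on itself.\<close>

lemma projection_L_space:
  assumes u: "u \<in> Phi T F" and g: "wandering g"
  shows "orthogonal_projection E (L_space T c u F) g = (\<lambda>v. if v \<in> sib_set T F u then g v else 0)"
  unfolding orthogonal_projection_def E_simps
proof (rule the_equality)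
  let ?g = "\<lambda>v. if v \<in> sib_set T F u then g v else 0"
  have gL: "?g \<in> L_space T c u F" by (rule restrict_in_L_space[OF u g])
  have perp: "hinner (ell2 V) (g - ?g) z = 0" if "z \<in> L_space T c u F" for z
  proof -
    have "(g - ?g) v * cnj (z v) = 0" for v
      using that by (simp add: L_space_def ell2_sib_set)
    then show ?thesis unfolding ell2_simps by (intro infsum_0)
  qed
  then show "?g \<in> L_space T c u F \<and> (\<forall>z\<in>L_space T c u F. hinner (ell2 V) (g - ?g) z = 0)"
    using gL by blast
  fix y assume y: "y \<in> L_space T c u F \<and> (\<forall>z\<in>L_space T c u F. hinner (ell2 V) (g - y) z = 0)"
  let ?z = "y - ?g"
  have z: "?z \<in> L_space T c u F" using y gL L_space_diff by blast
  have c: "g \<in> hcarrier (ell2 V)" "y \<in> hcarrier (ell2 V)" "?g \<in> hcarrier (ell2 V)"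
    "?z \<in> hcarrier (ell2 V)"
    using wandering_ell2[OF g] L_space_subset_ell2 y gL z by blast+
  have "hinner (ell2 V) ?z ?z = hinner (ell2 V) (g - ?g) ?z - hinner (ell2 V) (g - y) ?z"
    by (simp only: ell2.inner_diff c) simp
  also have "\<dots> = 0" using perp[OF z] y z by simp
  finally have "?z = 0" using ell2.inner_pos[OF c(4)] by fastforce
  then show "y = ?g" by (simp only: right_minus_eq)
qed

text \<open>The set \<open>F\<close> is forced by the non-root coordinates of \<open>v\<close>, and
  within \<open>Phi T F\<close> symmetry of the sibling relation turns the transversal property
  around.\<close>

lemma transversal_class:
  assumes \<Omega>: "is_transversal T \<Omega>" and v: "v \<in> V"
  shows "\<exists>F u. u \<in> \<Omega> F \<and> v \<in> sib_set T F u \<and>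
    (\<forall>F' u'. u' \<in> \<Omega> F' \<and> v \<in> sib_set T F' u' \<longrightarrow> F' = F \<and> u' = u)"
proof -
  define F where "F = {j. v j \<noteq> root_of (T j)}"
  have vF: "v \<in> Phi T F" using v by (simp add: Phi_def F_def)
  have \<Omega>F: "u' \<in> Phi T F'" if "u' \<in> \<Omega> F'" for u' F'
    using \<Omega> that by (auto simp: is_transversal_def)
  have "\<exists>!u. u \<in> \<Omega> F \<and> u \<in> sib_set T F v" using \<Omega> vF by (simp add: is_transversal_def)
  then obtain u where u: "u \<in> \<Omega> F" "u \<in> sib_set T F v"
    and uniq: "\<And>u'. u' \<in> \<Omega> F \<Longrightarrow> u' \<in> sib_set T F v \<Longrightarrow> u' = u" by blast
  have "F' = F \<and> u' = u" if u': "u' \<in> \<Omega> F'" "v \<in> sib_set T F' u'" for F' u'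
  proof -
    have "v \<in> Phi T F'" by (rule sib_set_Phi[OF \<Omega>F[OF u'(1)] u'(2)])
    then have "F' = F" by (auto simp: Phi_def F_def)
    then show ?thesis using u' uniq sib_set_sym[OF \<Omega>F vF] by blast
  qed
  moreover have "v \<in> sib_set T F u" using u sib_set_sym[OF \<Omega>F[OF u(1)] vF] by simp
  ultimately show ?thesis using u by blast
qed

text \<open>Only finitely many summands are non-zero, because the joint kernel is supported in
  \<open>core\<close>.\<close>

lemma kernel_operator_sum:
  assumes \<Omega>: "is_transversal T \<Omega>"
  shows "operator_has_sum E
           (\<lambda>(F, u) g. hscale E (\<Sum>\<^sub>\<infinity>\<alpha>. kernel_term c (mdepth T u) z w \<alpha>)
                         (orthogonal_projection E (L_space T c u F) g))
           (SIGMA F:UNIV. \<Omega> F) (kappa z w)"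
proof -
  let ?I = "SIGMA F:UNIV. \<Omega> F"
  let ?A = "\<lambda>(F, u) g. hscale E (\<Sum>\<^sub>\<infinity>\<alpha>. kernel_term c (mdepth T u) z w \<alpha>)
      (orthogonal_projection E (L_space T c u F) g)"
  define X0 where "X0 = {(F, u). u \<in> \<Omega> F \<and> sib_set T F u \<inter> core \<noteq> {}}"
  have \<Omega>F: "u \<in> Phi T F" if "u \<in> \<Omega> F" for u F
    using \<Omega> that by (auto simp: is_transversal_def)
  have "finite {(F, u). u \<in> \<Omega> F \<and> v \<in> sib_set T F u}" if "v \<in> core" for v
  proof -
    have "v \<in> V" using that core_V by blast
    from transversal_class[OF \<Omega> this] obtain F u where
      "\<forall>F' u'. u' \<in> \<Omega> F' \<and> v \<in> sib_set T F' u' \<longrightarrow> F' = F \<and> u' = u"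
      by (elim exE conjE)
    then have "{(F, u). u \<in> \<Omega> F \<and> v \<in> sib_set T F u} \<subseteq> {(F, u)}" by blast
    then show ?thesis by (rule finite_subset) simp
  qed
  moreover have "X0 = (\<Union>v\<in>core. {(F, u). u \<in> \<Omega> F \<and> v \<in> sib_set T F u})"
    by (auto simp: X0_def)
  ultimately have X0: "finite X0" "X0 \<subseteq> ?I" using finite_core by (auto simp: X0_def)
  have main: "(\<Sum>i\<in>X. ?A i g) - kappa z w g = 0" if X: "finite X" "X0 \<subseteq> X" "X \<subseteq> ?I" and g: "wandering g" for X g
  proof
    fix v
    have "sum h J v = (\<Sum>i\<in>J. h i v)" for h :: "'i \<Rightarrow> ('d \<Rightarrow> 'a) \<Rightarrow> complex" and J
      by (induction J rule: infinite_finite_induct) auto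
    then have "(\<Sum>i\<in>X. ?A i g) v = (\<Sum>i\<in>X. ?A i g v)" .
    also have "\<dots> = (\<Sum>i\<in>X. if v \<in> sib_set T (fst i) (snd i) then kappa z w g v else 0)"
    proof (rule sum.cong[OF refl])
      fix i assume "i \<in> X"
      then obtain F u where i: "i = (F, u)" "u \<in> \<Omega> F" using X(3) by auto
      show "?A i g v = (if v \<in> sib_set T (fst i) (snd i) then kappa z w g v else 0)"
        using mdepth_sib_set[OF \<Omega>F[OF i(2)], of v]
        by (simp add: i(1) projection_L_space[OF \<Omega>F[OF i(2)] g] E_simps kappa_def kernel_sum_def)
    qed
    \<comment> \<open>A vertex lies in exactly one class, so at most one summand survives, and
      \<open>X0\<close> ensures that it is present for the vertices in \<open>core\<close>.\<close>
    also have "\<dots> = kappa z w g v"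
    proof (cases "v \<in> core")
      case True
      then have "v \<in> V" using core_V by blast
      from transversal_class[OF \<Omega> this] obtain F u where Fu: "u \<in> \<Omega> F" "v \<in> sib_set T F u"
        "\<forall>F' u'. u' \<in> \<Omega> F' \<and> v \<in> sib_set T F' u' \<longrightarrow> F' = F \<and> u' = u"
        by (elim exE conjE)
      have "(F, u) \<in> X0" using True Fu(1,2) by (auto simp: X0_def)
      then have "(F, u) \<in> X" using X(2) by blast
      moreover have "v \<in> sib_set T (fst i) (snd i) \<longleftrightarrow> i = (F, u)" if "i \<in> X" for i
      proof -
        obtain F' u' where i: "i = (F', u')" "u' \<in> \<Omega> F'" using \<open>i \<in> X\<close> X(3) by auto
        then show ?thesis using Fu(2) Fu(3)[rule_format, of u' F'] by auto
      qed
      ultimately show ?thesis using X(1) by (simp add: sum.delta' cong: sum.cong)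
    next
      case False
      then have "kappa z w g v = 0" using wandering_off_core[OF g] by (simp add: kappa_def)
      then show ?thesis by (simp cong: if_cong)
    qed
    finally show "((\<Sum>i\<in>X. ?A i g) - kappa z w g) v = 0 v" by simp
  qed
  show ?thesis
    unfolding operator_has_sum_def
  proof (intro allI impI)
    fix e :: real assume "0 < e"
    show "\<forall>\<^sub>F X in finite_subsets_at_top ?I. \<forall>g\<in>hcarrier E.
        hnorm E ((\<Sum>i\<in>X. ?A i g) - kappa z w g) \<le> e * hnorm E g"
      unfolding eventually_finite_subsets_at_top
    proof (intro exI[of _ X0] conjI allI impI ballI)
      fix X g assume "finite X \<and> X0 \<subseteq> X \<and> X \<subseteq> ?I" and "g \<in> hcarrier E"
      then have "(\<Sum>i\<in>X. ?A i g) - kappa z w g = 0" using main E_carrier by blast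
      then show "hnorm E ((\<Sum>i\<in>X. ?A i g) - kappa z w g) \<le> e * hnorm E g"
        using \<open>0 < e\<close> ell2_hnorm_nonneg[of V g] by (simp only:) (simp add: E_simps hnorm_def ell2_simps)
    qed (use X0 in auto)
  qed
qed

end

theorem theorem2p9:
  fixes T :: "'d::finite \<Rightarrow> 'a pair_pre_digraph"
    and c :: "nat \<Rightarrow> real"
    and S :: "'d \<Rightarrow> (('d \<Rightarrow> 'a) \<Rightarrow> complex) \<Rightarrow> (('d \<Rightarrow> 'a) \<Rightarrow> complex)"
    and \<Omega> :: "'d set \<Rightarrow> ('d \<Rightarrow> 'a) set"
    and E :: "(('d \<Rightarrow> 'a) \<Rightarrow> complex) hspace"
  assumes "\<And>j. rooted_directed_tree (T j)"
    and "\<And>j. locally_finite (T j)"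
    and "finite_joint_branching_index T"
    and "\<And>n. 0 < c n" and "0 < (INF n. c n)" and "bdd_above (range c)"
    and "is_multishift T c S"
    and "is_transversal T \<Omega>"
    and E_def: "E = joint_kernel T S"
  shows "\<exists>r>0. \<exists>(H :: (complex ^ 'd \<Rightarrow> ('d \<Rightarrow> 'a) \<Rightarrow> complex) hspace) \<kappa>.
      reproducing_kernel_space E (ball 0 r) H \<and>
      (\<forall>f\<in>hcarrier H. holomorphic_into E (ball 0 r) f) \<and>
      (\<forall>j. bounded_operator H H (mult_coord E j)) \<and>
      unitarily_equivalent (ell2 (product_verts T)) S H (mult_coord E) \<and>
      reproducing_kernel E (ball 0 r) H \<kappa> \<and>
      (\<forall>z\<in>ball 0 r. \<forall>w\<in>ball 0 r.
         (\<forall>F. \<forall>u\<in>\<Omega> F. kernel_term c (mdepth T u) z w summable_on UNIV) \<and>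
         operator_has_sum E
           (\<lambda>(F, u) g. hscale E (\<Sum>\<^sub>\<infinity>\<alpha>. kernel_term c (mdepth T u) z w \<alpha>)
                         (orthogonal_projection E (L_space T c u F) g))
           (SIGMA F:UNIV. \<Omega> F) (\<kappa> z w))"
proof -
  interpret M: weighted_multishift T c S
    by unfold_locales (use assms in \<open>auto intro!: leafless_tree.intro\<close>)
  have E: "E = M.E" by (simp add: E_def M.E_def)
  show ?thesis
    unfolding E
  proof (intro exI[of _ M.radius] exI[of _ M.model_space] exI[of _ M.kappa] conjI ballI allI)
    show "holomorphic_into M.E (ball 0 M.radius) f" if "f \<in> hcarrier M.model_space" for f
      using that M.holomorphic_model by (auto simp: M.model_space_simps)
  qed (auto intro: M.radius_pos M.reproducing_model_space M.mult_coord_bounded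
      M.unitarily_equivalent_model M.reproducing_kernel_model M.kernel_term_summable
      M.kernel_operator_sum assms)
qed

end
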